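(* Let $\mathfrak{g}$ be a finite-dimensional complex simple Lie algebra, and let $\lambda_1,\lambda_2,\mu_1,\mu_2\in P^+$. Let $a,b\in\mathbb{C}$ with $a\ne b$, and set $V=\operatorname{ev}_a^*V(\lambda_1)\otimes\operatorname{ev}_b^*V(\lambda_2)$ and $V'=\operatorname{ev}_a^*V(\mu_1)\otimes\operatorname{ev}_b^*V(\mu_2)$. Then $\operatorname{Ext}^2_{\mathfrak{g}[t]}(V,V')$ is finite-dimensional.
   Context: $\mathfrak{g}[t]=\mathfrak{g}\otimes_{\mathbb{C}}\mathbb{C}[t]$ with bracket $[x\otimes p,y\otimes q]=[x,y]\otimes pq$. Fix a Cartan subalgebra and simple roots of $\mathfrak{g}$; $P^+$ is the set of dominant integral weights and $V(\lambda)$ is the finite-dimensional irreducible $\mathfrak{g}$-module of highest weight $\lambda$. For $c\in\mathbb{C}$, $\operatorname{ev}_c:\mathfrak{g}[t]\to\mathfrak{g}$ is the Lie algebra homomorphism $x\otimes p\mapsto p(c)x$, and $\operatorname{ev}_c^*V$ is the pullback of a $\mathfrak{g}$-module $V$ along it. $\operatorname{Ext}_{\mathfrak{g}[t]}$ is taken in the category of all $U(\mathfrak{g}[t])$-modules. *)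

theory Defs
  imports
    Complex_Main
    "HOL-Library.Function_Algebras"
    "HOL-Library.Poly_Mapping"
    "HOL-Computational_Algebra.Polynomial"
begin

section \<open>Complex vector spaces\<close>

class complex_vector = ab_group_add +
  fixes scaleC :: "complex \<Rightarrow> 'a \<Rightarrow> 'a"  (infixr \<open>*\<^sub>C\<close> 75)
  assumes scaleC_add_right: "c *\<^sub>C (x + y) = c *\<^sub>C x + c *\<^sub>C y"
    and scaleC_add_left: "(c + c') *\<^sub>C x = c *\<^sub>C x + c' *\<^sub>C x"
    and scaleC_scaleC: "c *\<^sub>C (c' *\<^sub>C x) = (c * c') *\<^sub>C x"
    and scaleC_one: "1 *\<^sub>C x = x"

global_interpretation complex_vector:
  vector_space "scaleC :: complex \<Rightarrow> 'a \<Rightarrow> 'a::complex_vector"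
  by unfold_locales (simp_all add: scaleC_add_right scaleC_add_left scaleC_scaleC scaleC_one)

abbreviation clinear :: "('a::complex_vector \<Rightarrow> 'b::complex_vector) \<Rightarrow> bool"
  where "clinear f \<equiv> Vector_Spaces.linear scaleC scaleC f"

lemma clinear_iff:
  "clinear f \<longleftrightarrow> (\<forall>x y. f (x + y) = f x + f y) \<and> (\<forall>c x. f (c *\<^sub>C x) = c *\<^sub>C f x)"
  by (simp add: Vector_Spaces.linear_def module_hom_def module_hom_axioms_def
      complex_vector.vector_space_axioms complex_vector.module_axioms)

definition cbilinear :: "('a::complex_vector \<Rightarrow> 'b::complex_vector \<Rightarrow> 'c::complex_vector) \<Rightarrow> bool"
  where "cbilinear f \<longleftrightarrow> (\<forall>y. clinear (\<lambda>x. f x y)) \<and> (\<forall>x. clinear (f x))"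

definition finite_dimensional :: "'a::complex_vector set \<Rightarrow> bool"
  where "finite_dimensional S \<longleftrightarrow> (\<exists>B. finite B \<and> B \<subseteq> S \<and> S = complex_vector.span B)"

instantiation complex :: complex_vector
begin
definition "scaleC_complex (c::complex) (x::complex) = c * x"
instance by standard (simp_all add: scaleC_complex_def algebra_simps)
end

instantiation "fun" :: (type, complex_vector) complex_vector
begin
definition "scaleC_fun c f = (\<lambda>x. c *\<^sub>C f x)"
instance
  by standard (simp_all add: scaleC_fun_def fun_eq_iff scaleC_add_right scaleC_add_left
      scaleC_scaleC scaleC_one)
end

instantiation poly_mapping :: (type, complex_vector) complex_vector
begin
definition "scaleC_poly_mapping c (p :: 'a \<Rightarrow>\<^sub>0 'b) = Poly_Mapping.map (scaleC c) p"

lemma lookup_scaleC: "Poly_Mapping.lookup (c *\<^sub>C p) k = c *\<^sub>C Poly_Mapping.lookup p k"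
  by (simp add: scaleC_poly_mapping_def Poly_Mapping.map.rep_eq when_def)

instance
  by standard (simp_all add: poly_mapping_eq_iff fun_eq_iff lookup_scaleC lookup_add
      scaleC_add_right scaleC_add_left scaleC_scaleC scaleC_one)
end

instantiation poly :: (complex_vector) complex_vector
begin
definition "scaleC_poly c (p :: 'a poly) = map_poly (scaleC c) p"

lemma coeff_scaleC: "coeff (c *\<^sub>C p) n = c *\<^sub>C coeff p n"
  by (simp add: scaleC_poly_def coeff_map_poly)

instance
  by standard (simp_all add: poly_eq_iff coeff_scaleC
      scaleC_add_right scaleC_add_left scaleC_scaleC scaleC_one)
end


section \<open>Tensor products\<close>

inductive_set tensor_relations ::
  "(('a::complex_vector \<times> 'b::complex_vector) \<Rightarrow>\<^sub>0 complex) set" where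
  "Poly_Mapping.single (x + x', y) 1 - Poly_Mapping.single (x, y) 1 - Poly_Mapping.single (x', y) 1
    \<in> tensor_relations"
| "Poly_Mapping.single (x, y + y') 1 - Poly_Mapping.single (x, y) 1 - Poly_Mapping.single (x, y') 1
    \<in> tensor_relations"
| "Poly_Mapping.single (c *\<^sub>C x, y) 1 - Poly_Mapping.single (x, y) c \<in> tensor_relations"
| "Poly_Mapping.single (x, c *\<^sub>C y) 1 - Poly_Mapping.single (x, y) c \<in> tensor_relations"

quotient_type (overloaded) ('a, 'b) tensor =
  "('a::complex_vector \<times> 'b::complex_vector) \<Rightarrow>\<^sub>0 complex" /
  "\<lambda>p q. p - q \<in> complex_vector.span tensor_relations"
proof (rule equivpI)
  show "reflp (\<lambda>p q. p - q \<in> complex_vector.span tensor_relations)"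
    by (simp add: reflp_def complex_vector.span_zero)
  show "symp (\<lambda>p q. p - q \<in> complex_vector.span tensor_relations)"
    using complex_vector.span_neg by (fastforce simp: symp_def)
  show "transp (\<lambda>p q. p - q \<in> complex_vector.span tensor_relations)"
    using complex_vector.span_add by (fastforce simp: transp_def)
qed

instantiation tensor :: (complex_vector, complex_vector) complex_vector
begin

lift_definition zero_tensor :: "('a, 'b) tensor" is 0 .

lift_definition plus_tensor :: "('a, 'b) tensor \<Rightarrow> ('a, 'b) tensor \<Rightarrow> ('a, 'b) tensor" is "(+)"
  unfolding add_diff_add by (rule complex_vector.span_add)

lift_definition uminus_tensor :: "('a, 'b) tensor \<Rightarrow> ('a, 'b) tensor" is uminus
  unfolding minus_diff_minus by (rule complex_vector.span_neg)

lift_definition minus_tensor :: "('a, 'b) tensor \<Rightarrow> ('a, 'b) tensor \<Rightarrow> ('a, 'b) tensor" is "(-)"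
proof -
  fix p p' q q' :: "('a \<times> 'b) \<Rightarrow>\<^sub>0 complex"
  assume "p - p' \<in> complex_vector.span tensor_relations"
    and "q - q' \<in> complex_vector.span tensor_relations"
  then have "(p - p') - (q - q') \<in> complex_vector.span tensor_relations"
    by (rule complex_vector.span_diff)
  then show "p - q - (p' - q') \<in> complex_vector.span tensor_relations"
    by (simp add: algebra_simps)
qed

lift_definition scaleC_tensor :: "complex \<Rightarrow> ('a, 'b) tensor \<Rightarrow> ('a, 'b) tensor" is scaleC
  unfolding complex_vector.scale_right_diff_distrib[symmetric] by (rule complex_vector.span_scale)

instance
  by standard (transfer; simp add: complex_vector.span_zero scaleC_add_right scaleC_add_left
      scaleC_scaleC scaleC_one algebra_simps)+

end

lift_definition tensor_pair :: "'a::complex_vector \<Rightarrow> 'b::complex_vector \<Rightarrow> ('a, 'b) tensor"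
    (infixr \<open>\<otimes>\<^sub>C\<close> 70)
  is "\<lambda>x y. Poly_Mapping.single (x, y) 1" .

definition tensor_lift ::
  "('a::complex_vector \<Rightarrow> 'b::complex_vector \<Rightarrow> 'c::complex_vector) \<Rightarrow> ('a, 'b) tensor \<Rightarrow> 'c"
  where "tensor_lift f = (THE F. clinear F \<and> (\<forall>x y. F (x \<otimes>\<^sub>C y) = f x y))"

definition free_lift :: "('k \<Rightarrow> 'v::complex_vector) \<Rightarrow> ('k \<Rightarrow>\<^sub>0 complex) \<Rightarrow> 'v"
  where "free_lift f p = (\<Sum>k\<in>Poly_Mapping.keys p. Poly_Mapping.lookup p k *\<^sub>C f k)"

lemma free_lift_superset:
  assumes "finite S" "Poly_Mapping.keys p \<subseteq> S"
  shows "free_lift f p = (\<Sum>k\<in>S. Poly_Mapping.lookup p k *\<^sub>C f k)"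
  unfolding free_lift_def
  by (rule sum.mono_neutral_left) (use assms in \<open>auto simp: in_keys_iff\<close>)

lemma clinear_free_lift: "clinear (free_lift f)"
  unfolding clinear_iff
proof safe
  fix p q :: "'a \<Rightarrow>\<^sub>0 complex" and c
  let ?S = "Poly_Mapping.keys p \<union> Poly_Mapping.keys q"
  have S: "finite ?S" "Poly_Mapping.keys p \<subseteq> ?S" "Poly_Mapping.keys q \<subseteq> ?S"
    "Poly_Mapping.keys (p + q) \<subseteq> ?S" "Poly_Mapping.keys (c *\<^sub>C p) \<subseteq> ?S"
    using Poly_Mapping.keys_add[of p q] by (auto simp: in_keys_iff lookup_scaleC)
  show "free_lift f (p + q) = free_lift f p + free_lift f q"
    unfolding free_lift_superset[OF S(1,2)] free_lift_superset[OF S(1,3)]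
      free_lift_superset[OF S(1,4)]
    by (simp add: lookup_add scaleC_add_left sum.distrib)
  show "free_lift f (c *\<^sub>C p) = c *\<^sub>C free_lift f p"
    unfolding free_lift_superset[OF S(1,2)] free_lift_superset[OF S(1,5)]
    by (simp add: lookup_scaleC scaleC_complex_def scaleC_scaleC complex_vector.scale_sum_right)
qed

lemma free_lift_single: "free_lift f (Poly_Mapping.single k c) = c *\<^sub>C f k"
  by (simp add: free_lift_def)

lemma poly_mapping_additive_eqI:
  fixes F G :: "('k \<Rightarrow>\<^sub>0 'a::ab_group_add) \<Rightarrow> 'b::ab_group_add"
  assumes "\<And>p q. F (p + q) = F p + F q" "\<And>p q. G (p + q) = G p + G q"
    and "\<And>k c. F (Poly_Mapping.single k c) = G (Poly_Mapping.single k c)"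
  shows "F p = G p"
proof (induction p rule: Poly_Mapping.update_induct)
  case const
  have "F 0 = 0" "G 0 = 0" using assms(1)[of 0 0] assms(2)[of 0 0] by simp_all
  then show ?case by simp
next
  case (update f a b)
  have "Poly_Mapping.update a b f = f + Poly_Mapping.single a b"
    using update(1)
    by (auto simp: poly_mapping_eq_iff fun_eq_iff lookup_add lookup_update lookup_single
        in_keys_iff when_def)
  with update assms show ?case by simp
qed

lemma scaleC_single: "c *\<^sub>C Poly_Mapping.single k x = Poly_Mapping.single k (c *\<^sub>C x)"
  by (simp add: poly_mapping_eq_iff fun_eq_iff lookup_scaleC lookup_single when_def)

lemma cbilinear_tensor_pair: "cbilinear (\<otimes>\<^sub>C)"
  unfolding cbilinear_def clinear_iff
proof safe
  fix x x' :: 'a and y y' :: 'b and c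
  show "(x + x') \<otimes>\<^sub>C y = x \<otimes>\<^sub>C y + x' \<otimes>\<^sub>C y"
    by transfer (simp add: complex_vector.span_base tensor_relations.intros(1) flip: diff_diff_eq)
  show "x \<otimes>\<^sub>C (y + y') = x \<otimes>\<^sub>C y + x \<otimes>\<^sub>C y'"
    by transfer (simp add: complex_vector.span_base tensor_relations.intros(2) flip: diff_diff_eq)
  show "(c *\<^sub>C x) \<otimes>\<^sub>C y = c *\<^sub>C (x \<otimes>\<^sub>C y)"
    by transfer (simp add: scaleC_single scaleC_complex_def complex_vector.span_base
        tensor_relations.intros(3))
  show "x \<otimes>\<^sub>C (c *\<^sub>C y) = c *\<^sub>C (x \<otimes>\<^sub>C y)"
    by transfer (simp add: scaleC_single scaleC_complex_def complex_vector.span_base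
        tensor_relations.intros(4))
qed

lemma tensor_cases:
  obtains p where "t = abs_tensor p"
  using Quotient3_abs_rep[OF Quotient3_tensor, of t, symmetric] by (rule that)

lemma tensor_hom_eqI:
  assumes "clinear F" "clinear G" "\<And>x y. F (x \<otimes>\<^sub>C y) = G (x \<otimes>\<^sub>C y)"
  shows "F t = G t"
proof -
  have *: "F (abs_tensor p) = G (abs_tensor p)" for p
  proof (rule poly_mapping_additive_eqI[where F = "\<lambda>p. F (abs_tensor p)" and G = "\<lambda>p. G (abs_tensor p)"])
    show "F (abs_tensor (p + q)) = F (abs_tensor p) + F (abs_tensor q)"
      "G (abs_tensor (p + q)) = G (abs_tensor p) + G (abs_tensor q)" for p q
      using assms(1,2) by (simp_all add: clinear_iff flip: plus_tensor.abs_eq)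
    fix k :: "'a \<times> 'b" and c
    obtain x y where k: "k = (x, y)" by (cases k)
    have "abs_tensor (Poly_Mapping.single k c) = c *\<^sub>C (x \<otimes>\<^sub>C y)"
      by (simp add: k tensor_pair.abs_eq scaleC_tensor.abs_eq scaleC_single scaleC_complex_def)
    then show "F (abs_tensor (Poly_Mapping.single k c)) = G (abs_tensor (Poly_Mapping.single k c))"
      using assms by (simp add: clinear_iff)
  qed
  show ?thesis by (cases t rule: tensor_cases) (simp add: *)
qed

lemma tensor_universal:
  assumes "cbilinear f"
  shows "\<exists>!F. clinear F \<and> (\<forall>x y. F (x \<otimes>\<^sub>C y) = f x y)"
proof (rule ex_ex1I)
  let ?L = "free_lift (\<lambda>(x, y). f x y)"
  have L1: "?L (p + q) = ?L p + ?L q" "?L (c *\<^sub>C p) = c *\<^sub>C ?L p" for p q c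
    using clinear_free_lift[of "\<lambda>(x, y). f x y"] by (simp_all add: clinear_iff)
  have "?L (p - q) = ?L p - ?L q" for p q
    using L1(1)[of "p - q" q] by (simp add: algebra_simps)
  note L = L1 this
  have zero: "?L p = 0" if "p \<in> complex_vector.span tensor_relations" for p
    using that
  proof (induction rule: complex_vector.span_induct_alt)
    case base
    show ?case by (simp add: free_lift_def)
  next
    case (step c x y)
    from step(1) have "?L x = 0"
      using assms
      by cases (simp_all add: L free_lift_single cbilinear_def clinear_iff scaleC_one)
    with step show ?case by (simp add: L)
  qed
  have eq: "?L p = ?L q" if "p - q \<in> complex_vector.span tensor_relations" for p q
    using zero[OF that] by (simp add: L)
  define F where "F t = ?L (rep_tensor t)" for t
  have F: "F (abs_tensor p) = ?L p" for p
  proof -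
    have "abs_tensor (rep_tensor (abs_tensor p)) = abs_tensor p"
      by (rule Quotient3_abs_rep[OF Quotient3_tensor])
    then show ?thesis
      unfolding F_def tensor.abs_eq_iff by (rule eq)
  qed
  have add: "F (s + t) = F s + F t" for s t
    by (cases s rule: tensor_cases, cases t rule: tensor_cases)
      (simp add: plus_tensor.abs_eq F L)
  have scale: "F (c *\<^sub>C t) = c *\<^sub>C F t" for c t
    by (cases t rule: tensor_cases) (simp add: scaleC_tensor.abs_eq F L)
  show "\<exists>F. clinear F \<and> (\<forall>x y. F (x \<otimes>\<^sub>C y) = f x y)"
    using add scale
    by (intro exI[of _ F]) (simp add: clinear_iff tensor_pair.abs_eq F free_lift_single scaleC_one)
next
  fix F G :: "('a, 'b) tensor \<Rightarrow> 'c"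
  assume "clinear F \<and> (\<forall>x y. F (x \<otimes>\<^sub>C y) = f x y)" "clinear G \<and> (\<forall>x y. G (x \<otimes>\<^sub>C y) = f x y)"
  then have "F t = G t" for t by (intro tensor_hom_eqI[of F G t]) simp_all
  then show "F = G" by (simp add: fun_eq_iff)
qed


section \<open>Lie algebras\<close>

class complex_lie_algebra = complex_vector +
  fixes lie :: "'a \<Rightarrow> 'a \<Rightarrow> 'a"
  assumes lie_add_left: "lie (x + x') y = lie x y + lie x' y"
    and lie_add_right: "lie x (y + y') = lie x y + lie x y'"
    and lie_scaleC_left: "lie (c *\<^sub>C x) y = c *\<^sub>C lie x y"
    and lie_scaleC_right: "lie x (c *\<^sub>C y) = c *\<^sub>C lie x y"
    and lie_self: "lie x x = 0"
    and jacobi: "lie x (lie y z) + lie y (lie z x) + lie z (lie x y) = 0"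

lemma lie_zero_left [simp]: "lie 0 (y::'a::complex_lie_algebra) = 0"
  using lie_add_left[of 0 0 y] by simp

lemma lie_zero_right [simp]: "lie (x::'a::complex_lie_algebra) 0 = 0"
  using lie_add_right[of x 0 0] by simp

lemma lie_skew: "lie y x = - lie x (y::'a::complex_lie_algebra)"
proof -
  have "lie (x + y) (x + y) = lie y x + lie x y"
    unfolding lie_add_left lie_add_right by (simp add: lie_self)
  then have "lie y x + lie x y = 0"
    by (simp only: lie_self)
  then show ?thesis by (simp only: eq_neg_iff_add_eq_0)
qed

lemma lie_sum_left: "lie (sum f S) (y::'a::complex_lie_algebra) = (\<Sum>i\<in>S. lie (f i) y)"
  by (induction S rule: infinite_finite_induct) (simp_all add: lie_add_left)

lemma lie_sum_right: "lie (x::'a::complex_lie_algebra) (sum f S) = (\<Sum>i\<in>S. lie x (f i))"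
  by (induction S rule: infinite_finite_induct) (simp_all add: lie_add_right)

definition lie_ideal :: "'g::complex_lie_algebra set \<Rightarrow> bool"
  where "lie_ideal I \<longleftrightarrow> complex_vector.subspace I \<and> (\<forall>x. \<forall>y\<in>I. lie x y \<in> I)"

definition simple_lie_algebra :: "'g::complex_lie_algebra itself \<Rightarrow> bool"
  where "simple_lie_algebra _ \<longleftrightarrow>
    (\<exists>x y :: 'g. lie x y \<noteq> 0) \<and> (\<forall>I :: 'g set. lie_ideal I \<longrightarrow> I = {0} \<or> I = UNIV)"

definition lie_subalgebra :: "'g::complex_lie_algebra set \<Rightarrow> bool"
  where "lie_subalgebra K \<longleftrightarrow> complex_vector.subspace K \<and> (\<forall>x\<in>K. \<forall>y\<in>K. lie x y \<in> K)"

primrec lower_central_series :: "'g::complex_lie_algebra set \<Rightarrow> nat \<Rightarrow> 'g set"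
  where
    "lower_central_series K 0 = K"
  | "lower_central_series K (Suc n) =
      complex_vector.span {lie x y |x y. x \<in> K \<and> y \<in> lower_central_series K n}"

definition cartan_subalgebra :: "'g::complex_lie_algebra set \<Rightarrow> bool"
  where "cartan_subalgebra H \<longleftrightarrow>
    lie_subalgebra H \<and> (\<exists>n. lower_central_series H n = {0}) \<and>
    {x. \<forall>h\<in>H. lie x h \<in> H} = H"

text \<open>Linear functionals on a subspace \<open>H\<close> are represented by functions on the whole Lie algebra
  that vanish outside \<open>H\<close>; a sum of such functions then represents the sum of the functionals.\<close>

definition dual :: "'g::complex_vector set \<Rightarrow> ('g \<Rightarrow> complex) set"
  where "dual H = {f. (\<forall>x\<in>H. \<forall>y\<in>H. f (x + y) = f x + f y) \<and>
    (\<forall>c. \<forall>x\<in>H. f (c *\<^sub>C x) = c * f x) \<and> (\<forall>x. x \<notin> H \<longrightarrow> f x = 0)}"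

definition root_space :: "'g::complex_lie_algebra set \<Rightarrow> ('g \<Rightarrow> complex) \<Rightarrow> 'g set"
  where "root_space H \<alpha> = {x. \<forall>h\<in>H. lie h x = \<alpha> h *\<^sub>C x}"

definition roots :: "'g::complex_lie_algebra set \<Rightarrow> ('g \<Rightarrow> complex) set"
  where "roots H = {\<alpha> \<in> dual H. \<alpha> \<noteq> 0 \<and> root_space H \<alpha> \<noteq> {0}}"

definition nonneg_combinations :: "('g \<Rightarrow> complex) set \<Rightarrow> ('g \<Rightarrow> complex) set"
  where "nonneg_combinations \<Delta> =
    {\<beta>. \<exists>n :: ('g \<Rightarrow> complex) \<Rightarrow> nat. \<beta> = (\<Sum>\<alpha>\<in>\<Delta>. of_nat (n \<alpha>) *\<^sub>C \<alpha>)}"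

definition simple_roots :: "'g::complex_lie_algebra set \<Rightarrow> ('g \<Rightarrow> complex) set \<Rightarrow> bool"
  where "simple_roots H \<Delta> \<longleftrightarrow>
    finite \<Delta> \<and> \<Delta> \<subseteq> roots H \<and> \<not> complex_vector.dependent \<Delta> \<and>
    (\<forall>\<beta>\<in>roots H. \<beta> \<in> nonneg_combinations \<Delta> \<or> - \<beta> \<in> nonneg_combinations \<Delta>)"

definition positive_roots :: "'g::complex_lie_algebra set \<Rightarrow> ('g \<Rightarrow> complex) set \<Rightarrow> ('g \<Rightarrow> complex) set"
  where "positive_roots H \<Delta> = roots H \<inter> nonneg_combinations \<Delta>"

text \<open>The coroot of \<open>\<alpha>\<close> is the unique element of the line \<open>[g\<^sub>\<alpha>, g\<^sub>-\<^sub>\<alpha>]\<close> on which \<open>\<alpha>\<close> takes the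
  value 2.\<close>

definition coroot :: "'g::complex_lie_algebra set \<Rightarrow> ('g \<Rightarrow> complex) \<Rightarrow> 'g"
  where "coroot H \<alpha> =
    (THE h. h \<in> complex_vector.span {lie x y |x y. x \<in> root_space H \<alpha> \<and> y \<in> root_space H (- \<alpha>)}
      \<and> \<alpha> h = 2)"

definition dominant_integral_weights ::
  "'g::complex_lie_algebra set \<Rightarrow> ('g \<Rightarrow> complex) set \<Rightarrow> ('g \<Rightarrow> complex) set"
  where "dominant_integral_weights H \<Delta> = {\<mu> \<in> dual H. \<forall>\<alpha>\<in>\<Delta>. \<mu> (coroot H \<alpha>) \<in> \<nat>}"


section \<open>Lie algebra modules\<close>

definition lie_module :: "('l::complex_lie_algebra \<Rightarrow> 'v::complex_vector \<Rightarrow> 'v) \<Rightarrow> bool"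
  where "lie_module \<rho> \<longleftrightarrow>
    cbilinear \<rho> \<and> (\<forall>x y v. \<rho> (lie x y) v = \<rho> x (\<rho> y v) - \<rho> y (\<rho> x v))"

definition irreducible_lie_module ::
  "('l::complex_lie_algebra \<Rightarrow> 'v::complex_vector \<Rightarrow> 'v) \<Rightarrow> bool"
  where "irreducible_lie_module \<rho> \<longleftrightarrow>
    lie_module \<rho> \<and> (\<exists>v::'v. v \<noteq> 0) \<and>
    (\<forall>W. complex_vector.subspace W \<and> (\<forall>x. \<forall>w\<in>W. \<rho> x w \<in> W) \<longrightarrow> W = {0} \<or> W = UNIV)"

text \<open>\<open>is_V H \<Delta> \<mu> \<rho>\<close>: the module \<open>\<rho>\<close> is (a model of) the finite-dimensional irreducible module
  \<open>V(\<mu>)\<close>, which is determined by \<open>\<mu>\<close> up to isomorphism.\<close>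

definition is_V :: "'g::complex_lie_algebra set \<Rightarrow> ('g \<Rightarrow> complex) set \<Rightarrow> ('g \<Rightarrow> complex)
    \<Rightarrow> ('g \<Rightarrow> 'v::complex_vector \<Rightarrow> 'v) \<Rightarrow> bool"
  where "is_V H \<Delta> \<mu> \<rho> \<longleftrightarrow>
    irreducible_lie_module \<rho> \<and> finite_dimensional (UNIV :: 'v set) \<and>
    (\<exists>v. v \<noteq> 0 \<and> (\<forall>h\<in>H. \<rho> h v = \<mu> h *\<^sub>C v) \<and>
      (\<forall>\<alpha>\<in>positive_roots H \<Delta>. \<forall>x\<in>root_space H \<alpha>. \<rho> x v = 0))"

definition tensor_module :: "('l::complex_lie_algebra \<Rightarrow> 'v::complex_vector \<Rightarrow> 'v)
    \<Rightarrow> ('l \<Rightarrow> 'w::complex_vector \<Rightarrow> 'w) \<Rightarrow> 'l \<Rightarrow> ('v, 'w) tensor \<Rightarrow> ('v, 'w) tensor"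
  where "tensor_module \<rho> \<sigma> x = tensor_lift (\<lambda>v w. \<rho> x v \<otimes>\<^sub>C w + v \<otimes>\<^sub>C \<sigma> x w)"


section \<open>Current algebras and evaluation\<close>

text \<open>The current algebra \<open>g[t]\<close> is the type \<open>'g poly\<close> of polynomials with coefficients in \<open>'g\<close>;
  the tensor \<open>x \<otimes> p\<close> is \<open>current x p\<close>.  See \<open>lie_current\<close> and \<open>ev_current\<close> below for the bracket
  and the evaluation map on such tensors, and \<open>current_sum\<close> for the fact that they span.\<close>

lift_definition poly_lie :: "'g::complex_lie_algebra poly \<Rightarrow> 'g poly \<Rightarrow> 'g poly"
  is "\<lambda>p q n. \<Sum>i\<le>n. lie (p i) (q (n - i))"
proof -
  fix p q :: "nat \<Rightarrow> 'g"
  assume "\<forall>\<^sub>\<infinity>n. p n = 0" "\<forall>\<^sub>\<infinity>n. q n = 0"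
  then obtain M N where M: "\<And>n. n \<ge> M \<Longrightarrow> p n = 0" and N: "\<And>n. n \<ge> N \<Longrightarrow> q n = 0"
    by (auto simp: MOST_nat_le)
  have "(\<Sum>i\<le>n. lie (p i) (q (n - i))) = 0" if "n \<ge> M + N" for n
  proof (rule sum.neutral, rule ballI)
    fix i
    show "lie (p i) (q (n - i)) = 0"
      using M[of i] N[of "n - i"] that by (cases "i \<ge> M") auto
  qed
  then show "\<forall>\<^sub>\<infinity>n. (\<Sum>i\<le>n. lie (p i) (q (n - i))) = 0"
    by (auto simp: MOST_nat_le)
qed

lemma poly_lie_add_left: "poly_lie (p + p') q = poly_lie p q + poly_lie p' q"
  by (simp add: poly_eq_iff poly_lie.rep_eq lie_add_left sum.distrib)

lemma poly_lie_add_right: "poly_lie p (q + q') = poly_lie p q + poly_lie p q'"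
  by (simp add: poly_eq_iff poly_lie.rep_eq lie_add_right sum.distrib)

lemma poly_lie_monom: "poly_lie (monom x i) (monom y j) = monom (lie x y) (i + j)"
proof (rule poly_eqI)
  fix n
  have "coeff (poly_lie (monom x i) (monom y j)) n =
      (\<Sum>k\<le>n. if k = i then (if n - i = j then lie x y else 0) else 0)"
    unfolding poly_lie.rep_eq by (rule sum.cong) auto
  also have "\<dots> = coeff (monom (lie x y) (i + j)) n"
    by (auto simp: sum.delta)
  finally show "coeff (poly_lie (monom x i) (monom y j)) n = coeff (monom (lie x y) (i + j)) n" .
qed

lemma poly_additive_induct:
  fixes F :: "'a::ab_group_add poly \<Rightarrow> 'b::ab_group_add"
  assumes add: "\<And>p q. F (p + q) = F p + F q" and monom: "\<And>x i. F (monom x i) = 0"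
  shows "F p = 0"
proof -
  have "F 0 = 0" using add[of 0 0] by simp
  then have "F (sum f S) = (\<Sum>i\<in>S. F (f i))" for f :: "nat \<Rightarrow> _" and S
    by (induction S rule: infinite_finite_induct) (simp_all add: add)
  then have "F (\<Sum>i\<le>degree p. monom (coeff p i) i) = 0" by (simp add: monom)
  then show ?thesis by (simp add: poly_as_sum_of_monoms)
qed

lemma poly_jacobi:
  "poly_lie p (poly_lie q r) + poly_lie q (poly_lie r p) + poly_lie r (poly_lie p q) = 0"
proof (rule poly_additive_induct[where p = p])
  fix x i
  show "poly_lie (monom x i) (poly_lie q r) + poly_lie q (poly_lie r (monom x i)) +
    poly_lie r (poly_lie (monom x i) q) = 0"
  proof (rule poly_additive_induct[where p = q])
    fix y j
    show "poly_lie (monom x i) (poly_lie (monom y j) r) + poly_lie (monom y j) (poly_lie r (monom x i)) +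
      poly_lie r (poly_lie (monom x i) (monom y j)) = 0"
    proof (rule poly_additive_induct[where p = r])
      fix z k
      show "poly_lie (monom x i) (poly_lie (monom y j) (monom z k)) +
        poly_lie (monom y j) (poly_lie (monom z k) (monom x i)) +
        poly_lie (monom z k) (poly_lie (monom x i) (monom y j)) = 0"
        using jacobi[of x y z] by (simp add: poly_lie_monom add_monom add_ac)
    qed (simp add: poly_lie_add_left poly_lie_add_right)
  qed (simp add: poly_lie_add_left poly_lie_add_right)
qed (simp add: poly_lie_add_left poly_lie_add_right)

lemma poly_lie_self: "poly_lie p p = 0"
proof (rule poly_eqI)
  fix n
  let ?S = "\<Sum>i\<le>n. lie (coeff p i) (coeff p (n - i))"
  have "?S = (\<Sum>i\<le>n. lie (coeff p (n - i)) (coeff p i))"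
    by (rule sum.reindex_bij_witness[of _ "\<lambda>i. n - i" "\<lambda>i. n - i"]) auto
  also have "\<dots> = - ?S"
    unfolding sum_negf[symmetric] by (rule sum.cong) (simp_all add: lie_skew[of "coeff p (n - _)"])
  finally have "?S + ?S = 0" by (simp add: eq_neg_iff_add_eq_0)
  moreover have "?S + ?S = 2 *\<^sub>C ?S"
    using scaleC_add_left[of 1 1 ?S] by (simp add: scaleC_one)
  ultimately show "coeff (poly_lie p p) n = coeff 0 n"
    by (simp add: poly_lie.rep_eq complex_vector.scale_eq_0_iff)
qed

instantiation poly :: (complex_lie_algebra) complex_lie_algebra
begin

definition "lie_poly = (poly_lie :: 'a poly \<Rightarrow> 'a poly \<Rightarrow> 'a poly)"

instance
proof
  fix x x' y z :: "'a poly" and c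
  show "lie (x + x') y = lie x y + lie x' y" "lie x (y + z) = lie x y + lie x z"
    by (simp_all add: lie_poly_def poly_lie_add_left poly_lie_add_right)
  show "lie (c *\<^sub>C x) y = c *\<^sub>C lie x y" "lie x (c *\<^sub>C y) = c *\<^sub>C lie x y"
    by (simp_all add: lie_poly_def poly_eq_iff poly_lie.rep_eq coeff_scaleC lie_scaleC_left
        lie_scaleC_right complex_vector.scale_sum_right)
  show "lie x x = 0" "lie x (lie y z) + lie y (lie z x) + lie z (lie x y) = 0"
    by (simp_all only: lie_poly_def poly_lie_self poly_jacobi)
qed

end

definition current :: "'g::complex_vector \<Rightarrow> complex poly \<Rightarrow> 'g poly"
  where "current x p = map_poly (\<lambda>c. c *\<^sub>C x) p"

definition ev :: "complex \<Rightarrow> 'g::complex_vector poly \<Rightarrow> 'g"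
  where "ev c f = (\<Sum>i\<le>degree f. c ^ i *\<^sub>C coeff f i)"

lemma coeff_current: "coeff (current x p) n = coeff p n *\<^sub>C x"
  by (simp add: current_def coeff_map_poly)

lemma lie_current: "lie (current x p) (current y q) = current (lie x y) (p * q)"
  by (simp add: poly_eq_iff lie_poly_def poly_lie.rep_eq coeff_current coeff_mult
      lie_scaleC_left lie_scaleC_right scaleC_scaleC complex_vector.scale_sum_left mult.commute)

lemma ev_current: "ev c (current x p) = poly p c *\<^sub>C x"
proof -
  have "degree (current x p) \<le> degree p"
    by (simp add: current_def map_poly_degree_leq)
  then have "ev c (current x p) = (\<Sum>i\<le>degree p. c ^ i *\<^sub>C coeff (current x p) i)"
    unfolding ev_def
    by (intro sum.mono_neutral_left) (auto simp: coeff_eq_0)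
  then show ?thesis
    by (simp add: coeff_current scaleC_scaleC poly_altdef complex_vector.scale_sum_left mult.commute)
qed

lemma current_sum: "f = (\<Sum>i\<le>degree f. current (coeff f i) (monom 1 i))"
proof -
  have "current x (monom 1 i) = monom x i" for x :: 'a and i
    by (simp add: poly_eq_iff coeff_current scaleC_one)
  then show ?thesis by (simp add: poly_as_sum_of_monoms)
qed

definition ev_pullback ::
  "complex \<Rightarrow> ('g::complex_lie_algebra \<Rightarrow> 'v \<Rightarrow> 'v) \<Rightarrow> 'g poly \<Rightarrow> 'v \<Rightarrow> 'v"
  where "ev_pullback c \<rho> f = \<rho> (ev c f)"


section \<open>Universal enveloping algebras\<close>

text \<open>The free associative algebra on a set is the monoid algebra of the free monoid of words.\<close>

datatype 'a fmonoid = FM "'a list"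

instantiation fmonoid :: (type) monoid_add
begin
definition "zero_fmonoid = FM []"
fun plus_fmonoid :: "'a fmonoid \<Rightarrow> 'a fmonoid \<Rightarrow> 'a fmonoid"
  where "FM xs + FM ys = FM (xs @ ys)"
instance
proof
  fix a b c :: "'a fmonoid"
  show "a + b + c = a + (b + c)" by (cases a; cases b; cases c) simp
  show "0 + a = a" "a + 0 = a" by (cases a; simp add: zero_fmonoid_def)+
qed
end

type_synonym 'a free_algebra = "'a fmonoid \<Rightarrow>\<^sub>0 complex"

definition free_gen :: "'a \<Rightarrow> 'a free_algebra"
  where "free_gen x = Poly_Mapping.single (FM [x]) 1"

inductive_set uea_ideal :: "'l::complex_lie_algebra free_algebra set" where
  "0 \<in> uea_ideal"
| "p \<in> uea_ideal \<Longrightarrow> q \<in> uea_ideal \<Longrightarrow> p + q \<in> uea_ideal"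
| "p \<in> uea_ideal \<Longrightarrow> r * p * s \<in> uea_ideal"
| "free_gen (x + y) - free_gen x - free_gen y \<in> uea_ideal"
| "free_gen (c *\<^sub>C x) - c *\<^sub>C free_gen x \<in> uea_ideal"
| "free_gen x * free_gen y - free_gen y * free_gen x - free_gen (lie x y) \<in> uea_ideal"

lemma uea_ideal_uminus: "p \<in> uea_ideal \<Longrightarrow> - p \<in> uea_ideal"
  using uea_ideal.intros(3)[of p "-1" 1] by simp

lemma uea_ideal_diff: "p \<in> uea_ideal \<Longrightarrow> q \<in> uea_ideal \<Longrightarrow> p - q \<in> uea_ideal"
  using uea_ideal.intros(2)[of p "- q"] uea_ideal_uminus[of q] by simp

primrec word_act :: "('l \<Rightarrow> 'v \<Rightarrow> 'v) \<Rightarrow> 'l fmonoid \<Rightarrow> 'v \<Rightarrow> 'v"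
  where "word_act \<rho> (FM xs) v = foldr \<rho> xs v"

definition free_act :: "('l \<Rightarrow> 'v::complex_vector \<Rightarrow> 'v) \<Rightarrow> 'l free_algebra \<Rightarrow> 'v \<Rightarrow> 'v"
  where "free_act \<rho> p v = free_lift (\<lambda>m. word_act \<rho> m v) p"

lemma word_act_add: "word_act \<rho> (m + n) v = word_act \<rho> m (word_act \<rho> n v)"
  by (cases m; cases n) simp

lemma word_act_linear:
  assumes "lie_module \<rho>"
  shows "word_act \<rho> m (v + w) = word_act \<rho> m v + word_act \<rho> m w"
    and "word_act \<rho> m (c *\<^sub>C v) = c *\<^sub>C word_act \<rho> m v"
proof -
  obtain xs where m: "m = FM xs" by (cases m)
  have "\<rho> x (v + w) = \<rho> x v + \<rho> x w" "\<rho> x (c *\<^sub>C v) = c *\<^sub>C \<rho> x v" for x v w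
    using assms by (auto simp: lie_module_def cbilinear_def clinear_iff)
  then have "foldr \<rho> xs (v + w) = foldr \<rho> xs v + foldr \<rho> xs w \<and>
      foldr \<rho> xs (c *\<^sub>C v) = c *\<^sub>C foldr \<rho> xs v"
    by (induction xs) auto
  then show "word_act \<rho> m (v + w) = word_act \<rho> m v + word_act \<rho> m w"
    "word_act \<rho> m (c *\<^sub>C v) = c *\<^sub>C word_act \<rho> m v"
    by (simp_all add: m)
qed

lemma free_act_add_left: "free_act \<rho> (p + q) v = free_act \<rho> p v + free_act \<rho> q v"
  using clinear_free_lift[of "\<lambda>m. word_act \<rho> m v"] by (simp add: free_act_def clinear_iff)

lemma free_act_scaleC_left: "free_act \<rho> (c *\<^sub>C p) v = c *\<^sub>C free_act \<rho> p v"
  using clinear_free_lift[of "\<lambda>m. word_act \<rho> m v"] by (simp add: free_act_def clinear_iff)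

lemma free_act_single: "free_act \<rho> (Poly_Mapping.single m c) v = c *\<^sub>C word_act \<rho> m v"
  by (simp add: free_act_def free_lift_single)

lemma free_act_diff_left: "free_act \<rho> (p - q) v = free_act \<rho> p v - free_act \<rho> q v"
  using free_act_add_left[of \<rho> "p - q" q v] by (simp add: algebra_simps)

lemma free_act_linear:
  assumes "lie_module \<rho>"
  shows "free_act \<rho> p (v + w) = free_act \<rho> p v + free_act \<rho> p w"
    and "free_act \<rho> p (c *\<^sub>C v) = c *\<^sub>C free_act \<rho> p v"
  unfolding free_act_def free_lift_def word_act_linear[OF assms]
  by (simp_all add: scaleC_add_right sum.distrib complex_vector.scale_sum_right scaleC_scaleC
      mult.commute)

lemma free_act_mult:
  assumes "lie_module \<rho>"
  shows "free_act \<rho> (p * q) v = free_act \<rho> p (free_act \<rho> q v)"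
proof (rule poly_mapping_additive_eqI[where p = p])
  fix m :: "'a fmonoid" and c :: complex
  show "free_act \<rho> (Poly_Mapping.single m c * q) v =
    free_act \<rho> (Poly_Mapping.single m c) (free_act \<rho> q v)"
  proof (rule poly_mapping_additive_eqI[where p = q])
    fix n :: "'a fmonoid" and c' :: complex
    show "free_act \<rho> (Poly_Mapping.single m c * Poly_Mapping.single n c') v =
      free_act \<rho> (Poly_Mapping.single m c) (free_act \<rho> (Poly_Mapping.single n c') v)"
      by (simp add: mult_single free_act_single word_act_add word_act_linear[OF assms]
          scaleC_scaleC mult.commute)
  qed (simp_all add: distrib_left free_act_add_left free_act_linear[OF assms])
qed (simp_all add: distrib_right free_act_add_left)

lemma free_act_gen: "free_act \<rho> (free_gen x) v = \<rho> x v"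
  by (simp add: free_gen_def free_act_single scaleC_one)

lemma free_act_one: "free_act \<rho> 1 v = v"
  by (simp add: free_act_single scaleC_one zero_fmonoid_def flip: single_one)

lemma free_act_uea_ideal:
  assumes \<rho>: "lie_module \<rho>" and "p \<in> uea_ideal"
  shows "free_act \<rho> p v = 0"
  using assms(2)
proof (induction arbitrary: v rule: uea_ideal.induct)
  case (3 p r s)
  have "free_act \<rho> r 0 = 0"
    using free_act_linear(2)[OF \<rho>, of r 0 0] by simp
  with 3 show ?case by (simp add: free_act_mult[OF \<rho>])
next
  case (4 x y)
  then show ?case
    using \<rho> by (simp add: free_act_diff_left free_act_gen lie_module_def cbilinear_def clinear_iff)
next
  case (5 c x)
  then show ?case
    using \<rho> by (simp add: free_act_diff_left free_act_gen free_act_scaleC_left lie_module_def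
        cbilinear_def clinear_iff)
next
  case (6 x y)
  then show ?case
    using \<rho> by (simp add: free_act_diff_left free_act_gen free_act_mult lie_module_def)
qed (simp_all add: free_act_def free_lift_def free_act_add_left[unfolded free_act_def free_lift_def])

quotient_type (overloaded) 'l uea =
  "'l::complex_lie_algebra free_algebra" / "\<lambda>p q. p - q \<in> uea_ideal"
proof (rule equivpI)
  show "reflp (\<lambda>p q. p - q \<in> (uea_ideal :: 'l free_algebra set))"
    by (simp add: reflp_def uea_ideal.intros(1))
  show "symp (\<lambda>p q. p - q \<in> (uea_ideal :: 'l free_algebra set))"
    using uea_ideal_uminus by (fastforce simp: symp_def)
  show "transp (\<lambda>p q. p - q \<in> (uea_ideal :: 'l free_algebra set))"
    using uea_ideal.intros(2) by (fastforce simp: transp_def)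
qed

instantiation uea :: (complex_lie_algebra) ring_1
begin

lift_definition zero_uea :: "'a uea" is 0 .

lift_definition one_uea :: "'a uea" is 1 .

lift_definition plus_uea :: "'a uea \<Rightarrow> 'a uea \<Rightarrow> 'a uea" is "(+)"
  unfolding add_diff_add by (rule uea_ideal.intros(2))

lift_definition uminus_uea :: "'a uea \<Rightarrow> 'a uea" is uminus
  unfolding minus_diff_minus by (rule uea_ideal_uminus)

lift_definition minus_uea :: "'a uea \<Rightarrow> 'a uea \<Rightarrow> 'a uea" is "(-)"
proof -
  fix p p' q q' :: "'a free_algebra"
  assume "p - p' \<in> uea_ideal" "q - q' \<in> uea_ideal"
  then have "(p - p') - (q - q') \<in> uea_ideal"
    by (rule uea_ideal_diff)
  then show "p - q - (p' - q') \<in> uea_ideal"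
    by (simp add: algebra_simps)
qed

lift_definition times_uea :: "'a uea \<Rightarrow> 'a uea \<Rightarrow> 'a uea" is "(*)"
proof -
  fix p p' q q' :: "'a free_algebra"
  assume "p - p' \<in> uea_ideal" "q - q' \<in> uea_ideal"
  then have "1 * (p - p') * q + p' * (q - q') * 1 \<in> uea_ideal"
    by (intro uea_ideal.intros(2) uea_ideal.intros(3))
  then show "p * q - p' * q' \<in> uea_ideal"
    by (simp add: algebra_simps)
qed

instance
proof
  have "lie_module (\<lambda>(x::'a) (z::complex). 0)"
    by (simp add: lie_module_def cbilinear_def clinear_iff)
  from free_act_uea_ideal[OF this, of 1 1] have "(1 :: 'a free_algebra) \<notin> uea_ideal"
    by (auto simp: free_act_one)
  then have "0 - 1 \<notin> (uea_ideal :: 'a free_algebra set)"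
    using uea_ideal_uminus[of "- 1"] by auto
  then show "(0 :: 'a uea) \<noteq> 1"
    by transfer
qed (transfer; simp add: uea_ideal.intros(1) algebra_simps)+

end

lift_definition uea_gen :: "'l::complex_lie_algebra \<Rightarrow> 'l uea" is free_gen .

lift_definition uea_scalar :: "complex \<Rightarrow> 'l::complex_lie_algebra uea" is "\<lambda>c. c *\<^sub>C 1" .

definition uea_module :: "('l::complex_lie_algebra uea \<Rightarrow> 'v::ab_group_add \<Rightarrow> 'v) \<Rightarrow> bool"
  where "uea_module A \<longleftrightarrow>
    (\<forall>u u' v. A (u + u') v = A u v + A u' v) \<and> (\<forall>u v v'. A u (v + v') = A u v + A u v') \<and>
    (\<forall>u u' v. A (u * u') v = A u (A u' v)) \<and> (\<forall>v. A 1 v = v)"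

text \<open>The module over the enveloping algebra that corresponds to the Lie algebra module \<open>\<rho>\<close>.\<close>

definition uea_act :: "('l::complex_lie_algebra \<Rightarrow> 'v::complex_vector \<Rightarrow> 'v) \<Rightarrow> 'l uea \<Rightarrow> 'v \<Rightarrow> 'v"
  where "uea_act \<rho> = (THE A. uea_module A \<and> (\<forall>c v. A (uea_scalar c) v = c *\<^sub>C v) \<and>
    (\<forall>x v. A (uea_gen x) v = \<rho> x v))"

lemma free_algebra_induct:
  assumes gen: "\<And>x. P (free_gen x)" and one: "P 1"
    and add: "\<And>p q. P p \<Longrightarrow> P q \<Longrightarrow> P (p + q)" and mult: "\<And>p q. P p \<Longrightarrow> P q \<Longrightarrow> P (p * q)"
    and scalar: "\<And>c. P (c *\<^sub>C 1)"
  shows "P p"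
proof -
  have word: "P (Poly_Mapping.single (FM xs) 1)" for xs
  proof (induction xs)
    case Nil
    show ?case using one by (simp add: zero_fmonoid_def flip: single_one)
  next
    case (Cons x xs)
    then have "P (free_gen x * Poly_Mapping.single (FM xs) 1)" by (intro mult gen)
    then show ?case by (simp add: free_gen_def mult_single)
  qed
  have single: "P (Poly_Mapping.single m c)" for m c
  proof -
    obtain xs where m: "m = FM xs" by (cases m)
    have "P ((c *\<^sub>C 1) * Poly_Mapping.single (FM xs) 1)" by (intro mult scalar word)
    then show ?thesis
      by (simp add: m scaleC_single mult_single scaleC_complex_def zero_fmonoid_def flip: single_one)
  qed
  show ?thesis
  proof (induction p rule: Poly_Mapping.update_induct)
    case const
    show ?case using scalar[of 0] by simp
  next
    case (update f a b)
    have "Poly_Mapping.update a b f = f + Poly_Mapping.single a b"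
      using update(1)
      by (auto simp: poly_mapping_eq_iff fun_eq_iff lookup_add lookup_update lookup_single
          in_keys_iff when_def)
    with update single add show ?case by simp
  qed
qed

lemma uea_cases:
  obtains p where "u = abs_uea p"
  using Quotient3_abs_rep[OF Quotient3_uea, of u, symmetric] by (rule that)

lemma uea_act_ex1:
  assumes \<rho>: "lie_module \<rho>"
  shows "\<exists>!A. uea_module A \<and> (\<forall>c v. A (uea_scalar c) v = c *\<^sub>C v) \<and> (\<forall>x v. A (uea_gen x) v = \<rho> x v)"
proof (rule ex_ex1I)
  define A where "A u v = free_act \<rho> (rep_uea u) v" for u v
  have A: "A (abs_uea p) v = free_act \<rho> p v" for p v
  proof -
    have "abs_uea (rep_uea (abs_uea p)) = abs_uea p"
      by (rule Quotient3_abs_rep[OF Quotient3_uea])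
    then have "rep_uea (abs_uea p) - p \<in> uea_ideal"
      by (simp only: uea.abs_eq_iff)
    from free_act_uea_ideal[OF \<rho> this, of v] show ?thesis
      by (simp add: A_def free_act_diff_left)
  qed
  have add: "A (u + u') v = A u v + A u' v" for u u' v
    by (cases u rule: uea_cases, cases u' rule: uea_cases)
      (simp add: plus_uea.abs_eq A free_act_add_left)
  have mult: "A (u * u') v = A u (A u' v)" for u u' v
    by (cases u rule: uea_cases, cases u' rule: uea_cases)
      (simp add: times_uea.abs_eq A free_act_mult[OF \<rho>])
  have add': "A u (v + w) = A u v + A u w" for u v w
    by (simp add: A_def free_act_linear[OF \<rho>])
  show "\<exists>A. uea_module A \<and> (\<forall>c v. A (uea_scalar c) v = c *\<^sub>C v) \<and> (\<forall>x v. A (uea_gen x) v = \<rho> x v)"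
    using add add' mult
    by (intro exI[of _ A]) (simp add: uea_module_def one_uea_def uea_scalar.abs_eq uea_gen.abs_eq A
        free_act_one free_act_gen free_act_scaleC_left)
next
  fix A A' :: "'a uea \<Rightarrow> 'b \<Rightarrow> 'b"
  assume A: "uea_module A \<and> (\<forall>c v. A (uea_scalar c) v = c *\<^sub>C v) \<and> (\<forall>x v. A (uea_gen x) v = \<rho> x v)"
    and A': "uea_module A' \<and> (\<forall>c v. A' (uea_scalar c) v = c *\<^sub>C v) \<and> (\<forall>x v. A' (uea_gen x) v = \<rho> x v)"
  have "\<forall>v. A (abs_uea p) v = A' (abs_uea p) v" for p
    by (induction p rule: free_algebra_induct)
      (use A A' in \<open>simp_all add: uea_module_def flip: plus_uea.abs_eq times_uea.abs_eq
        uea_gen.abs_eq uea_scalar.abs_eq one_uea_def\<close>)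
  then have "A u v = A' u v" for u v
    by (cases u rule: uea_cases) simp
  then show "A = A'"
    by (simp add: fun_eq_iff)
qed


section \<open>Projective resolutions and Ext\<close>

text \<open>\<open>'b \<Rightarrow>\<^sub>0 'l uea\<close> is the free left module on \<open>'b\<close>, with this action.\<close>

definition free_module_act :: "'l::complex_lie_algebra uea \<Rightarrow> ('b \<Rightarrow>\<^sub>0 'l uea) \<Rightarrow> 'b \<Rightarrow>\<^sub>0 'l uea"
  where "free_module_act u p = Poly_Mapping.map (\<lambda>c. u * c) p"

definition hom_on :: "'m set \<Rightarrow> ('u \<Rightarrow> 'm \<Rightarrow> 'm::ab_group_add)
    \<Rightarrow> ('u \<Rightarrow> 'n \<Rightarrow> 'n::ab_group_add) \<Rightarrow> ('m \<Rightarrow> 'n) \<Rightarrow> bool"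
  where "hom_on M A A' f \<longleftrightarrow>
    (\<forall>x\<in>M. \<forall>y\<in>M. f (x + y) = f x + f y) \<and> (\<forall>u. \<forall>x\<in>M. f (A u x) = A' u (f x))"

text \<open>Projective modules are the direct summands of free modules, that is, the images of idempotent
  endomorphisms of free modules.\<close>

definition projective :: "('b \<Rightarrow>\<^sub>0 'l::complex_lie_algebra uea) set \<Rightarrow> bool"
  where "projective P \<longleftrightarrow>
    (\<exists>e. hom_on UNIV free_module_act free_module_act e \<and> (\<forall>x. e (e x) = e x) \<and> P = range e)"

text \<open>A projective resolution \<open>\<dots> \<rightarrow> P 2 \<rightarrow> P 1 \<rightarrow> P 0 \<rightarrow> V \<rightarrow> 0\<close>, with \<open>d n : P (n + 1) \<rightarrow> P n\<close> and
  augmentation \<open>\<epsilon>\<close>.\<close>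

definition projective_resolution :: "('l::complex_lie_algebra uea \<Rightarrow> 'v::ab_group_add \<Rightarrow> 'v)
    \<Rightarrow> (nat \<Rightarrow> ('b \<Rightarrow>\<^sub>0 'l uea) set) \<Rightarrow> (nat \<Rightarrow> ('b \<Rightarrow>\<^sub>0 'l uea) \<Rightarrow> ('b \<Rightarrow>\<^sub>0 'l uea))
    \<Rightarrow> (('b \<Rightarrow>\<^sub>0 'l uea) \<Rightarrow> 'v) \<Rightarrow> bool"
  where "projective_resolution A P d \<epsilon> \<longleftrightarrow>
    (\<forall>n. projective (P n)) \<and>
    (\<forall>n. hom_on (P (Suc n)) free_module_act free_module_act (d n)) \<and>
    hom_on (P 0) free_module_act A \<epsilon> \<and>
    \<epsilon> ` P 0 = UNIV \<and>
    {x \<in> P 0. \<epsilon> x = 0} = d 0 ` P (Suc 0) \<and>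
    (\<forall>n. {x \<in> P (Suc n). d n x = 0} = d (Suc n) ` P (Suc (Suc n)))"

text \<open>Homomorphisms out of a submodule \<open>M\<close>, extended by zero so that they are determined by their
  values on \<open>M\<close>.\<close>

definition Hom_space :: "'m set \<Rightarrow> ('u \<Rightarrow> 'm \<Rightarrow> 'm::ab_group_add)
    \<Rightarrow> ('u \<Rightarrow> 'n \<Rightarrow> 'n::ab_group_add) \<Rightarrow> ('m \<Rightarrow> 'n) set"
  where "Hom_space M A A' = {f. hom_on M A A' f \<and> (\<forall>x. x \<notin> M \<longrightarrow> f x = 0)}"

definition ext_cocycles :: "(nat \<Rightarrow> ('b \<Rightarrow>\<^sub>0 'l::complex_lie_algebra uea) set)
    \<Rightarrow> (nat \<Rightarrow> ('b \<Rightarrow>\<^sub>0 'l uea) \<Rightarrow> ('b \<Rightarrow>\<^sub>0 'l uea)) \<Rightarrow> ('l uea \<Rightarrow> 'w::complex_vector \<Rightarrow> 'w) \<Rightarrow> nat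
    \<Rightarrow> (('b \<Rightarrow>\<^sub>0 'l uea) \<Rightarrow> 'w) set"
  where "ext_cocycles P d A n =
    {f \<in> Hom_space (P n) free_module_act A. \<forall>x\<in>P (Suc n). f (d n x) = 0}"

fun ext_coboundaries :: "(nat \<Rightarrow> ('b \<Rightarrow>\<^sub>0 'l::complex_lie_algebra uea) set)
    \<Rightarrow> (nat \<Rightarrow> ('b \<Rightarrow>\<^sub>0 'l uea) \<Rightarrow> ('b \<Rightarrow>\<^sub>0 'l uea)) \<Rightarrow> ('l uea \<Rightarrow> 'w::complex_vector \<Rightarrow> 'w) \<Rightarrow> nat
    \<Rightarrow> (('b \<Rightarrow>\<^sub>0 'l uea) \<Rightarrow> 'w) set"
  where
    "ext_coboundaries P d A 0 = {0}"
  | "ext_coboundaries P d A (Suc n) =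
      (\<lambda>g x. if x \<in> P (Suc n) then g (d n x) else 0) ` Hom_space (P n) free_module_act A"

definition ext_class :: "(nat \<Rightarrow> ('b \<Rightarrow>\<^sub>0 'l::complex_lie_algebra uea) set)
    \<Rightarrow> (nat \<Rightarrow> ('b \<Rightarrow>\<^sub>0 'l uea) \<Rightarrow> ('b \<Rightarrow>\<^sub>0 'l uea)) \<Rightarrow> ('l uea \<Rightarrow> 'w::complex_vector \<Rightarrow> 'w) \<Rightarrow> nat
    \<Rightarrow> (('b \<Rightarrow>\<^sub>0 'l uea) \<Rightarrow> 'w) \<Rightarrow> (('b \<Rightarrow>\<^sub>0 'l uea) \<Rightarrow> 'w) set"
  where "ext_class P d A n f = {f + b |b. b \<in> ext_coboundaries P d A n}"

text \<open>\<open>Ext P d A n\<close> is the \<open>n\<close>-th cohomology of the complex of homomorphisms from the resolution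
  \<open>P\<close>, \<open>d\<close> to the module \<open>A\<close>, as a set of cohomology classes.  If \<open>P\<close>, \<open>d\<close> resolves \<open>V\<close>, then this is
  the \<open>n\<close>-th Ext space from \<open>V\<close> to \<open>A\<close>.\<close>

definition Ext :: "(nat \<Rightarrow> ('b \<Rightarrow>\<^sub>0 'l::complex_lie_algebra uea) set)
    \<Rightarrow> (nat \<Rightarrow> ('b \<Rightarrow>\<^sub>0 'l uea) \<Rightarrow> ('b \<Rightarrow>\<^sub>0 'l uea)) \<Rightarrow> ('l uea \<Rightarrow> 'w::complex_vector \<Rightarrow> 'w) \<Rightarrow> nat
    \<Rightarrow> (('b \<Rightarrow>\<^sub>0 'l uea) \<Rightarrow> 'w) set set"
  where "Ext P d A n = ext_class P d A n ` ext_cocycles P d A n"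

text \<open>Taking classes is a linear map from the cocycles onto Ext, so the classes of the elements
  of \<open>complex_vector.span F\<close> are the linear combinations of the classes of the elements of \<open>F\<close>.\<close>

definition Ext_finite_dimensional :: "(nat \<Rightarrow> ('b \<Rightarrow>\<^sub>0 'l::complex_lie_algebra uea) set)
    \<Rightarrow> (nat \<Rightarrow> ('b \<Rightarrow>\<^sub>0 'l uea) \<Rightarrow> ('b \<Rightarrow>\<^sub>0 'l uea)) \<Rightarrow> ('l uea \<Rightarrow> 'w::complex_vector \<Rightarrow> 'w) \<Rightarrow> nat \<Rightarrow> bool"
  where "Ext_finite_dimensional P d A n \<longleftrightarrow>
    (\<exists>F. finite F \<and> F \<subseteq> ext_cocycles P d A n \<and>
      Ext P d A n = ext_class P d A n ` complex_vector.span F)"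


section \<open>The definitions apply to the modules in question\<close>

lemma clinear_ev: "clinear (ev c)"
proof -
  have ev: "ev c f = (\<Sum>i\<le>n. c ^ i *\<^sub>C coeff f i)" if "degree f \<le> n" for f :: "'a poly" and n
    unfolding ev_def by (rule sum.mono_neutral_left) (use that in \<open>auto simp: coeff_eq_0\<close>)
  show ?thesis
    unfolding clinear_iff
  proof safe
    fix f g :: "'a poly" and z
    let ?n = "max (degree f) (degree g)"
    have "degree (f + g) \<le> ?n" by (rule degree_add_le) simp_all
    then show "ev c (f + g) = ev c f + ev c g"
      by (simp add: ev[of _ ?n] scaleC_add_right sum.distrib)
    have "degree (z *\<^sub>C f) \<le> degree f"
      by (simp add: scaleC_poly_def map_poly_degree_leq)
    then show "ev c (z *\<^sub>C f) = z *\<^sub>C ev c f"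
      by (simp add: ev[of _ "degree f"] coeff_scaleC complex_vector.scale_sum_right scaleC_scaleC
          mult.commute)
  qed
qed

lemma ev_lie: "ev c (lie f g) = lie (ev c f) (ev c g)"
proof -
  have ev_sum: "ev c (sum h S) = (\<Sum>i\<in>S. ev c (h i))" for h :: "nat \<Rightarrow> 'a poly" and S
  proof (induction S rule: infinite_finite_induct)
    case (insert x S)
    then show ?case using clinear_ev[of c, where 'a = 'a] by (simp add: clinear_iff)
  qed (simp_all add: ev_def)
  let ?f = "\<lambda>i. current (coeff f i) (monom 1 i)" and ?g = "\<lambda>i. current (coeff g i) (monom 1 i)"
  have "ev c (lie (sum ?f {..degree f}) (sum ?g {..degree g})) =
      lie (ev c (sum ?f {..degree f})) (ev c (sum ?g {..degree g}))"
    by (simp add: lie_sum_left lie_sum_right ev_sum lie_current ev_current lie_scaleC_left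
        lie_scaleC_right scaleC_scaleC complex_vector.scale_sum_right mult.commute)
  then show ?thesis by (simp only: current_sum[symmetric])
qed

lemma lie_module_ev_pullback:
  assumes "lie_module \<rho>"
  shows "lie_module (ev_pullback c \<rho>)"
  using assms clinear_ev[of c, where 'a = 'a]
  by (simp add: lie_module_def ev_pullback_def ev_lie cbilinear_def clinear_iff)

lemma tensor_lift:
  assumes "cbilinear f"
  shows "clinear (tensor_lift f)" and "tensor_lift f (x \<otimes>\<^sub>C y) = f x y"
  using theI'[OF tensor_universal[OF assms]] by (simp_all add: tensor_lift_def)

lemma tensor_module_pair:
  assumes "lie_module \<rho>" "lie_module \<sigma>"
  shows "clinear (tensor_module \<rho> \<sigma> x)"
    and "tensor_module \<rho> \<sigma> x (v \<otimes>\<^sub>C w) = \<rho> x v \<otimes>\<^sub>C w + v \<otimes>\<^sub>C \<sigma> x w"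
proof -
  have "cbilinear (\<lambda>v w. \<rho> x v \<otimes>\<^sub>C w + v \<otimes>\<^sub>C \<sigma> x w)"
    using assms cbilinear_tensor_pair[where 'a = 'b and 'b = 'c]
    by (simp add: lie_module_def cbilinear_def clinear_iff scaleC_add_right add_ac)
  from tensor_lift[OF this] show "clinear (tensor_module \<rho> \<sigma> x)"
    "tensor_module \<rho> \<sigma> x (v \<otimes>\<^sub>C w) = \<rho> x v \<otimes>\<^sub>C w + v \<otimes>\<^sub>C \<sigma> x w"
    by (simp_all add: tensor_module_def)
qed

lemma lie_module_tensor_module:
  assumes "lie_module \<rho>" "lie_module \<sigma>"
  shows "lie_module (tensor_module \<rho> \<sigma>)"
proof -
  let ?T = "tensor_module \<rho> \<sigma>"
  note T = tensor_module_pair[OF assms]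
  have T': "?T x (s + t) = ?T x s + ?T x t" "?T x (c *\<^sub>C t) = c *\<^sub>C ?T x t" for x s t c
    using T(1) by (simp_all add: clinear_iff)
  have T'': "?T x (s - t) = ?T x s - ?T x t" for x s t
    using T'(1)[of x "s - t" t] by (simp add: algebra_simps)
  have P: "(v + v') \<otimes>\<^sub>C w = v \<otimes>\<^sub>C w + v' \<otimes>\<^sub>C w" "v \<otimes>\<^sub>C (w + w') = v \<otimes>\<^sub>C w + v \<otimes>\<^sub>C w'"
    "(c *\<^sub>C v) \<otimes>\<^sub>C w = c *\<^sub>C (v \<otimes>\<^sub>C w)" "v \<otimes>\<^sub>C (c *\<^sub>C w) = c *\<^sub>C (v \<otimes>\<^sub>C w)"
    for v v' :: 'b and w w' :: 'c and c
    using cbilinear_tensor_pair[where 'a = 'b and 'b = 'c]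
    by (simp_all add: cbilinear_def clinear_iff)
  have P': "(v - v') \<otimes>\<^sub>C w = v \<otimes>\<^sub>C w - v' \<otimes>\<^sub>C w" "v \<otimes>\<^sub>C (w - w') = v \<otimes>\<^sub>C w - v \<otimes>\<^sub>C w'"
    for v v' :: 'b and w w' :: 'c
    using P(1)[of "v - v'" v' w] P(2)[of v "w - w'" w'] by (simp_all add: algebra_simps)
  have R: "\<rho> (x + y) v = \<rho> x v + \<rho> y v" "\<rho> (c *\<^sub>C x) v = c *\<^sub>C \<rho> x v"
    "\<rho> (lie x y) v = \<rho> x (\<rho> y v) - \<rho> y (\<rho> x v)" for x y v c
    using assms(1) by (simp_all add: lie_module_def cbilinear_def clinear_iff)
  have S: "\<sigma> (x + y) v = \<sigma> x v + \<sigma> y v" "\<sigma> (c *\<^sub>C x) v = c *\<^sub>C \<sigma> x v"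
    "\<sigma> (lie x y) v = \<sigma> x (\<sigma> y v) - \<sigma> y (\<sigma> x v)" for x y v c
    using assms(2) by (simp_all add: lie_module_def cbilinear_def clinear_iff)
  have "?T (x + y) t = ?T x t + ?T y t" for x y t
    by (rule tensor_hom_eqI[where G = "\<lambda>t. ?T x t + ?T y t"])
      (simp_all add: clinear_iff T' T(2) R S P scaleC_add_right add_ac)
  moreover have "?T (c *\<^sub>C x) t = c *\<^sub>C ?T x t" for c x t
    by (rule tensor_hom_eqI[where G = "\<lambda>t. c *\<^sub>C ?T x t"])
      (simp_all add: clinear_iff T' T(2) R S P scaleC_add_right scaleC_scaleC mult.commute)
  moreover have "?T (lie x y) t = ?T x (?T y t) - ?T y (?T x t)" for x y t
    by (rule tensor_hom_eqI[where G = "\<lambda>t. ?T x (?T y t) - ?T y (?T x t)"])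
      (simp_all add: clinear_iff T' T(2) R S P P' complex_vector.scale_right_diff_distrib algebra_simps)
  ultimately show ?thesis
    by (simp add: lie_module_def cbilinear_def clinear_iff T')
qed

lemma uea_act:
  assumes "lie_module \<rho>"
  shows "uea_module (uea_act \<rho>)" and "uea_act \<rho> (uea_scalar c) v = c *\<^sub>C v"
    and "uea_act \<rho> (uea_gen x) v = \<rho> x v"
  using theI'[OF uea_act_ex1[OF assms]] by (simp_all add: uea_act_def)

text \<open>Every module over an enveloping algebra has a projective resolution by submodules of the free
  module on the following type: the generators of the resolution are the elements of the module in
  degree 0, and the formal linear combinations of generators that represent cycles in higher degrees.\<close>

datatype ('v, 'u) syzygy = Gen 'v | Rel "('u \<times> ('v, 'u) syzygy) list"

definition free_hom :: "('l::complex_lie_algebra uea \<Rightarrow> 'v::ab_group_add \<Rightarrow> 'v) \<Rightarrow> ('k \<Rightarrow> 'v)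
    \<Rightarrow> ('k \<Rightarrow>\<^sub>0 'l uea) \<Rightarrow> 'v"
  where "free_hom A f p = (\<Sum>k\<in>Poly_Mapping.keys p. A (Poly_Mapping.lookup p k) (f k))"

lemma uea_module_zero:
  assumes "uea_module A"
  shows "A 0 v = 0" "A u 0 = 0"
proof -
  have "A (0 + 0) v = A 0 v + A 0 v" "A u (0 + 0) = A u 0 + A u 0"
    using assms unfolding uea_module_def by blast+
  then show "A 0 v = 0" "A u 0 = 0" by simp_all
qed

lemma free_hom_add:
  assumes "uea_module A"
  shows "free_hom A f (p + q) = free_hom A f p + free_hom A f q"
proof -
  let ?S = "Poly_Mapping.keys p \<union> Poly_Mapping.keys q"
  have S: "free_hom A f r = (\<Sum>k\<in>?S. A (Poly_Mapping.lookup r k) (f k))"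
    if "Poly_Mapping.keys r \<subseteq> ?S" for r
    unfolding free_hom_def
    by (rule sum.mono_neutral_left) (use that in \<open>auto simp: in_keys_iff uea_module_zero[OF assms]\<close>)
  have "Poly_Mapping.keys (p + q) \<subseteq> ?S" by (rule Poly_Mapping.keys_add)
  then show ?thesis
    using assms by (simp add: S lookup_add uea_module_def sum.distrib)
qed

lemma free_hom_single:
  assumes "uea_module A"
  shows "free_hom A f (Poly_Mapping.single k u) = A u (f k)"
  by (simp add: free_hom_def uea_module_zero[OF assms])

lemma lookup_free_module_act:
  "Poly_Mapping.lookup (free_module_act u p) k = u * Poly_Mapping.lookup p k"
  by (simp add: free_module_act_def Poly_Mapping.map.rep_eq when_def)

lemma free_module_act_single:
  "free_module_act u (Poly_Mapping.single k c) = Poly_Mapping.single k (u * c)"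
  by (simp add: poly_mapping_eq_iff fun_eq_iff lookup_free_module_act lookup_single when_def)

lemma uea_module_free_module_act: "uea_module free_module_act"
  by (simp add: uea_module_def poly_mapping_eq_iff fun_eq_iff lookup_free_module_act lookup_add
      algebra_simps)

lemma free_hom_act:
  assumes "uea_module A"
  shows "free_hom A f (free_module_act u p) = A u (free_hom A f p)"
proof (rule poly_mapping_additive_eqI[where p = p])
  show "free_hom A f (free_module_act u (p + q)) =
      free_hom A f (free_module_act u p) + free_hom A f (free_module_act u q)"
    "A u (free_hom A f (p + q)) = A u (free_hom A f p) + A u (free_hom A f q)" for p q
    using assms uea_module_free_module_act[where 'a = 'a and 'b = 'c]
    by (simp_all add: uea_module_def free_hom_add[OF assms])
  show "free_hom A f (free_module_act u (Poly_Mapping.single k c)) =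
      A u (free_hom A f (Poly_Mapping.single k c))" for k c
    using assms by (simp add: free_module_act_single free_hom_single[OF assms]) (simp add: uea_module_def)
qed

lemma hom_on_free_hom: "uea_module A \<Longrightarrow> hom_on M free_module_act A (free_hom A f)"
  by (simp add: hom_on_def free_hom_add free_hom_act)

lemma free_hom_id: "free_hom free_module_act (\<lambda>k. Poly_Mapping.single k 1) p = p"
  by (rule poly_mapping_additive_eqI[where p = p and G = "\<lambda>p. p"])
    (simp_all add: free_hom_add free_hom_single uea_module_free_module_act free_module_act_single)

lemma sum_list_free:
  fixes p :: "'k \<Rightarrow>\<^sub>0 'l::complex_lie_algebra uea"
  assumes ks: "Poly_Mapping.keys p = set ks" "distinct ks"
  shows "(\<Sum>(u, k)\<leftarrow>map (\<lambda>k. (Poly_Mapping.lookup p k, k)) ks. Poly_Mapping.single k u) = p"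
proof -
  have "(\<Sum>(u, k)\<leftarrow>map (\<lambda>k. (Poly_Mapping.lookup p k, k)) ks. Poly_Mapping.single k u) =
      (\<Sum>k\<in>Poly_Mapping.keys p. Poly_Mapping.single k (Poly_Mapping.lookup p k))"
    unfolding ks(1) sum_list_distinct_conv_sum_set[OF ks(2), symmetric] by (simp add: o_def)
  also have "\<dots> = p"
    using free_hom_id[of p] by (simp add: free_hom_def free_module_act_single)
  finally show ?thesis .
qed

lemma projective_free:
  "projective {p :: 'b \<Rightarrow>\<^sub>0 'a::complex_lie_algebra uea. Poly_Mapping.keys p \<subseteq> B}"
proof -
  define e :: "('b \<Rightarrow>\<^sub>0 'a uea) \<Rightarrow> 'b \<Rightarrow>\<^sub>0 'a uea" where "e = free_hom free_module_act (\<lambda>k. if k \<in> B then Poly_Mapping.single k 1 else 0)"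
  have e: "Poly_Mapping.lookup (e p) k = (if k \<in> B then Poly_Mapping.lookup p k else 0)"
    for p :: "'b \<Rightarrow>\<^sub>0 'a uea" and k
    by (rule poly_mapping_additive_eqI[where F = "\<lambda>p. Poly_Mapping.lookup (e p) k"])
      (auto simp: e_def free_hom_add free_hom_single uea_module_free_module_act lookup_add
        free_module_act_single lookup_single when_def uea_module_zero)
  show ?thesis
    unfolding projective_def
  proof (intro exI[of _ e] conjI allI)
    show "hom_on UNIV free_module_act free_module_act e"
      unfolding e_def by (rule hom_on_free_hom[OF uea_module_free_module_act])
    show "e (e x) = e x" for x
      by (simp add: poly_mapping_eq_iff fun_eq_iff e)
    have "e p = p" if "Poly_Mapping.keys p \<subseteq> B" for p
      using that by (auto simp: poly_mapping_eq_iff fun_eq_iff e in_keys_iff)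
    then show "{p :: 'b \<Rightarrow>\<^sub>0 'a uea. Poly_Mapping.keys p \<subseteq> B} = range e"
    proof (intro equalityI subsetI)
      fix p assume "p \<in> {p :: 'b \<Rightarrow>\<^sub>0 'a uea. Poly_Mapping.keys p \<subseteq> B}"
      then have "p = e p" using \<open>\<And>p. Poly_Mapping.keys p \<subseteq> B \<Longrightarrow> e p = p\<close> by simp
      then show "p \<in> range e" by (rule range_eqI)
    qed (auto simp: in_keys_iff e split: if_splits)
  qed
qed

theorem ex_projective_resolution:
  fixes A :: "'l::complex_lie_algebra uea \<Rightarrow> 'v::ab_group_add \<Rightarrow> 'v"
  assumes A: "uea_module A"
  shows "\<exists>(P :: nat \<Rightarrow> (('v, 'l uea) syzygy \<Rightarrow>\<^sub>0 'l uea) set) d \<epsilon>. projective_resolution A P d \<epsilon>"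
proof -
  note F = uea_module_free_module_act
  define comb :: "('l uea \<times> ('v, 'l uea) syzygy) list \<Rightarrow> ('v, 'l uea) syzygy \<Rightarrow>\<^sub>0 'l uea"
    where "comb l = (\<Sum>(u, k)\<leftarrow>l. Poly_Mapping.single k u)" for l
  define \<epsilon> where "\<epsilon> = free_hom A (\<lambda>k :: ('v, 'l uea) syzygy. case k of Gen v \<Rightarrow> v | Rel l \<Rightarrow> 0)"
  define D where "D = free_hom free_module_act (\<lambda>k :: ('v, 'l uea) syzygy. case k of Gen v \<Rightarrow> 0 | Rel l \<Rightarrow> comb l)"
  define B where "B = rec_nat (range Gen) (\<lambda>n S. {Rel l |l. snd ` set l \<subseteq> S \<and>
      (if n = 0 then \<epsilon> (comb l) = 0 else D (comb l) = 0)})"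
  define P where "P n = {p :: ('v, 'l uea) syzygy \<Rightarrow>\<^sub>0 'l uea. Poly_Mapping.keys p \<subseteq> B n}" for n
  define Z where "Z n = {p \<in> P n. if n = 0 then \<epsilon> p = 0 else D p = 0}" for n
  have B0: "B 0 = range Gen" by (simp add: B_def)
  have keys_comb: "Poly_Mapping.keys (comb l) \<subseteq> snd ` set l" for l
  proof (induction l)
    case (Cons a l)
    obtain u k where a: "a = (u, k)" by (cases a)
    have "Poly_Mapping.keys (comb (a # l)) \<subseteq> Poly_Mapping.keys (Poly_Mapping.single k u) \<union> Poly_Mapping.keys (comb l)"
      unfolding comb_def a using Poly_Mapping.keys_add[of "Poly_Mapping.single k u"] by simp
    with Cons show ?case by (auto simp: a split: if_splits)
  qed (simp add: comb_def)
  have BS: "B (Suc n) = {Rel l |l. snd ` set l \<subseteq> B n \<and> comb l \<in> Z n}" for n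
  proof -
    have B_Suc: "B (Suc n) = {Rel l |l. snd ` set l \<subseteq> B n \<and>
        (if n = 0 then \<epsilon> (comb l) = 0 else D (comb l) = 0)}"
      unfolding B_def by simp
    have "comb l \<in> Z n \<longleftrightarrow> (if n = 0 then \<epsilon> (comb l) = 0 else D (comb l) = 0)"
      if "snd ` set l \<subseteq> B n" for l
      using that keys_comb[of l] unfolding Z_def P_def by blast
    then show ?thesis unfolding B_Suc by blast
  qed
  have D_hom: "D (p + q) = D p + D q" "D (free_module_act u p) = free_module_act u (D p)" for p q u
    by (simp_all add: D_def free_hom_add free_hom_act F)
  have \<epsilon>_hom: "\<epsilon> (p + q) = \<epsilon> p + \<epsilon> q" "\<epsilon> (free_module_act u p) = A u (\<epsilon> p)" for p q u
    by (simp_all add: \<epsilon>_def free_hom_add free_hom_act A)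
  have D0: "D 0 = 0" and \<epsilon>0: "\<epsilon> 0 = 0"
    using D_hom(1)[of 0 0] \<epsilon>_hom(1)[of 0 0] by simp_all
  have Z_zero: "0 \<in> Z n" for n
    by (simp add: Z_def P_def D0 \<epsilon>0)
  have Z_add: "p + q \<in> Z n" if "p \<in> Z n" "q \<in> Z n" for p q n
    using that Poly_Mapping.keys_add[of p q] by (auto simp: Z_def P_def D_hom \<epsilon>_hom split: if_splits)
  have Z_act: "free_module_act u p \<in> Z n" if "p \<in> Z n" for u p n
  proof -
    have "Poly_Mapping.keys (free_module_act u p) \<subseteq> Poly_Mapping.keys p"
      by (auto simp: in_keys_iff lookup_free_module_act)
    with that show ?thesis
      by (auto simp: Z_def P_def D_hom \<epsilon>_hom uea_module_zero[OF A] uea_module_zero[OF F] split: if_splits)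
  qed
  have exact: "Z n = D ` P (Suc n)" for n
  proof (intro equalityI subsetI)
    fix p assume p: "p \<in> Z n"
    obtain ks where ks: "Poly_Mapping.keys p = set ks" "distinct ks"
      using finite_distinct_list[of "Poly_Mapping.keys p"] by auto
    define l where "l = map (\<lambda>k. (Poly_Mapping.lookup p k, k)) ks"
    have comb: "comb l = p"
      unfolding comb_def l_def by (rule sum_list_free[OF ks])
    have "snd ` set l \<subseteq> B n"
      using p ks by (auto simp: l_def Z_def P_def)
    then have "Poly_Mapping.single (Rel l) 1 \<in> P (Suc n)"
      using comb p by (auto simp: P_def BS)
    moreover have "D (Poly_Mapping.single (Rel l) 1) = p"
      by (simp add: D_def free_hom_single F comb poly_mapping_eq_iff fun_eq_iff
          lookup_free_module_act)
    ultimately show "p \<in> D ` P (Suc n)" by (metis imageI)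
  next
    fix p assume "p \<in> D ` P (Suc n)"
    then obtain q where q: "q \<in> P (Suc n)" and p: "p = D q" by auto
    have "(\<Sum>k\<in>S. free_module_act (Poly_Mapping.lookup q k) (case k of Gen v \<Rightarrow> 0 | Rel l \<Rightarrow> comb l)) \<in> Z n"
      if "S \<subseteq> B (Suc n)" for S
      using that
      by (induction S rule: infinite_finite_induct) (auto simp: Z_zero BS intro!: Z_add Z_act)
    then show "p \<in> Z n"
      using q unfolding p D_def free_hom_def P_def by blast
  qed
  have "\<epsilon> (Poly_Mapping.single (Gen v) 1) = v" for v
    using A by (simp add: \<epsilon>_def free_hom_single[OF A]) (simp add: uea_module_def)
  moreover have "Poly_Mapping.single (Gen v) 1 \<in> P 0" for v
    by (simp add: P_def B0)
  ultimately have surj: "\<epsilon> ` P 0 = UNIV" by (metis UNIV_eq_I imageI)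
  have "projective_resolution A P (\<lambda>n. D) \<epsilon>"
    unfolding projective_resolution_def
  proof (intro conjI allI)
    show "projective (P n)" for n unfolding P_def by (rule projective_free)
    show "{x \<in> P 0. \<epsilon> x = 0} = D ` P (Suc 0)" using exact[of 0] by (simp add: Z_def)
    show "{x \<in> P (Suc n). D x = 0} = D ` P (Suc (Suc n))" for n using exact[of "Suc n"] by (simp add: Z_def)
  qed (simp_all add: surj hom_on_def D_hom \<epsilon>_hom)
  then show ?thesis by blast
qed

end

theory Submission
  imports Defs "HOL-Library.Product_Plus" "HOL-Computational_Algebra.Fundamental_Theorem_Algebra"
begin

text \<open>A class in the second Ext space is a cocycle on a projective resolution.  Comparing the
  resolution with the cochains of \<open>g[t]\<close> in low degrees turns it into a Lie algebra 2-cocycle with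
  values in \<open>Hom V V'\<close>, and this cocycle is the obstruction to a module structure on \<open>V' \<times> F\<close>, for a free
  module \<open>F\<close>, that splits the class.  The algebra \<open>g[t]\<close> is finitely presented in the strong sense
  that maps \<open>\<phi>\<^sub>i : g \<rightarrow> E\<close>, \<open>i \<le> 3\<close>, into a Lie algebra with \<open>[\<phi>\<^sub>i x, \<phi>\<^sub>j y] = \<phi>\<^sub>i\<^sub>+\<^sub>j [x, y]\<close> for \<open>i + j \<le> 3\<close>
  extend to all degrees.  So a class vanishes as soon as finitely many linear functionals, the
  coordinates of the 2-cocycle in total degree at most 3, vanish on it.

  The extension from degrees below \<open>n\<close> to degree \<open>n\<close> compares the bilinear maps
  \<open>B\<^sub>i x y = [\<phi>\<^sub>i x, \<phi>\<^sub>n\<^sub>-\<^sub>i y]\<close>.  By the Jacobi identity they all agree up to \<open>g\<close>-invariants that lie in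
  \<open>g N\<close> for a finite-dimensional \<open>g\<close>-module \<open>N\<close>; those are zero by a Casimir argument that rests on
  Cartan's criterion.  The common value is an alternating 2-cocycle of \<open>g\<close>, hence factors through
  the bracket.\<close>

section \<open>Linear algebra in finite-dimensional subspaces\<close>

text \<open>A full comparison with the Chevalley-Eilenberg complex would need its exactness; linear
  sections of \<open>\<epsilon>\<close>, \<open>d 0\<close> and \<open>d 1\<close> supply just the
  low-degree part. Let K be the kernel of \<epsilon> in \<open>P 0\<close>. By dimension shift a
  class is an extension of K by V', and it is zero exactly when this extension splits. A module on
  V' x F that restricts over K to the extension forces a splitting: F is free, so the projection
  onto F has an equivariant section. The maps \<phi>_i therefore take values in the endomorphisms of
  V' x F, an infinite-dimensional space where complete reducibility is not at hand. Finite dimension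
  is regained because, for fixed n, the brackets [\<phi>_i x, \<phi>_(n-i) y] with 0 < i < n span a
  finite-dimensional g-module. The constant 3 comes from the step to degree n: the B_i with 0 < i <
  n - 1 are shown to coincide, and B_1 is alternating because B_2 = B_1 = B_(n-2). An index 2 below
  n - 1 exists from n = 4 on.\<close>

global_interpretation complex_vector_pair:
  vector_space_pair "scaleC :: complex \<Rightarrow> 'a \<Rightarrow> 'a::complex_vector"
    "scaleC :: complex \<Rightarrow> 'b \<Rightarrow> 'b::complex_vector"
  by unfold_locales

abbreviation csubspace :: "'a::complex_vector set \<Rightarrow> bool"
  where "csubspace \<equiv> complex_vector.subspace"

abbreviation cspan :: "'a::complex_vector set \<Rightarrow> 'a set"
  where "cspan \<equiv> complex_vector.span"

abbreviation cindependent :: "'a::complex_vector set \<Rightarrow> bool"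
  where "cindependent B \<equiv> \<not> complex_vector.dependent B"

abbreviation cdim :: "'a::complex_vector set \<Rightarrow> nat"
  where "cdim \<equiv> complex_vector.dim"

lemmas clinear_add = complex_vector_pair.linear_add
lemmas clinear_scale = complex_vector_pair.linear_scale
lemmas clinear_0 = complex_vector_pair.linear_0
lemmas clinear_diff = complex_vector_pair.linear_diff
lemmas clinear_neg = complex_vector_pair.linear_neg
lemmas clinear_sum = complex_vector_pair.linear_sum
lemmas csubspace_simps = complex_vector.subspace_0 complex_vector.subspace_add
  complex_vector.subspace_scale complex_vector.subspace_diff complex_vector.subspace_neg

lemma clinearI:
  assumes "\<And>x y. f (x + y) = f x + f y" and "\<And>c x. f (c *\<^sub>C x) = c *\<^sub>C f x"
  shows "clinear f"
  using assms by (simp add: clinear_iff)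

lemma clinear_compose: "clinear f \<Longrightarrow> clinear g \<Longrightarrow> clinear (\<lambda>x. f (g x))"
  by (simp add: clinear_iff)

lemma clinear_add_fun: "clinear f \<Longrightarrow> clinear g \<Longrightarrow> clinear (\<lambda>x. f x + g x)"
  by (simp add: clinear_iff scaleC_add_right add_ac)

lemma clinear_diff_fun: "clinear f \<Longrightarrow> clinear g \<Longrightarrow> clinear (\<lambda>x. f x - g x)"
  by (simp add: clinear_iff complex_vector.scale_right_diff_distrib)

lemma clinear_scale_fun: "clinear f \<Longrightarrow> clinear (\<lambda>x. c *\<^sub>C f x)"
  by (simp add: clinear_iff scaleC_add_right scaleC_scaleC mult.commute)

lemma clinear_sum_fun: "(\<And>i. i \<in> I \<Longrightarrow> clinear (f i)) \<Longrightarrow> clinear (\<lambda>x. \<Sum>i\<in>I. f i x)"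
  by (simp add: clinear_iff sum.distrib complex_vector.scale_sum_right)

lemma clinear_id: "clinear (\<lambda>x. x)"
  by (simp add: clinear_iff)

lemma clinear_funpow: "clinear f \<Longrightarrow> clinear (f ^^ n)" for f :: "'a::complex_vector \<Rightarrow> 'a"
  by (induction n) (auto simp: clinear_iff)

lemma funpow_stable: "(\<And>w. w \<in> W \<Longrightarrow> f w \<in> W) \<Longrightarrow> w \<in> W \<Longrightarrow> (f ^^ n) w \<in> W"
  by (induction n) auto

text \<open>The spanning set may lie outside \<open>W\<close>, so the property passes to subspaces
  at once.\<close>

lemma finite_dimensional_iff_span:
  "finite_dimensional W \<longleftrightarrow> csubspace W \<and> (\<exists>B. finite B \<and> W \<subseteq> cspan B)" (is "?l \<longleftrightarrow> ?r")
proof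
  assume ?r
  then obtain B where W: "csubspace W" and B: "finite B" "W \<subseteq> cspan B" by blast
  obtain C where C: "C \<subseteq> W" "cindependent C" "W \<subseteq> cspan C"
    using complex_vector.maximal_independent_subset[of W] by blast
  have "finite C"
    using complex_vector.independent_span_bound[OF B(1) C(2)] B(2) C(1) by blast
  then show ?l
    unfolding finite_dimensional_def
    using C(1,3) W complex_vector.span_minimal[OF C(1) W] by blast
next
  assume ?l
  then show ?r
    unfolding finite_dimensional_def by (metis complex_vector.subspace_span order_refl)
qed

lemma finite_dimensional_subspaceD: "finite_dimensional W \<Longrightarrow> csubspace W"
  by (simp add: finite_dimensional_iff_span)

lemma finite_dimensional_subspace:
  assumes "finite_dimensional W" "csubspace U" "U \<subseteq> W"
  shows "finite_dimensional U"
  using assms unfolding finite_dimensional_iff_span by blast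

lemma finite_dimensional_span: "finite B \<Longrightarrow> finite_dimensional (cspan B)"
  unfolding finite_dimensional_iff_span by auto

lemma finite_dimensional_basis:
  assumes "finite_dimensional W"
  obtains B where "finite B" "cindependent B" "cspan B = W"
proof -
  obtain C where W: "csubspace W" and C: "finite C" "W \<subseteq> cspan C"
    using assms unfolding finite_dimensional_iff_span by blast
  obtain B where B: "B \<subseteq> W" "cindependent B" "W \<subseteq> cspan B"
    using complex_vector.maximal_independent_subset[of W] by blast
  have "finite B"
    using complex_vector.independent_span_bound[OF C(1) B(2)] B(1) C(2) by blast
  then show ?thesis
    using that[of B] B complex_vector.span_minimal[OF B(1) W] by blast
qed

lemma independent_card_le_cdim:
  assumes "finite_dimensional W" "B \<subseteq> W" "cindependent B"
  shows "finite B" "card B \<le> cdim W"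
proof -
  obtain C where C: "finite C" "cindependent C" "cspan C = W"
    using finite_dimensional_basis[OF assms(1)] .
  have "card C = cdim W"
    using complex_vector.dim_span_eq_card_independent[OF C(2)] C(3) by simp
  then show "finite B" "card B \<le> cdim W"
    using complex_vector.independent_span_bound[OF C(1) assms(3)] assms(2) C(3) by auto
qed

lemma cdim_psubset:
  assumes "finite_dimensional W" "csubspace U" "U \<subset> W"
  shows "cdim U < cdim W"
proof -
  obtain B where B: "finite B" "cindependent B" "cspan B = U"
    using finite_dimensional_basis[OF finite_dimensional_subspace[OF assms(1,2)]] assms(3) by blast
  obtain x where x: "x \<in> W" "x \<notin> U" using assms(3) by blast
  have "cindependent (insert x B)"
    using B x by (simp add: complex_vector.independent_insertI)
  moreover have "insert x B \<subseteq> W"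
    using B(3) x(1) assms(3) complex_vector.span_superset[of B] by auto
  ultimately have "card (insert x B) \<le> cdim W"
    using independent_card_le_cdim(2)[OF assms(1)] by blast
  moreover have "x \<notin> B" using x(2) B(3) complex_vector.span_base by blast
  ultimately show ?thesis
    using B complex_vector.dim_span_eq_card_independent[OF B(2)] by simp
qed

lemma cdim_mono:
  assumes "finite_dimensional W" "csubspace U" "U \<subseteq> W"
  shows "cdim U \<le> cdim W"
  using cdim_psubset[OF assms(1,2)] assms(3) by (cases "U = W") (auto simp: less_imp_le)

text \<open>The image of a basis of \<open>W\<close> is independent and of the same size, so the
  image of \<open>W\<close> has full dimension and cannot be a proper subspace.\<close>

lemma injective_endomorphism_surjective:
  assumes W: "finite_dimensional W" and f: "clinear f" and stable: "\<And>w. w \<in> W \<Longrightarrow> f w \<in> W"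
    and inj: "\<And>w. w \<in> W \<Longrightarrow> f w = 0 \<Longrightarrow> w = 0" and "w \<in> W"
  shows "w \<in> f ` W"
proof -
  obtain B where B: "finite B" "cindependent B" "cspan B = W"
    using finite_dimensional_basis[OF W] .
  have inj_on: "inj_on f (cspan B)"
  proof (rule inj_onI)
    fix x y assume xy: "x \<in> cspan B" "y \<in> cspan B" "f x = f y"
    then have "x - y \<in> W" using B(3) complex_vector.span_diff by blast
    moreover have "f (x - y) = 0" using xy by (simp add: clinear_diff[OF f])
    ultimately show "x = y" using inj by fastforce
  qed
  then have ind: "cindependent (f ` B)"
    using complex_vector_pair.linear_independent_injective_image[OF f B(2)] by blast
  have sub: "f ` W \<subseteq> W" using stable by blast
  have fW: "f ` W = cspan (f ` B)"
    using complex_vector_pair.linear_span_image[OF f, of B] B(3) by simp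
  have "card (f ` B) = card B"
    by (rule card_image) (rule inj_on_subset[OF inj_on complex_vector.span_superset])
  then have "cdim (f ` W) = cdim W"
    using complex_vector.dim_span_eq_card_independent[OF ind]
      complex_vector.dim_span_eq_card_independent[OF B(2)] B(3) fW by simp
  then have "f ` W = W"
    using cdim_psubset[OF W, of "f ` W"] sub fW by (metis complex_vector.subspace_span less_irrefl psubsetI)
  then show ?thesis using assms(5) by simp
qed

text \<open>The kernels of the powers of \<open>T\<close> increase, so one of maximal dimension is
  stationary; then \<open>T ^^ k\<close> is injective, hence surjective, on its image. The two
  clauses are the two halves of the decomposition of \<open>W\<close> into kernel and image of
  \<open>T ^^ k\<close>. Positivity of \<open>k\<close> lets later arguments factor
  \<open>T ^^ k\<close> through \<open>T\<close>.\<close>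

lemma fitting:
  assumes W: "finite_dimensional W" and T: "clinear T" and stable: "T ` W \<subseteq> W"
  shows "\<exists>k>0. (\<forall>w\<in>W. (T ^^ k) ((T ^^ k) w) = 0 \<longrightarrow> (T ^^ k) w = 0) \<and>
    (\<forall>w\<in>W. \<exists>u\<in>W. (T ^^ k) (w - (T ^^ k) u) = 0)"
proof -
  define K where "K n = {w \<in> W. (T ^^ n) w = 0}" for n
  have Tn: "clinear (T ^^ n)" for n by (rule clinear_funpow[OF T])
  have subW: "csubspace W" by (rule finite_dimensional_subspaceD[OF W])
  have subK: "csubspace (K n)" for n
    using subW by (auto simp: complex_vector.subspace_def K_def clinear_0[OF Tn]
        clinear_add[OF Tn] clinear_scale[OF Tn])
  have fdK: "finite_dimensional (K n)" for n
    by (rule finite_dimensional_subspace[OF W subK]) (auto simp: K_def)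
  have mono: "K m \<subseteq> K (m + n)" for m n
    by (auto simp: K_def add.commute[of m] funpow_add clinear_0[OF Tn])
  have le: "cdim (K n) \<le> cdim W" for n
    by (rule cdim_mono[OF W subK]) (auto simp: K_def)
  have "\<exists>k. k > 0 \<and> (\<forall>n. n > 0 \<longrightarrow> cdim (K n) \<le> cdim (K k))"
    using ex_has_greatest_nat[of "\<lambda>n. n > (0::nat)" 1 "\<lambda>n. cdim (K n)" "Suc (cdim W)"] le
    by (auto simp: less_Suc_eq_le)
  then obtain k where k: "k > 0" "\<And>n. n > 0 \<Longrightarrow> cdim (K n) \<le> cdim (K k)" by blast
  have "K k = K (k + k)"
    using cdim_psubset[OF fdK[of "k + k"] subK[of k]] k(2)[of "k + k"] k(1) mono[of k k] by fastforce
  then have inj: "(T ^^ k) w = 0" if "w \<in> W" "(T ^^ k) ((T ^^ k) w) = 0" for w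
    using that by (auto simp: K_def funpow_add)
  have Tk: "(T ^^ k) w \<in> W" if "w \<in> W" for w
    using funpow_stable[of W T] stable that by blast
  let ?I = "(T ^^ k) ` W"
  have "csubspace ?I"
    using complex_vector_pair.linear_subspace_image[OF Tn subW] .
  then have fdI: "finite_dimensional ?I"
    using finite_dimensional_subspace[OF W] Tk by blast
  have "\<exists>u\<in>W. (T ^^ k) (w - (T ^^ k) u) = 0" if "w \<in> W" for w
  proof -
    have "(T ^^ k) w \<in> (T ^^ k) ` ?I"
    proof (rule injective_endomorphism_surjective[OF fdI Tn])
      show "(T ^^ k) v \<in> ?I" if "v \<in> ?I" for v using that Tk by blast
      show "v = 0" if "v \<in> ?I" "(T ^^ k) v = 0" for v using that inj by blast
      show "(T ^^ k) w \<in> ?I" using that by blast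
    qed
    then show ?thesis by (auto simp: clinear_diff[OF Tn])
  qed
  with k(1) inj show ?thesis by blast
qed

section \<open>Generalised eigenvectors\<close>

definition gen_eigen :: "('a::complex_vector \<Rightarrow> 'a) \<Rightarrow> complex \<Rightarrow> 'a \<Rightarrow> bool"
  where "gen_eigen T l v \<longleftrightarrow> (\<exists>k. ((\<lambda>v. T v - l *\<^sub>C v) ^^ k) v = 0)"

lemma clinear_shift: "clinear T \<Longrightarrow> clinear (\<lambda>v. T v - l *\<^sub>C v)"
  by (intro clinear_diff_fun clinear_scale_fun clinear_id)

lemma funpow_commute:
  assumes "\<And>v. f (g v) = g (f v)"
  shows "(f ^^ m) ((g ^^ n) v) = (g ^^ n) ((f ^^ m) v)"
proof -
  have 1: "f ((g ^^ n) v) = (g ^^ n) (f v)" for n v by (induction n) (auto simp: assms)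
  show ?thesis by (induction m) (auto simp: 1)
qed

lemma shift_commute:
  assumes "clinear T"
  shows "((\<lambda>v. T v - l *\<^sub>C v) ^^ m) (((\<lambda>v. T v - l' *\<^sub>C v) ^^ n) v) =
    ((\<lambda>v. T v - l' *\<^sub>C v) ^^ n) (((\<lambda>v. T v - l *\<^sub>C v) ^^ m) v)"
  by (rule funpow_commute)
    (simp add: clinear_diff[OF assms] clinear_scale[OF assms] complex_vector.scale_right_diff_distrib
      scaleC_scaleC mult.commute)

lemma gen_eigen_shift:
  assumes "clinear T" "gen_eigen T l v"
  shows "gen_eigen T l (((\<lambda>v. T v - l' *\<^sub>C v) ^^ n) v)"
proof -
  obtain k where "((\<lambda>v. T v - l *\<^sub>C v) ^^ k) v = 0" using assms(2) unfolding gen_eigen_def by blast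
  then have "((\<lambda>v. T v - l *\<^sub>C v) ^^ k) (((\<lambda>v. T v - l' *\<^sub>C v) ^^ n) v) = 0"
    by (subst shift_commute[OF assms(1)])
      (simp add: clinear_0[OF clinear_funpow[OF clinear_shift[OF assms(1)]]])
  then show ?thesis unfolding gen_eigen_def by blast
qed

lemma gen_eigen_add:
  assumes "clinear T" "gen_eigen T l v" "gen_eigen T l w"
  shows "gen_eigen T l (v + w)"
proof -
  let ?S = "\<lambda>v. T v - l *\<^sub>C v"
  have lin: "clinear (?S ^^ n)" for n by (intro clinear_funpow clinear_shift assms)
  obtain j k where "(?S ^^ j) v = 0" "(?S ^^ k) w = 0" using assms unfolding gen_eigen_def by blast
  moreover from this have "(?S ^^ (k + j)) v = 0" "(?S ^^ (j + k)) w = 0"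
    by (simp_all only: funpow_add comp_apply clinear_0[OF lin])
  ultimately have "(?S ^^ (k + j)) (v + w) = 0"
    by (simp add: clinear_add[OF lin] add.commute)
  then show ?thesis unfolding gen_eigen_def by blast
qed

lemma gen_eigen_scale:
  assumes "clinear T" "gen_eigen T l v"
  shows "gen_eigen T l (c *\<^sub>C v)"
  using assms(2) clinear_scale[OF clinear_funpow[OF clinear_shift[OF assms(1)]]]
  unfolding gen_eigen_def by fastforce

lemma gen_eigen_0: "clinear T \<Longrightarrow> gen_eigen T l 0"
  unfolding gen_eigen_def by (rule exI[of _ 0]) simp

lemma subspace_gen_eigen: "clinear T \<Longrightarrow> csubspace {v. gen_eigen T l v}"
  by (simp add: complex_vector.subspace_def gen_eigen_add gen_eigen_scale gen_eigen_0)

text \<open>Induction on \<open>n\<close> reduces to a vector with T v = m v. On it the powers of T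
  - l act by the nonzero scalars (m - l)^k, so they can kill it only if it is zero.\<close>

lemma shift_injective_on_gen_eigen:
  assumes T: "clinear T" and "gen_eigen T l v" "((\<lambda>v. T v - m *\<^sub>C v) ^^ n) v = 0" "l \<noteq> m"
  shows "v = 0"
  using assms(2,3)
proof (induction n arbitrary: v)
  case (Suc n)
  have 1: "T v - m *\<^sub>C v = 0"
  proof (rule Suc(1))
    show "gen_eigen T l (T v - m *\<^sub>C v)" using gen_eigen_shift[OF T Suc(2), of 1 m] by simp
    show "((\<lambda>v. T v - m *\<^sub>C v) ^^ n) (T v - m *\<^sub>C v) = 0"
      using Suc(3) by (simp add: funpow_Suc_right del: funpow.simps)
  qed
  have "((\<lambda>v. T v - l *\<^sub>C v) ^^ k) v = (m - l) ^ k *\<^sub>C v" for k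
  proof (induction k)
    case (Suc k)
    have "T v - l *\<^sub>C v = (m - l) *\<^sub>C v"
      using 1 by (simp add: complex_vector.scale_left_diff_distrib)
    then have "(m - l) ^ k *\<^sub>C (T v - l *\<^sub>C v) = (m - l) ^ Suc k *\<^sub>C v"
      by (simp add: scaleC_scaleC mult.commute)
    moreover have "T ((m - l) ^ k *\<^sub>C v) - l *\<^sub>C (m - l) ^ k *\<^sub>C v = (m - l) ^ k *\<^sub>C (T v - l *\<^sub>C v)"
      using clinear_scale[OF clinear_shift[OF T, of l]] by blast
    ultimately show ?case by (simp add: Suc)
  qed (simp add: scaleC_one)
  then show ?case using Suc(2) \<open>l \<noteq> m\<close> unfolding gen_eigen_def
    by (auto simp: complex_vector.scale_eq_0_iff)
qed simp

lemma gen_eigen_unique: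
  assumes "clinear T" "gen_eigen T l v" "gen_eigen T m v" "l \<noteq> m"
  shows "v = 0"
  using shift_injective_on_gen_eigen[OF assms(1,2) _ assms(4)] assms(3) unfolding gen_eigen_def
  by blast

text \<open>A power of T - m b removes the summand for \<open>b\<close>, keeps the others in their
  generalised eigenspaces, and is injective on the one for \<open>l\<close>.\<close>

lemma gen_eigen_sum_other:
  assumes T: "clinear T" and "finite S" "\<And>b. b \<in> S \<Longrightarrow> gen_eigen T (m b) (u b)"
    "\<And>b. b \<in> S \<Longrightarrow> m b \<noteq> l" "gen_eigen T l (\<Sum>b\<in>S. u b)"
  shows "(\<Sum>b\<in>S. u b) = 0"
  using assms(2-)
proof (induction S arbitrary: u rule: finite_induct)
  case (insert b S)
  let ?S = "\<lambda>v. T v - m b *\<^sub>C v"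
  obtain k where k: "(?S ^^ k) (u b) = 0"
    using insert(4)[of b] unfolding gen_eigen_def by auto
  have lin: "clinear (?S ^^ k)" by (intro clinear_funpow clinear_shift T)
  let ?z = "\<Sum>b\<in>insert b S. u b"
  have z: "(?S ^^ k) ?z = (\<Sum>b\<in>S. (?S ^^ k) (u b))"
    using insert(1,2) by (simp add: clinear_add[OF lin] clinear_sum[OF lin] k)
  have "(\<Sum>b\<in>S. (?S ^^ k) (u b)) = 0"
  proof (rule insert(3))
    show "gen_eigen T (m b') ((?S ^^ k) (u b'))" if "b' \<in> S" for b'
      using insert(4) that by (intro gen_eigen_shift T) auto
    show "m b' \<noteq> l" if "b' \<in> S" for b' using insert(5) that by auto
    show "gen_eigen T l (\<Sum>b\<in>S. (?S ^^ k) (u b))"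
      unfolding z[symmetric] using insert(6) by (intro gen_eigen_shift T) auto
  qed
  then have "(?S ^^ k) ?z = 0" using z by simp
  then show ?case using shift_injective_on_gen_eigen[OF T insert(6)] insert(5)[of b] by auto
qed simp

section \<open>Coordinates and traces\<close>

abbreviation crep :: "'a::complex_vector set \<Rightarrow> 'a \<Rightarrow> 'a \<Rightarrow> complex"
  where "crep \<equiv> complex_vector.representation"

lemma crep_sum:
  assumes "finite B" "cindependent B" "v \<in> cspan B"
  shows "(\<Sum>b\<in>B. crep B v b *\<^sub>C b) = v"
  using complex_vector.sum_representation_eq[OF assms(2,3,1) order_refl] .

definition ctrace :: "'a::complex_vector set \<Rightarrow> ('a \<Rightarrow> 'a) \<Rightarrow> complex"
  where "ctrace B f = (\<Sum>b\<in>B. crep B (f b) b)"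

lemma crep_linear_sum:
  assumes B: "finite B" "cindependent B" and C: "finite C" "cindependent C" and f: "clinear f"
    and st: "\<And>w. w \<in> cspan B \<Longrightarrow> f w \<in> cspan C" and w: "w \<in> cspan B"
  shows "crep C (f w) x = (\<Sum>b\<in>B. crep B w b * crep C (f b) x)"
proof -
  have bB: "f b \<in> cspan C" if "b \<in> B" for b using st complex_vector.span_base[OF that] by blast
  have "f w = (\<Sum>b\<in>B. crep B w b *\<^sub>C f b)"
    using crep_sum[OF B w] clinear_sum[OF f, of "\<lambda>b. crep B w b *\<^sub>C b" B] clinear_scale[OF f] by simp
  then have "crep C (f w) = (\<lambda>x. \<Sum>b\<in>B. crep C (crep B w b *\<^sub>C f b) x)"
    using complex_vector.representation_sum[OF C(2), of B "\<lambda>b. crep B w b *\<^sub>C f b"]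
      complex_vector.span_scale[OF bB] by simp
  then show ?thesis
    using complex_vector.representation_scale[OF C(2) bB] by simp
qed

text \<open>The two bases may belong to different subspaces. With \<open>g\<close> the identity the
  formula becomes the independence of the trace from the basis.\<close>

lemma ctrace_comm:
  assumes B: "finite B" "cindependent B" and C: "finite C" "cindependent C"
    and f: "clinear f" "\<And>w. w \<in> cspan B \<Longrightarrow> f w \<in> cspan C"
    and g: "clinear g" "\<And>w. w \<in> cspan C \<Longrightarrow> g w \<in> cspan B"
  shows "ctrace C (\<lambda>w. f (g w)) = ctrace B (\<lambda>w. g (f w))"
proof -
  have "ctrace C (\<lambda>w. f (g w)) = (\<Sum>c\<in>C. \<Sum>b\<in>B. crep B (g c) b * crep C (f b) c)"
    unfolding ctrace_def
    by (intro sum.cong refl crep_linear_sum[OF B C f]) (auto intro: g complex_vector.span_base)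
  also have "\<dots> = (\<Sum>b\<in>B. \<Sum>c\<in>C. crep C (f b) c * crep B (g c) b)"
    by (subst sum.swap) (simp add: mult.commute)
  also have "\<dots> = ctrace B (\<lambda>w. g (f w))"
    unfolding ctrace_def
    by (intro sum.cong refl crep_linear_sum[OF C B g, symmetric]) (auto intro: f complex_vector.span_base)
  finally show ?thesis .
qed

lemma ctrace_basis:
  assumes "finite B" "cindependent B" "finite C" "cindependent C" "cspan B = cspan C"
    and f: "clinear f" "\<And>w. w \<in> cspan B \<Longrightarrow> f w \<in> cspan B"
  shows "ctrace B f = ctrace C f"
  using ctrace_comm[OF assms(3,4,1,2) f(1) _ clinear_id] assms(5) f(2) by simp

lemma ctrace_cong: "(\<And>b. b \<in> B \<Longrightarrow> f b = g b) \<Longrightarrow> ctrace B f = ctrace B g"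
  unfolding ctrace_def by simp

lemma ctrace_add:
  assumes "cindependent B" "\<And>b. b \<in> B \<Longrightarrow> f b \<in> cspan B" "\<And>b. b \<in> B \<Longrightarrow> g b \<in> cspan B"
  shows "ctrace B (\<lambda>w. f w + g w) = ctrace B f + ctrace B g"
  using assms by (simp add: ctrace_def complex_vector.representation_add sum.distrib)

lemma ctrace_diff:
  assumes "cindependent B" "\<And>b. b \<in> B \<Longrightarrow> f b \<in> cspan B" "\<And>b. b \<in> B \<Longrightarrow> g b \<in> cspan B"
  shows "ctrace B (\<lambda>w. f w - g w) = ctrace B f - ctrace B g"
  using assms by (simp add: ctrace_def complex_vector.representation_diff sum_subtractf)

lemma ctrace_scale:
  assumes "cindependent B" "\<And>b. b \<in> B \<Longrightarrow> f b \<in> cspan B"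
  shows "ctrace B (\<lambda>w. c *\<^sub>C f w) = c * ctrace B f"
  using assms by (simp add: ctrace_def complex_vector.representation_scale sum_distrib_left)

lemma ctrace_sum:
  assumes "cindependent B" "\<And>i b. i \<in> I \<Longrightarrow> b \<in> B \<Longrightarrow> f i b \<in> cspan B"
  shows "ctrace B (\<lambda>w. \<Sum>i\<in>I. f i w) = (\<Sum>i\<in>I. ctrace B (f i))"
  using assms(2)
proof (induction I rule: infinite_finite_induct)
  case (insert i I)
  then show ?case
    using ctrace_add[OF assms(1), of "f i" "\<lambda>w. \<Sum>i\<in>I. f i w"] complex_vector.span_sum
    by (simp add: complex_vector.span_sum)
qed (simp_all add: ctrace_def complex_vector.representation_zero)

section \<open>Eigenvalues and triangular bases\<close>

definition poly_act :: "('a::complex_vector \<Rightarrow> 'a) \<Rightarrow> complex poly \<Rightarrow> 'a \<Rightarrow> 'a"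
  where "poly_act T p w = (\<Sum>i\<le>degree p. coeff p i *\<^sub>C (T ^^ i) w)"

lemma poly_act_eq:
  assumes "degree p \<le> n"
  shows "poly_act T p w = (\<Sum>i\<le>n. coeff p i *\<^sub>C (T ^^ i) w)"
  unfolding poly_act_def
  by (rule sum.mono_neutral_left) (use assms in \<open>auto simp: coeff_eq_0\<close>)

lemma poly_act_linear_factor:
  assumes "clinear T"
  shows "poly_act T ([:- l, 1:] * q) w = T (poly_act T q w) - l *\<^sub>C poly_act T q w"
proof -
  let ?n = "degree q"
  have 1: "degree ([:- l, 1:] * q) \<le> Suc ?n"
    using degree_mult_le[of "[:- l, 1:]" q] by simp
  have "poly_act T ([:- l, 1:] * q) w =
     (\<Sum>i\<le>Suc ?n. coeff (pCons 0 q) i *\<^sub>C (T ^^ i) w) - (\<Sum>i\<le>Suc ?n. (l * coeff q i) *\<^sub>C (T ^^ i) w)"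
    unfolding poly_act_eq[OF 1] sum_subtractf[symmetric]
    by (intro sum.cong refl) (simp flip: complex_vector.scale_left_diff_distrib)
  also have "(\<Sum>i\<le>Suc ?n. coeff (pCons 0 q) i *\<^sub>C (T ^^ i) w) = T (poly_act T q w)"
    unfolding poly_act_def sum.atMost_Suc_shift
    by (simp add: clinear_sum[OF assms] clinear_scale[OF assms])
  also have "(\<Sum>i\<le>Suc ?n. (l * coeff q i) *\<^sub>C (T ^^ i) w) = l *\<^sub>C poly_act T q w"
    unfolding poly_act_eq[of q "Suc ?n", OF le_SucI[OF order_refl]] complex_vector.scale_sum_right
    by (simp add: scaleC_scaleC)
  finally show ?thesis .
qed

text \<open>Split off a root \<open>l\<close> of \<open>p\<close>: the cofactor either sends
  \<open>w\<close> to an eigenvector for \<open>l\<close>, or annihilates \<open>w\<close> and has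
  smaller degree. A nonzero constant cannot annihilate \<open>w\<close>, which ends the
  induction.\<close>

lemma eigenvalue_of_annihilator:
  assumes T: "clinear T" and stable: "\<And>w. w \<in> W \<Longrightarrow> T w \<in> W" and W: "csubspace W"
    and "p \<noteq> 0" "poly_act T p w = 0" "w \<in> W" "w \<noteq> 0"
  shows "\<exists>l v. v \<in> W \<and> v \<noteq> 0 \<and> T v = l *\<^sub>C v"
  using assms(4-)
proof (induction "degree p" arbitrary: p w)
  case 0
  then obtain c where "p = [:c:]" using degree_eq_zeroE[of p] by auto
  then show ?case using 0 by (simp add: poly_act_def)
next
  case (Suc n)
  then have "\<not> constant (poly p)" by (simp add: constant_degree)
  then obtain l where "poly p l = 0" using fundamental_theorem_of_algebra by blast
  then obtain q where p: "p = [:- l, 1:] * q" using poly_eq_0_iff_dvd[of p l] by blast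
  have q: "q \<noteq> 0" using p Suc(3) by auto
  then have deg: "n = degree q" using Suc(2) unfolding p by (subst (asm) degree_mult_eq) auto
  have mem: "poly_act T q w \<in> W"
    unfolding poly_act_def
    by (intro complex_vector.subspace_sum complex_vector.subspace_scale W funpow_stable stable Suc(5))
  have eig: "T (poly_act T q w) = l *\<^sub>C poly_act T q w"
    using Suc(4) unfolding p poly_act_linear_factor[OF T] by simp
  show ?case
  proof (cases "poly_act T q w = 0")
    case True
    then show ?thesis using Suc(1)[OF deg q _ Suc(5,6)] by blast
  next
    case False
    then show ?thesis using mem eig by blast
  qed
qed

lemma span_image_lessThan:
  "v \<in> cspan (f ` {..<n::nat}) \<Longrightarrow> \<exists>c. v = (\<Sum>i<n. c i *\<^sub>C f i)"
proof (induction n arbitrary: v)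
  case (Suc n)
  then obtain k where "v - k *\<^sub>C f n \<in> cspan (f ` {..<n})"
    using complex_vector.span_breakdown_eq[of v "f n" "f ` {..<n}"] by (auto simp: lessThan_Suc)
  then obtain c where c: "v - k *\<^sub>C f n = (\<Sum>i<n. c i *\<^sub>C f i)" using Suc(1) by blast
  have "v = (\<Sum>i<Suc n. (c(n := k)) i *\<^sub>C f i)"
    using c by (simp add: algebra_simps)
  then show ?case by blast
qed auto

text \<open>Some iterate of \<open>T\<close> on \<open>w\<close> depends on the earlier ones, for
  otherwise \<open>W\<close> would contain independent sets of every size. The relation is a
  polynomial that annihilates \<open>w\<close>.\<close>

lemma ex_eigenvector:
  assumes W: "finite_dimensional W" and T: "clinear T" and stable: "T ` W \<subseteq> W"
    and "W \<noteq> {0}"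
  obtains l v where "v \<in> W" "v \<noteq> 0" "T v = l *\<^sub>C v"
proof -
  have sub: "csubspace W" by (rule finite_dimensional_subspaceD[OF W])
  obtain w where w: "w \<in> W" "w \<noteq> 0" using assms(4) complex_vector.subspace_0[OF sub] by blast
  let ?f = "\<lambda>i. (T ^^ i) w"
  have mem: "?f i \<in> W" for i using funpow_stable[of W T] stable w(1) by blast
  have "\<exists>d. ?f d \<in> cspan (?f ` {..<d})"
  proof (rule ccontr)
    assume "\<not> ?thesis"
    then have no: "?f d \<notin> cspan (?f ` {..<d})" for d by blast
    have "cindependent (?f ` {..<d}) \<and> card (?f ` {..<d}) = d" for d
    proof (induction d)
      case (Suc d)
      have eq: "?f ` {..<Suc d} = insert (?f d) (?f ` {..<d})" by (simp only: lessThan_Suc image_insert)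
      have new: "?f d \<notin> ?f ` {..<d}"
        using no[of d] complex_vector.span_superset[of "?f ` {..<d}"] by (metis subsetD)
      have "cindependent (insert (?f d) (?f ` {..<d}))"
        by (rule complex_vector.independent_insertI[OF no]) (rule conjunct1[OF Suc])
      then show ?case
        unfolding eq card_insert_disjoint[OF finite_imageI[OF finite_lessThan] new] conjunct2[OF Suc]
        by simp
    qed (simp add: complex_vector.independent_empty)
    moreover have "?f ` {..<Suc (cdim W)} \<subseteq> W" using mem by blast
    ultimately show False
      using independent_card_le_cdim(2)[OF W, of "?f ` {..<Suc (cdim W)}"]
      by (metis Suc_n_not_le_n)
  qed
  then obtain d c where c: "?f d = (\<Sum>i<d. c i *\<^sub>C ?f i)"
    using span_image_lessThan[of _ ?f] by blast
  \<comment> \<open>Monic, hence nonzero even if all \<open>c i\<close> vanish.\<close>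
  define p where "p = monom 1 d - (\<Sum>i<d. monom (c i) i)"
  have cp: "coeff p i = (if i = d then 1 else if i < d then - c i else 0)" for i
    unfolding p_def coeff_diff coeff_sum coeff_monom by (auto simp: sum.delta)
  have "degree p \<le> d" by (rule degree_le) (simp add: cp)
  then have "poly_act T p w = (\<Sum>i<d. coeff p i *\<^sub>C ?f i) + ?f d"
    unfolding poly_act_eq[OF \<open>degree p \<le> d\<close>] lessThan_Suc_atMost[symmetric] sum.lessThan_Suc cp[of d]
    by (simp add: scaleC_one)
  also have "(\<Sum>i<d. coeff p i *\<^sub>C ?f i) = - ?f d"
    unfolding c sum_negf[symmetric] by (intro sum.cong refl) (simp add: cp)
  finally have "poly_act T p w = 0" by simp
  moreover have "p \<noteq> 0" using cp[of d] by auto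
  ultimately show ?thesis
    using eigenvalue_of_annihilator[OF T _ sub _ _ w] stable that by blast
qed

lemma crep_extend_0:
  assumes "cindependent B" "C \<subseteq> B" "v \<in> cspan C" "b \<notin> C"
  shows "crep B v b = 0"
  using complex_vector.representation_extend[OF assms(1,3,2)]
    complex_vector.representation_ne_zero[of C v b] assms(4) by auto

text \<open>A basis of \<open>W\<close> in which the semisimple part of \<open>T\<close> is diagonal with entries \<open>l b\<close> and the
  nilpotent part has zero diagonal.\<close>

lemma ex_gen_eigen_basis:
  assumes W: "finite_dimensional W" and T: "clinear T" and stable: "T ` W \<subseteq> W"
  shows "\<exists>B l. finite B \<and> cindependent B \<and> cspan B = W \<and> (\<forall>b\<in>B. gen_eigen T (l b) b) \<and>
    (\<forall>b\<in>B. crep B (T b - l b *\<^sub>C b) b = 0)"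
  using assms
proof (induction "cdim W" arbitrary: W rule: less_induct)
  case less
  note W = less(2) and stable = less(4)
  have sub: "csubspace W" by (rule finite_dimensional_subspaceD[OF W])
  show ?case
  proof (cases "W = {0}")
    case True
    then show ?thesis
      by (intro exI[of _ "{}"]) (auto simp: complex_vector.independent_empty)
  next
    case False
    then obtain m v where v: "v \<in> W" "v \<noteq> 0" "T v = m *\<^sub>C v"
      using ex_eigenvector[OF W T stable] by metis
    let ?S = "\<lambda>v. T v - m *\<^sub>C v"
    have S: "clinear ?S" by (rule clinear_shift[OF T])
    have SW: "?S ` W \<subseteq> W"
      using stable sub by (auto simp: csubspace_simps image_subset_iff)
    obtain k where k: "k > 0" "\<forall>w\<in>W. (?S ^^ k) ((?S ^^ k) w) = 0 \<longrightarrow> (?S ^^ k) w = 0"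
      "\<forall>w\<in>W. \<exists>u\<in>W. (?S ^^ k) (w - (?S ^^ k) u) = 0"
      using fitting[OF W S SW] by (elim exE conjE)
    obtain B0 where B0: "B0 \<subseteq> ?S ` W" "cindependent B0" "?S ` W \<subseteq> cspan B0"
      using complex_vector.maximal_independent_subset[of "?S ` W"] by blast
    obtain C where C: "B0 \<subseteq> C" "C \<subseteq> W" "cindependent C" "W \<subseteq> cspan C"
      using complex_vector.maximal_independent_subset_extend[OF subset_trans[OF B0(1) SW] B0(2)] by blast
    \<comment> \<open>T - m kills \<open>v\<close>, so it is not onto \<open>W\<close>: otherwise
      \<open>v\<close> would be (T - m)^k u for some \<open>u\<close> in \<open>W\<close>, and the
      choice of \<open>k\<close> would force v = 0.\<close>
    have "B0 \<noteq> C"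
    proof
      assume "B0 = C"
      have "cspan B0 \<subseteq> ?S ` W"
        by (rule complex_vector.span_minimal[OF B0(1)])
          (rule complex_vector_pair.linear_subspace_image[OF S sub])
      then have "W \<subseteq> ?S ` W" using \<open>B0 = C\<close> C(4) by blast
      then have surj: "\<exists>u\<in>W. w = (?S ^^ n) u" if "w \<in> W" for w n
        using that
      proof (induction n arbitrary: w)
        case (Suc n)
        then obtain u where "u \<in> W" "w = ?S u" by blast
        then show ?case using Suc(1)[OF Suc(2) \<open>u \<in> W\<close>] by auto
      qed auto
      obtain u where u: "u \<in> W" "v = (?S ^^ k) u" using surj[OF v(1), of k] by blast
      have "(?S ^^ k) v = 0"
      proof (cases k)
        case (Suc j)
        have "(?S ^^ Suc j) v = (?S ^^ j) (?S v)" by (simp only: funpow_Suc_right comp_apply)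
        then show ?thesis using Suc v(3) clinear_0[OF clinear_funpow[OF S]] by simp
      qed (use k(1) in simp)
      then show False using k(2)[rule_format, OF u(1)] u(2) v(2) by simp
    qed
    then obtain c where c: "c \<in> C" "c \<notin> B0" using C(1) by blast
    \<comment> \<open>A hyperplane of \<open>W\<close> that contains the image of T - m. It is
      stable under \<open>T\<close>, so the induction hypothesis supplies its basis, and
      \<open>T\<close> acts on the quotient by \<open>m\<close>.\<close>
    define U where "U = cspan (C - {c})"
    have subU: "csubspace U" unfolding U_def by simp
    have UW: "U \<subseteq> W" unfolding U_def
      by (rule complex_vector.span_minimal[OF _ sub]) (use C(2) in blast)
    have cU: "c \<notin> U" using C(3) c(1) unfolding U_def complex_vector.dependent_def by blast
    have SU: "?S w \<in> U" if "w \<in> W" for w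
    proof -
      have "?S w \<in> cspan B0" using B0(3) that by blast
      also have "cspan B0 \<subseteq> U" unfolding U_def
        by (rule complex_vector.span_mono) (use C(1) c in blast)
      finally show ?thesis .
    qed
    have WU: "\<exists>k. w - k *\<^sub>C c \<in> U" if "w \<in> W" for w
      using that C(4) c(1) complex_vector.span_breakdown[OF c(1)] unfolding U_def by blast
    have TU: "T ` U \<subseteq> U"
    proof (rule image_subsetI)
      fix u assume u: "u \<in> U"
      then have "?S u + m *\<^sub>C u \<in> U"
        using UW by (intro complex_vector.subspace_add[OF subU] complex_vector.subspace_scale[OF subU] SU) auto
      then show "T u \<in> U" by simp
    qed
    have fdU: "finite_dimensional U" by (rule finite_dimensional_subspace[OF W subU UW])
    have "cdim U < cdim W" using cU c(1) C(2) UW by (intro cdim_psubset[OF W subU]) blast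
    from less(1)[OF this fdU T TU] obtain B l where
      B: "finite B" "cindependent B" "cspan B = U" "\<And>b. b \<in> B \<Longrightarrow> gen_eigen T (l b) b"
        "\<And>b. b \<in> B \<Longrightarrow> crep B (T b - l b *\<^sub>C b) b = 0" by blast
    have "c \<in> W" using c C by blast
    then obtain u where u: "u \<in> W" "(?S ^^ k) (c - (?S ^^ k) u) = 0" using bspec[OF k(3)] by blast
    \<comment> \<open>\<open>c\<close> is moved within its coset of \<open>U\<close> to a
      generalised eigenvector for \<open>m\<close>; as k > 0, the correction lies in the image of T
      - m and so in \<open>U\<close>. Since T - m maps \<open>b0\<close> into \<open>U\<close>, the
      new diagonal entry vanishes.\<close>
    define b0 where "b0 = c - (?S ^^ k) u"
    have Sku: "(?S ^^ k) u \<in> U"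
    proof -
      obtain j where "k = Suc j" using k(1) gr0_conv_Suc by auto
      then show ?thesis using SU funpow_stable[of W ?S u j] SW u(1) by auto
    qed
    have b0U: "b0 \<notin> U" using cU Sku complex_vector.subspace_add[OF subU _ Sku, of b0]
      unfolding b0_def by auto
    have b0W: "b0 \<in> W" using \<open>c \<in> W\<close> Sku UW unfolding b0_def
      by (auto intro: complex_vector.subspace_diff[OF sub])
    let ?B = "insert b0 B"
    have ind: "cindependent ?B"
      using B b0U by (simp add: complex_vector.independent_insertI)
    have "b0 \<notin> B" using b0U B(3) complex_vector.span_base by blast
    have span: "cspan ?B = W"
    proof
      show "cspan ?B \<subseteq> W"
        using b0W UW B(3) complex_vector.span_superset[of B] sub
        by (intro complex_vector.span_minimal) auto
      show "W \<subseteq> cspan ?B"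
      proof
        fix w assume "w \<in> W"
        then obtain a where a: "w - a *\<^sub>C c \<in> U" using WU by blast
        have "w - a *\<^sub>C b0 = (w - a *\<^sub>C c) + a *\<^sub>C (?S ^^ k) u"
          unfolding b0_def by (simp add: complex_vector.scale_right_diff_distrib)
        also have "\<dots> \<in> U" by (intro csubspace_simps subU a Sku)
        finally show "w \<in> cspan ?B"
          using complex_vector.span_breakdown_eq[of w b0 B] B(3) by blast
      qed
    qed
    define l' where "l' = l(b0 := m)"
    have "gen_eigen T (l' b) b" if "b \<in> ?B" for b
      using that B(4)[of b] u(2) \<open>b0 \<notin> B\<close> unfolding l'_def gen_eigen_def b0_def[symmetric] by auto
    moreover have "crep ?B (T b - l' b *\<^sub>C b) b = 0" if "b \<in> ?B" for b
    proof (cases "b = b0")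
      case True
      then show ?thesis
        using SU[OF b0W] \<open>b0 \<notin> B\<close> B(3) by (intro crep_extend_0[OF ind, of B]) (auto simp: l'_def)
    next
      case False
      then have b: "b \<in> B" using that by blast
      then have "b \<in> U" using B(3) complex_vector.span_base by blast
      then have "T b - l b *\<^sub>C b \<in> cspan B" unfolding B(3) using TU by (intro csubspace_simps subU) auto
      then show ?thesis
        using complex_vector.representation_extend[OF ind _ subset_insertI] B(5)[OF b] False
        by (simp add: l'_def)
    qed
    ultimately show ?thesis
      using ind span B(1) by (intro exI[of _ ?B] exI[of _ l']) auto
  qed
qed

section \<open>Trace forms of simple Lie algebras\<close>

lemma lie_module_linear: "lie_module \<rho> \<Longrightarrow> clinear (\<rho> x)"
  and lie_module_linear_left: "lie_module \<rho> \<Longrightarrow> clinear (\<lambda>x. \<rho> x v)"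
  and lie_module_lie: "lie_module \<rho> \<Longrightarrow> \<rho> (lie x y) v = \<rho> x (\<rho> y v) - \<rho> y (\<rho> x v)"
  by (auto simp: lie_module_def cbilinear_def)

lemma lie_neg_left: "lie (- x) (y::'a::complex_lie_algebra) = - lie x y"
  and lie_neg_right: "lie x (- y) = - lie x y"
  using lie_add_left[of x "- x" y] lie_add_right[of x y "- y"]
  by (simp_all add: eq_neg_iff_add_eq_0 add.commute)

lemma lie_lie_right: "lie x (lie y z) = lie (lie x y) z + lie y (lie x (z::'a::complex_lie_algebra))"
proof -
  have "lie y (lie z x) = - lie y (lie x z)" "lie z (lie x y) = - lie (lie x y) z"
    by (simp_all add: lie_skew[of z x] lie_skew[of z "lie x y"] lie_neg_right)
  then show ?thesis using jacobi[of x y z] by (simp add: algebra_simps)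
qed

lemma lie_module_adjoint: "lie_module (lie :: 'a::complex_lie_algebra \<Rightarrow> 'a \<Rightarrow> 'a)"
proof -
  have "lie (lie x y) v = lie x (lie y v) - lie y (lie x v)" for x y v :: 'a
    using lie_lie_right[of x y v] by simp
  then show ?thesis
    by (simp add: lie_module_def cbilinear_def clinear_iff lie_add_left lie_add_right
        lie_scaleC_left lie_scaleC_right)
qed

text \<open>The shifted operators obey a Leibniz rule: each application of \<open>?C\<close> applies
  \<open>?A\<close> to \<open>z\<close> or \<open>?B\<close> to \<open>w\<close>. After
  \<open>i + j\<close> applications every term has used up one of the two factors.\<close>

lemma gen_eigen_lie_module:
  assumes \<rho>: "lie_module \<rho>" and "gen_eigen (lie x) m z" "gen_eigen (\<rho> x) l w"
  shows "gen_eigen (\<rho> x) (l + m) (\<rho> z w)"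
proof -
  let ?A = "\<lambda>z. lie x z - m *\<^sub>C z" and ?B = "\<lambda>w. \<rho> x w - l *\<^sub>C w"
    and ?C = "\<lambda>w. \<rho> x w - (l + m) *\<^sub>C w"
  have C: "clinear (?C ^^ n)" for n
    by (intro clinear_funpow clinear_shift lie_module_linear \<rho>)
  have step: "?C (\<rho> z w) = \<rho> (?A z) w + \<rho> z (?B w)" for z w
    using lie_module_lie[OF \<rho>, of x z w]
    by (simp add: clinear_diff[OF lie_module_linear[OF \<rho>]] clinear_scale[OF lie_module_linear[OF \<rho>]]
        clinear_diff[OF lie_module_linear_left[OF \<rho>]] clinear_scale[OF lie_module_linear_left[OF \<rho>]]
        scaleC_add_left)
  have "(?A ^^ i) z = 0 \<Longrightarrow> (?B ^^ j) w = 0 \<Longrightarrow> (?C ^^ (i + j)) (\<rho> z w) = 0" for i j z w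
  proof (induction "i + j" arbitrary: i j z w)
    case 0
    then show ?case by (simp add: clinear_0[OF lie_module_linear[OF \<rho>]])
  next
    case (Suc n)
    have 1: "(?C ^^ n) (\<rho> (?A z) w) = 0"
    proof (cases i)
      case 0
      then have "z = 0" using Suc(3) by simp
      then show ?thesis by (simp add: clinear_0[OF lie_module_linear_left[OF \<rho>]] clinear_0[OF C])
    next
      case (Suc i')
      then have "(?A ^^ i') (?A z) = 0"
        using Suc.prems(1) by (simp only: funpow_Suc_right comp_apply)
      then show ?thesis using Suc.hyps(1)[of i' j "?A z" w] Suc.hyps(2) Suc.prems(2) Suc by simp
    qed
    have 2: "(?C ^^ n) (\<rho> z (?B w)) = 0"
    proof (cases j)
      case 0
      then have "w = 0" using Suc(4) by simp
      then show ?thesis by (simp add: clinear_0[OF lie_module_linear[OF \<rho>]] clinear_0[OF C])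
    next
      case (Suc j')
      then have "(?B ^^ j') (?B w) = 0"
        using Suc.prems(2) by (simp only: funpow_Suc_right comp_apply)
      then show ?thesis using Suc.hyps(1)[of i j' z "?B w"] Suc.hyps(2) Suc.prems(1) Suc by simp
    qed
    have "(?C ^^ Suc n) (\<rho> z w) = (?C ^^ n) (\<rho> (?A z) w + \<rho> z (?B w))"
      unfolding funpow_Suc_right comp_apply step ..
    then show ?case using 1 2 Suc.hyps(2) by (simp add: clinear_add[OF C])
  qed
  then show ?thesis using assms(2,3) unfolding gen_eigen_def by blast
qed

text \<open>The Cartan subalgebra is carried along as the source of an element whose adjoint action
  is not nilpotent.\<close>

locale simple_lie =
  fixes H :: "'g::complex_lie_algebra set"
  assumes finite_dimensional: "finite_dimensional (UNIV :: 'g set)"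
    and simple: "simple_lie_algebra TYPE('g)"
    and cartan: "cartan_subalgebra H"
begin

lemma ideal_cases: "lie_ideal (I :: 'g set) \<Longrightarrow> I = {0} \<or> I = UNIV"
  using simple by (simp add: simple_lie_algebra_def)

text \<open>The brackets span a nonzero ideal. From here on perfectness stands in for structure
  theory: a linear condition on \<open>g\<close> need only be checked on brackets.\<close>

lemma perfect: "cspan {lie x y |x y :: 'g. True} = UNIV" (is "cspan ?S = _")
proof -
  have "lie x y \<in> cspan ?S" for x y :: 'g by (intro complex_vector.span_base) blast
  then have "lie_ideal (cspan ?S)" by (simp add: lie_ideal_def)
  moreover obtain x y :: 'g where "lie x y \<noteq> 0"
    using simple by (auto simp: simple_lie_algebra_def)
  ultimately show ?thesis using ideal_cases \<open>\<And>y x. lie x y \<in> cspan ?S\<close> by blast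
qed

lemma perfect_induct:
  assumes "csubspace {x. P x}" and "\<And>x y. P (lie x (y::'g))"
  shows "P z"
proof -
  have "cspan {lie x y |x y :: 'g. True} \<subseteq> {x. P x}"
    by (rule complex_vector.span_minimal) (use assms in auto)
  then show ?thesis unfolding perfect by blast
qed

text \<open>If every \<open>ad x\<close> were nilpotent, then Engel's argument for the nilpotent algebra \<open>H\<close> acting on
  \<open>g / H\<close> would contradict that \<open>H\<close> is self-normalising.\<close>

lemma ex_nonzero_root_vector: "\<exists>x z m. m \<noteq> 0 \<and> z \<noteq> (0::'g) \<and> gen_eigen (lie x) m z"
proof (rule ccontr)
  assume contra: "\<not> ?thesis"
  \<comment> \<open>Without nonzero eigenvalues, a basis of generalised eigenvectors of
    \<open>lie x\<close> consists of vectors for the eigenvalue 0.\<close>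
  have nil: "gen_eigen (lie x) 0 v" for x v :: 'g
  proof -
    obtain B l where B: "cspan B = UNIV" "\<And>b. b \<in> B \<Longrightarrow> gen_eigen (lie x) (l b) b"
      using ex_gen_eigen_basis[OF finite_dimensional lie_module_linear[OF lie_module_adjoint], of x]
      by auto
    have "gen_eigen (lie x) 0 b" if "b \<in> B" for b
      using B(2)[OF that] contra gen_eigen_0[OF lie_module_linear[OF lie_module_adjoint]]
      by metis
    then have "cspan B \<subseteq> {v. gen_eigen (lie x) 0 v}"
      by (intro complex_vector.span_minimal subspace_gen_eigen lie_module_linear[OF lie_module_adjoint])
        auto
    then show ?thesis using B(1) by blast
  qed
  let ?C = "lower_central_series H"
  obtain N where N: "?C N = {0}" using cartan by (auto simp: cartan_subalgebra_def)
  have subH: "csubspace H" and HH: "\<And>x y. x \<in> H \<Longrightarrow> y \<in> H \<Longrightarrow> lie x y \<in> H"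
    using cartan by (auto simp: cartan_subalgebra_def lie_subalgebra_def)
  have norm: "x \<in> H" if "\<And>h. h \<in> H \<Longrightarrow> lie x h \<in> H" for x
    using cartan that by (auto simp: cartan_subalgebra_def)
  have C_lie: "lie x y \<in> ?C (Suc n)" if "x \<in> H" "y \<in> ?C n" for x y n
    unfolding lower_central_series.simps by (rule complex_vector.span_base) (use that in blast)
  have subC: "csubspace (?C n)" for n by (cases n) (simp_all add: subH)
  have C_mono: "?C (Suc n) \<subseteq> ?C n" for n
  proof (induction n)
    case 0
    show ?case
      unfolding lower_central_series.simps
      by (rule complex_vector.span_minimal[OF _ subH]) (use HH in blast)
  next
    case (Suc n)
    show ?case
      unfolding lower_central_series.simps(2)[of H "Suc n"]
      by (rule complex_vector.span_minimal[OF _ subC]) (use Suc C_lie in blast)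
  qed
  have C_H: "?C n \<subseteq> H" for n
    by (induction n) (use C_mono in \<open>simp, blast\<close>)
  show False
  proof (cases "H = UNIV")
    case True
    have "?C n = UNIV" for n
      by (induction n) (use perfect in \<open>simp_all add: True\<close>)
    then have "(UNIV :: 'g set) = {0}" using N by metis
    then show False using simple by (auto simp: simple_lie_algebra_def)
  next
    case False
    \<comment> \<open>Starting at the zero term of the lower central series and climbing back to
      \<open>H\<close>, a vector outside \<open>H\<close> is kept that the current term maps into
      \<open>H\<close>. At \<open>H\<close> itself this contradicts self-normalisation.\<close>
    have step: "\<exists>v. v \<notin> H \<and> (\<forall>c\<in>?C k. lie c v \<in> H)"
      if "\<exists>v. v \<notin> H \<and> (\<forall>c\<in>?C (Suc k). lie c v \<in> H)" for k
    proof -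
      have S: "\<exists>v. v \<notin> H \<and> (\<forall>c\<in>?C (Suc k). lie c v \<in> H) \<and> (\<forall>c\<in>S. lie c v \<in> H)"
        if "finite S" "S \<subseteq> ?C k" for S
        using that
      proof (induction S rule: finite_induct)
        case empty
        then show ?case using \<open>\<exists>v. v \<notin> H \<and> (\<forall>c\<in>?C (Suc k). lie c v \<in> H)\<close> by simp
      next
        case (insert c S)
        \<comment> \<open>The elements of \<open>?C k\<close> are treated one at a time.
          \<open>U\<close> is stable under the new element \<open>c\<close> because the bracket of
          \<open>c\<close> with anything already treated lies in \<open>?C (Suc k)\<close>, which
          maps \<open>U\<close> into \<open>H\<close>.\<close>
        define U where "U = {v. (\<forall>c\<in>?C (Suc k). lie c v \<in> H) \<and> (\<forall>c\<in>S. lie c v \<in> H)}"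
        have cH: "c \<in> H" and cC: "c \<in> ?C k" using insert(4) C_H by auto
        have stable: "lie c v \<in> U" if v: "v \<in> U" for v
        proof -
          have "lie d (lie c v) \<in> H" if d: "d \<in> ?C (Suc k)" for d
          proof -
            have "lie d c = - lie c d" by (rule lie_skew)
            then have "lie d c \<in> ?C (Suc k)"
              using C_lie[OF cH d] C_mono[of "Suc k"] subC[of "Suc k"]
              by (metis complex_vector.subspace_neg subsetD)
            then have "lie (lie d c) v \<in> H" "lie c (lie d v) \<in> H"
              using v d cH HH by (auto simp: U_def)
            then show ?thesis
              unfolding lie_lie_right[of d c v] by (rule complex_vector.subspace_add[OF subH])
          qed
          moreover have "lie d (lie c v) \<in> H" if d: "d \<in> S" for d
          proof -
            have "lie d c \<in> ?C (Suc k)" using d insert(4) C_H cC by (intro C_lie) auto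
            then have "lie (lie d c) v \<in> H" "lie c (lie d v) \<in> H"
              using v d cH HH by (auto simp: U_def)
            then show ?thesis
              unfolding lie_lie_right[of d c v] by (rule complex_vector.subspace_add[OF subH])
          qed
          ultimately show ?thesis by (simp add: U_def)
        qed
        obtain v where v: "v \<in> U" "v \<notin> H" using insert(3,4) by (auto simp: U_def)
        have "(\<lambda>v. lie c v - 0 *\<^sub>C v) = lie c" by simp
        then obtain n where "(lie c ^^ n) v = 0" using nil[of c v] unfolding gen_eigen_def by auto
        then have "(lie c ^^ n) v \<in> H" using complex_vector.subspace_0[OF subH] by simp
        \<comment> \<open>The iterates of \<open>lie c\<close> on \<open>v\<close> reach
          \<open>H\<close>, and \<open>u\<close> is the last one before the first entry.\<close>
        then have "\<exists>u. u \<in> U \<and> u \<notin> H \<and> lie c u \<in> H"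
          using v
        proof (induction n arbitrary: v)
          case (Suc n)
          show ?case
          proof (cases "lie c v \<in> H")
            case False
            have "(lie c ^^ n) (lie c v) \<in> H" using Suc(2) by (simp only: funpow_Suc_right comp_apply)
            then show ?thesis using Suc(1) stable Suc(3) False by blast
          qed (use Suc in blast)
        qed simp
        then show ?case by (auto simp: U_def)
      qed
      have "finite_dimensional (?C k)"
        by (rule finite_dimensional_subspace[OF finite_dimensional subC]) simp
      then obtain D where D: "finite D" "cindependent D" "cspan D = ?C k"
        by (rule finite_dimensional_basis)
      have "D \<subseteq> ?C k" using complex_vector.span_superset[of D] D(3) by simp
      then obtain v where v: "v \<notin> H" "\<forall>c\<in>D. lie c v \<in> H"
        using S[OF D(1)] by auto
      have "cspan D \<subseteq> {c. lie c v \<in> H}"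
        using v(2) subH by (intro complex_vector.span_minimal)
          (auto simp: complex_vector.subspace_def lie_add_left lie_scaleC_left)
      then show ?thesis using v(1) D(3) by blast
    qed
    have "\<exists>v. v \<notin> H \<and> (\<forall>c\<in>?C N. lie c v \<in> H)"
      using False N complex_vector.subspace_0[OF subH] by auto
    then have "\<exists>v. v \<notin> H \<and> (\<forall>c\<in>?C 0. lie c v \<in> H)"
    proof (induction N)
      case (Suc n)
      then show ?case using step by blast
    qed
    then obtain v where v: "v \<notin> H" "\<And>c. c \<in> H \<Longrightarrow> lie c v \<in> H" by auto
    have "lie v h \<in> H" if "h \<in> H" for h
      using complex_vector.subspace_neg[OF subH v(2)[OF that]] by (simp add: lie_skew[of v h])
    then show False using norm v(1) by blast
  qed
qed

text \<open>Cartan's criterion.  Here \<open>s\<close> is the complex conjugate of the semisimple part of \<open>\<rho> x\<close>.  For a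
  generalised eigenvector \<open>z\<close> of \<open>ad x\<close> the commutator \<open>[s, \<rho> z]\<close> is a multiple of \<open>\<rho> z\<close>, so the trace
  of \<open>\<rho> x s\<close> vanishes; but that trace is the sum of the \<open>\<bar>l b\<bar>\<^sup>2\<close>.\<close>

lemma trace_form_zero_imp_nilpotent:
  assumes \<rho>: "lie_module (\<rho> :: 'g \<Rightarrow> 'e::complex_vector \<Rightarrow> 'e)"
    and B: "finite B" "cindependent B" and stable: "\<And>x. \<rho> x ` cspan B \<subseteq> cspan B"
    and zero: "\<And>x y. ctrace B (\<lambda>w. \<rho> x (\<rho> y w)) = 0" and "w \<in> cspan B"
  shows "gen_eigen (\<rho> x) 0 w"
proof -
  let ?W = "cspan B"
  note lin = lie_module_linear[OF \<rho>] and linl = lie_module_linear_left[OF \<rho>]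
  have W: "finite_dimensional ?W" by (rule finite_dimensional_span[OF B(1)])
  have st: "\<rho> x w \<in> ?W" if "w \<in> ?W" for x w using stable that by blast
  obtain C l where C: "finite C" "cindependent C" "cspan C = ?W"
    and eig: "\<And>b. b \<in> C \<Longrightarrow> gen_eigen (\<rho> x) (l b) b"
    and diag: "\<And>b. b \<in> C \<Longrightarrow> crep C (\<rho> x b - l b *\<^sub>C b) b = 0"
    using ex_gen_eigen_basis[OF W lin stable, of x] by blast
  have CW: "b \<in> ?W" if "b \<in> C" for b using C(3) complex_vector.span_base[OF that] by simp
  obtain s where s: "clinear s" "\<And>b. b \<in> C \<Longrightarrow> s b = cnj (l b) *\<^sub>C b"
    using complex_vector_pair.linear_independent_extend[OF C(2), of "\<lambda>b. cnj (l b) *\<^sub>C b"] by auto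
  have sW: "s w \<in> ?W" if "w \<in> ?W" for w
  proof -
    have "s ` cspan C \<subseteq> cspan C"
      unfolding complex_vector_pair.linear_span_image[OF s(1), symmetric]
      by (rule complex_vector.span_minimal)
        (auto simp: s(2) intro: complex_vector.span_scale[OF complex_vector.span_base])
    then show ?thesis using that C(3) by auto
  qed
  \<comment> \<open>\<open>s\<close> scales each generalised eigenspace as a whole, not only the
    basis vectors in it: the components of \<open>w\<close> at other eigenvalues sum to
    zero.\<close>
  have s_eig: "s w = cnj m *\<^sub>C w" if w: "w \<in> ?W" "gen_eigen (\<rho> x) m w" for w m
  proof -
    define u where "u b = crep C w b *\<^sub>C b" for b
    define C1 where "C1 = {b \<in> C. l b = m}"
    define C2 where "C2 = {b \<in> C. l b \<noteq> m}"
    have fin: "finite C1" "finite C2" "C1 \<inter> C2 = {}" and CC: "C1 \<union> C2 = C"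
      using C(1) by (auto simp: C1_def C2_def)
    have u: "gen_eigen (\<rho> x) (l b) (u b)" if "b \<in> C" for b
      unfolding u_def by (rule gen_eigen_scale[OF lin eig[OF that]])
    have "w = sum u (C1 \<union> C2)"
      using crep_sum[OF C(1,2)] w(1) C(3) by (simp add: u_def CC)
    then have split: "w = sum u C1 + sum u C2"
      unfolding sum.union_disjoint[OF fin] .
    have e1: "sum u C1 \<in> {w. gen_eigen (\<rho> x) m w}"
      by (rule complex_vector.subspace_sum[OF subspace_gen_eigen[OF lin]])
        (use u in \<open>auto simp: C1_def\<close>)
    have "sum u C2 = w - sum u C1" using split by simp
    also have "\<dots> \<in> {w. gen_eigen (\<rho> x) m w}"
      by (rule complex_vector.subspace_diff[OF subspace_gen_eigen[OF lin] _ e1]) (use w(2) in simp)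
    finally have "gen_eigen (\<rho> x) m (sum u C2)" by simp
    then have "sum u C2 = 0"
      by (intro gen_eigen_sum_other[OF lin fin(2), where m = l and l = m and u = u]) (use u in \<open>auto simp: C2_def\<close>)
    then have w1: "w = sum u C1" using split by simp
    then have "s w = (\<Sum>b\<in>C1. s (u b))" by (simp add: clinear_sum[OF s(1)])
    also have "\<dots> = (\<Sum>b\<in>C1. cnj m *\<^sub>C u b)"
      by (intro sum.cong refl)
        (simp add: C1_def u_def clinear_scale[OF s(1)] s(2) scaleC_scaleC mult.commute)
    also have "\<dots> = cnj m *\<^sub>C w" unfolding w1 by (simp add: complex_vector.scale_sum_right)
    finally show ?thesis .
  qed
  have zeroC: "ctrace C (\<lambda>w. \<rho> y (\<rho> z w)) = 0" for y z
    using ctrace_basis[OF C(1,2) B C(3) clinear_compose[OF lin[of y] lin[of z]]] zero st C(3) by auto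
  \<comment> \<open>\<open>\<rho> z\<close> raises eigenvalues by \<open>m\<close>, and conjugation
    is additive. Conjugation is chosen because it makes the diagonal entries of the final trace
    nonnegative.\<close>
  have s_comm: "s (\<rho> z w) = \<rho> z (s w) + cnj m *\<^sub>C \<rho> z w"
    if z: "gen_eigen (lie x) m z" and w: "w \<in> ?W" for z m w
  proof -
    have "cspan C \<subseteq> {w. s (\<rho> z w) = \<rho> z (s w) + cnj m *\<^sub>C \<rho> z w}"
    proof (rule complex_vector.span_minimal)
      show "csubspace {w. s (\<rho> z w) = \<rho> z (s w) + cnj m *\<^sub>C \<rho> z w}"
        by (simp add: complex_vector.subspace_def clinear_0[OF lin] clinear_0[OF s(1)]
            clinear_add[OF lin] clinear_add[OF s(1)] clinear_scale[OF lin] clinear_scale[OF s(1)]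
            scaleC_add_right scaleC_scaleC mult.commute add_ac)
      show "C \<subseteq> {w. s (\<rho> z w) = \<rho> z (s w) + cnj m *\<^sub>C \<rho> z w}"
      proof safe
        fix b assume b: "b \<in> C"
        have "s (\<rho> z b) = cnj (l b + m) *\<^sub>C \<rho> z b"
          by (rule s_eig[OF st[OF CW[OF b]] gen_eigen_lie_module[OF \<rho> z eig[OF b]]])
        then show "s (\<rho> z b) = \<rho> z (s b) + cnj m *\<^sub>C \<rho> z b"
          by (simp add: s(2)[OF b] clinear_scale[OF lin] scaleC_add_left)
      qed
    qed
    then show ?thesis using w C(3) by blast
  qed
  \<comment> \<open>Cyclicity of the trace carries \<open>\<rho> z\<close> past \<open>s\<close>.
    The two orders differ by \<open>cnj m\<close> times a value of the trace form, which is
    zero.\<close>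
  have tr_lie: "ctrace C (\<lambda>w. \<rho> (lie y z) (s w)) = 0" if z: "gen_eigen (lie x) m z" for y z m
  proof -
    have st': "\<And>w. w \<in> cspan C \<Longrightarrow> \<rho> z w \<in> cspan C" for z using st C(3) by simp
    have sW': "\<And>w. w \<in> cspan C \<Longrightarrow> s w \<in> cspan C" using sW C(3) by simp
    have mem: "b \<in> cspan C" if "b \<in> C" for b by (rule complex_vector.span_base[OF that])
    have "ctrace C (\<lambda>w. \<rho> z (\<rho> y (s w))) = ctrace C (\<lambda>w. \<rho> y (s (\<rho> z w)))"
      by (rule ctrace_comm[OF C(1,2) C(1,2) lin _ clinear_compose[OF lin s(1)]])
        (auto intro: st' sW')
    also have "\<dots> = ctrace C (\<lambda>w. \<rho> y (\<rho> z (s w)) + cnj m *\<^sub>C \<rho> y (\<rho> z w))"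
      by (rule ctrace_cong) (simp add: s_comm[OF z] CW clinear_add[OF lin] clinear_scale[OF lin])
    also have "\<dots> = ctrace C (\<lambda>w. \<rho> y (\<rho> z (s w))) + cnj m * ctrace C (\<lambda>w. \<rho> y (\<rho> z w))"
      using ctrace_add[OF C(2), of "\<lambda>w. \<rho> y (\<rho> z (s w))" "\<lambda>w. cnj m *\<^sub>C \<rho> y (\<rho> z w)"]
        ctrace_scale[OF C(2), of "\<lambda>w. \<rho> y (\<rho> z w)" "cnj m"]
      by (simp add: st' sW' mem complex_vector.span_scale)
    finally have eq: "ctrace C (\<lambda>w. \<rho> z (\<rho> y (s w))) = ctrace C (\<lambda>w. \<rho> y (\<rho> z (s w)))"
      by (simp add: zeroC)
    have "ctrace C (\<lambda>w. \<rho> (lie y z) (s w)) =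
        ctrace C (\<lambda>w. \<rho> y (\<rho> z (s w))) - ctrace C (\<lambda>w. \<rho> z (\<rho> y (s w)))"
      unfolding lie_module_lie[OF \<rho>] by (intro ctrace_diff[OF C(2)] st' sW' mem)
    then show ?thesis using eq by simp
  qed
  have mem: "\<rho> y (s b) \<in> cspan C" if "b \<in> C" for b y using st sW CW[OF that] C(3) by simp
  have sub_tr: "csubspace {v. ctrace C (\<lambda>w. \<rho> (f v) (s w)) = 0}" if "clinear f" for f :: "'g \<Rightarrow> 'g"
    using that ctrace_add[OF C(2) mem mem] ctrace_scale[OF C(2) mem]
    by (simp add: complex_vector.subspace_def clinear_0 clinear_add clinear_scale
        clinear_0[OF linl] clinear_add[OF linl] clinear_scale[OF linl]
        ctrace_def complex_vector.representation_zero)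
  have tr_lie': "ctrace C (\<lambda>w. \<rho> (lie y z) (s w)) = 0" for y z
  proof -
    obtain D k where D: "cspan D = UNIV" "\<And>b. b \<in> D \<Longrightarrow> gen_eigen (lie x) (k b) b"
      using ex_gen_eigen_basis[OF finite_dimensional lie_module_linear[OF lie_module_adjoint], of x]
      by auto
    have "cspan D \<subseteq> {z. ctrace C (\<lambda>w. \<rho> (lie y z) (s w)) = 0}"
      by (rule complex_vector.span_minimal[OF _ sub_tr[OF lie_module_linear[OF lie_module_adjoint]]])
        (use tr_lie D(2) in auto)
    then show ?thesis using D(1) by blast
  qed
  \<comment> \<open>By perfectness \<open>x\<close> is itself a combination of brackets.\<close>
  have "ctrace C (\<lambda>w. \<rho> x (s w)) = 0"
    by (rule perfect_induct[OF sub_tr[OF clinear_id] tr_lie'])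
  moreover have "ctrace C (\<lambda>w. \<rho> x (s w)) = (\<Sum>b\<in>C. of_real ((cmod (l b))\<^sup>2))"
    unfolding ctrace_def
  proof (rule sum.cong[OF refl])
    fix b assume b: "b \<in> C"
    have m: "\<rho> x b \<in> cspan C" "b \<in> cspan C" using st CW[OF b] C(3) by auto
    have "crep C (\<rho> x b) b = l b"
      using diag[OF b] m complex_vector.representation_basis[OF C(2) b]
      by (simp add: complex_vector.representation_diff[OF C(2)] complex_vector.span_scale
          complex_vector.representation_scale[OF C(2)])
    then have "crep C (\<rho> x (s b)) b = l b * cnj (l b)"
      using m by (simp add: s(2)[OF b] clinear_scale[OF lin] complex_vector.representation_scale[OF C(2)])
    then show "crep C (\<rho> x (s b)) b = of_real ((cmod (l b))\<^sup>2)"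
      by (simp only: complex_norm_square)
  qed
  ultimately have "(\<Sum>b\<in>C. (cmod (l b))\<^sup>2) = 0"
    by (metis of_real_eq_0_iff of_real_sum)
  then have "l b = 0" if "b \<in> C" for b
    using that C(1) by (simp add: sum_nonneg_eq_0_iff)
  then have "cspan C \<subseteq> {w. gen_eigen (\<rho> x) 0 w}"
    by (intro complex_vector.span_minimal subspace_gen_eigen lin) (use eig in force)
  then show ?thesis using assms(6) C(3) by blast
qed

text \<open>A root vector \<open>z\<close> for \<open>h\<close> shifts the generalised eigenvalues
  of \<open>\<rho> h\<close> by \<open>m \<noteq> 0\<close>, while \<open>\<rho> h\<close> is
  nilpotent on the span; so \<open>z\<close> acts by zero. The elements that act by zero form an
  ideal, which is therefore all of \<open>g\<close>.\<close>

lemma trace_form_zero_imp_trivial: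
  assumes \<rho>: "lie_module (\<rho> :: 'g \<Rightarrow> 'e::complex_vector \<Rightarrow> 'e)"
    and B: "finite B" "cindependent B" and stable: "\<And>x. \<rho> x ` cspan B \<subseteq> cspan B"
    and zero: "\<And>x y. ctrace B (\<lambda>w. \<rho> x (\<rho> y w)) = 0" and "w \<in> cspan B"
  shows "\<rho> x w = 0"
proof -
  note lin = lie_module_linear[OF \<rho>] and linl = lie_module_linear_left[OF \<rho>]
  note nil = trace_form_zero_imp_nilpotent[OF \<rho> B stable zero]
  obtain h z :: 'g and m where z: "m \<noteq> 0" "z \<noteq> 0" "gen_eigen (lie h) m z"
    using ex_nonzero_root_vector by blast
  let ?K = "{x. \<forall>w\<in>cspan B. \<rho> x w = 0}"
  have "z \<in> ?K"
  proof safe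
    fix w assume w: "w \<in> cspan B"
    have "gen_eigen (\<rho> h) (0 + m) (\<rho> z w)"
      by (rule gen_eigen_lie_module[OF \<rho> z(3) nil[OF w]])
    moreover have "gen_eigen (\<rho> h) 0 (\<rho> z w)" using stable w by (intro nil) blast
    ultimately show "\<rho> z w = 0" using gen_eigen_unique[OF lin] z(1) by simp
  qed
  moreover have "lie_ideal ?K"
    unfolding lie_ideal_def
  proof safe
    show "csubspace ?K"
      by (simp add: complex_vector.subspace_def clinear_0[OF linl] clinear_add[OF linl] clinear_scale[OF linl])
    fix x y w assume "\<forall>w\<in>cspan B. \<rho> y w = 0" "w \<in> cspan B"
    then show "\<rho> (lie x y) w = 0"
      using stable by (auto simp: lie_module_lie[OF \<rho>] clinear_0[OF lin] image_subset_iff)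
  qed
  ultimately have "?K = UNIV" using ideal_cases z(2) by blast
  then show ?thesis using assms(6) by blast
qed

end

section \<open>Invariant forms and Casimir elements\<close>

definition dual_bases :: "('g::complex_vector \<Rightarrow> 'g \<Rightarrow> complex) \<Rightarrow> 'g set \<Rightarrow> ('g \<Rightarrow> 'g) \<Rightarrow> bool"
  where "dual_bases \<beta> E f \<longleftrightarrow> finite E \<and> (\<forall>e\<in>E. \<beta> e (f e) = 1) \<and>
    (\<forall>v. (\<Sum>e\<in>E. \<beta> v (f e) *\<^sub>C e) = v) \<and> (\<forall>v. (\<Sum>e\<in>E. \<beta> e v *\<^sub>C f e) = v)"

definition invariant_form :: "('g::complex_lie_algebra \<Rightarrow> 'g \<Rightarrow> complex) \<Rightarrow> bool"
  where "invariant_form \<beta> \<longleftrightarrow> cbilinear \<beta> \<and> (\<forall>x y. \<beta> x y = \<beta> y x) \<and>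
    (\<forall>x y z. \<beta> (lie x y) z = \<beta> x (lie y z))"

text \<open>This is the invariance of the tensor \<Sum> e \<otimes> f e, tested against bilinear
  maps. It holds because an invariant form makes the matrices of \<open>lie x\<close> in the two
  dual bases negative transposes of each other.\<close>

lemma dual_bases_invariant:
  assumes \<beta>: "invariant_form \<beta>" and d: "dual_bases \<beta> E f" and \<Phi>: "cbilinear \<Phi>"
  shows "(\<Sum>e\<in>E. \<Phi> (lie x e) (f e) + \<Phi> e (lie x (f e))) = 0"
proof -
  have lin: "clinear (\<Phi> a)" "clinear (\<lambda>a. \<Phi> a b)" for a b
    using \<Phi> by (auto simp: cbilinear_def)
  have "(\<Sum>e\<in>E. \<Phi> (lie x e) (f e)) = (\<Sum>e\<in>E. \<Sum>e'\<in>E. \<beta> (lie x e) (f e') *\<^sub>C \<Phi> e' (f e))"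
  proof (rule sum.cong[OF refl])
    fix e
    have "\<Phi> (lie x e) (f e) = \<Phi> (\<Sum>e'\<in>E. \<beta> (lie x e) (f e') *\<^sub>C e') (f e)"
      using d by (simp add: dual_bases_def)
    then show "\<Phi> (lie x e) (f e) = (\<Sum>e'\<in>E. \<beta> (lie x e) (f e') *\<^sub>C \<Phi> e' (f e))"
      by (simp add: clinear_sum[OF lin(2)] clinear_scale[OF lin(2)])
  qed
  moreover have "(\<Sum>e\<in>E. \<Phi> e (lie x (f e))) = (\<Sum>e\<in>E. \<Sum>e'\<in>E. \<beta> e' (lie x (f e)) *\<^sub>C \<Phi> e (f e'))"
  proof (rule sum.cong[OF refl])
    fix e
    have "\<Phi> e (lie x (f e)) = \<Phi> e (\<Sum>e'\<in>E. \<beta> e' (lie x (f e)) *\<^sub>C f e')"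
      using d by (simp add: dual_bases_def)
    then show "\<Phi> e (lie x (f e)) = (\<Sum>e'\<in>E. \<beta> e' (lie x (f e)) *\<^sub>C \<Phi> e (f e'))"
      by (simp add: clinear_sum[OF lin(1)] clinear_scale[OF lin(1)])
  qed
  moreover have "(\<Sum>e\<in>E. \<Sum>e'\<in>E. \<beta> e' (lie x (f e)) *\<^sub>C \<Phi> e (f e')) =
      (\<Sum>e\<in>E. \<Sum>e'\<in>E. \<beta> e (lie x (f e')) *\<^sub>C \<Phi> e' (f e))"
    by (rule sum.swap)
  moreover have "\<beta> (lie x e) (f e') + \<beta> e (lie x (f e')) = 0" for e e'
  proof -
    have lin': "clinear (\<lambda>a. \<beta> a b)" for b using \<beta> by (simp add: invariant_form_def cbilinear_def)
    have "\<beta> (lie x e) (f e') = - \<beta> (lie e x) (f e')"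
      by (simp add: lie_skew[of x e] clinear_neg[OF lin'])
    moreover have "\<beta> (lie e x) (f e') = \<beta> e (lie x (f e'))" using \<beta> unfolding invariant_form_def by blast
    ultimately show ?thesis by simp
  qed
  ultimately show ?thesis
    by (simp add: sum.distrib flip: scaleC_add_left)
      (simp add: complex_vector.scale_zero_left flip: sum.distrib scaleC_add_left)
qed

lemma cbilinear_lie_module: "lie_module \<rho> \<Longrightarrow> clinear g \<Longrightarrow> cbilinear (\<lambda>a b. g (\<rho> a (\<rho> b w)))"
  unfolding cbilinear_def
  by (blast intro: clinear_compose clinear_compose[OF lie_module_linear lie_module_linear_left]
      clinear_compose[OF _ lie_module_linear_left]
      clinear_compose[OF _ clinear_compose[OF lie_module_linear lie_module_linear_left]])

lemma casimir_commute:
  assumes \<beta>: "invariant_form \<beta>" and d: "dual_bases \<beta> E f" and \<rho>: "lie_module \<rho>"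
  shows "\<rho> x (\<Sum>e\<in>E. \<rho> e (\<rho> (f e) w)) = (\<Sum>e\<in>E. \<rho> e (\<rho> (f e) (\<rho> x w)))"
proof -
  note lin = lie_module_linear[OF \<rho>]
  have "(\<Sum>e\<in>E. \<rho> (lie x e) (\<rho> (f e) w) + \<rho> e (\<rho> (lie x (f e)) w)) = 0"
    by (rule dual_bases_invariant[OF \<beta> d cbilinear_lie_module[OF \<rho> clinear_id]])
  moreover have "\<rho> (lie x e) (\<rho> (f e) w) + \<rho> e (\<rho> (lie x (f e)) w) =
      \<rho> x (\<rho> e (\<rho> (f e) w)) - \<rho> e (\<rho> (f e) (\<rho> x w))" for e
    by (simp add: lie_module_lie[OF \<rho>] clinear_diff[OF lin])
  ultimately show ?thesis by (simp add: clinear_sum[OF lin] sum_subtractf)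
qed

definition trace_form :: "'e::complex_vector set \<Rightarrow> ('g \<Rightarrow> 'e \<Rightarrow> 'e) \<Rightarrow> 'g \<Rightarrow> 'g \<Rightarrow> complex"
  where "trace_form B \<rho> x y = ctrace B (\<lambda>w. \<rho> x (\<rho> y w))"

lemma invariant_form_trace_form:
  assumes \<rho>: "lie_module \<rho>" and B: "finite B" "cindependent B"
    and stable: "\<And>x. \<rho> x ` cspan B \<subseteq> cspan B"
  shows "invariant_form (trace_form B \<rho>)"
proof -
  note lin = lie_module_linear[OF \<rho>] and linl = lie_module_linear_left[OF \<rho>]
  have st: "\<rho> x w \<in> cspan B" if "w \<in> cspan B" for x w using stable that by blast
  have m: "\<rho> x (\<rho> y b) \<in> cspan B" if "b \<in> B" for x y b
    by (intro st complex_vector.span_base that)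
  have comm: "ctrace B (\<lambda>w. \<rho> x (\<rho> y (\<rho> z w))) = ctrace B (\<lambda>w. \<rho> y (\<rho> z (\<rho> x w)))" for x y z
    by (rule ctrace_comm[OF B B lin st clinear_compose[OF lin lin]]) (auto intro: st)
  have "trace_form B \<rho> x y = trace_form B \<rho> y x" for x y
    unfolding trace_form_def by (rule ctrace_comm[OF B B lin st lin st])
  moreover have "trace_form B \<rho> (lie x y) z = trace_form B \<rho> x (lie y z)" for x y z
  proof -
    have "ctrace B (\<lambda>w. \<rho> (lie x y) (\<rho> z w)) =
        ctrace B (\<lambda>w. \<rho> x (\<rho> y (\<rho> z w))) - ctrace B (\<lambda>w. \<rho> y (\<rho> x (\<rho> z w)))"
      unfolding lie_module_lie[OF \<rho>] by (intro ctrace_diff[OF B(2)] st m complex_vector.span_base)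
    also have "ctrace B (\<lambda>w. \<rho> y (\<rho> x (\<rho> z w))) = ctrace B (\<lambda>w. \<rho> x (\<rho> z (\<rho> y w)))"
      by (rule comm)
    also have "ctrace B (\<lambda>w. \<rho> x (\<rho> y (\<rho> z w))) - ctrace B (\<lambda>w. \<rho> x (\<rho> z (\<rho> y w))) =
        ctrace B (\<lambda>w. \<rho> x (\<rho> (lie y z) w))"
      unfolding lie_module_lie[OF \<rho>] clinear_diff[OF lin]
      by (intro ctrace_diff[OF B(2), symmetric] st m complex_vector.span_base)
    finally show ?thesis by (simp add: trace_form_def)
  qed
  moreover have "cbilinear (trace_form B \<rho>)"
    unfolding cbilinear_def clinear_iff trace_form_def
    by (simp add: clinear_add[OF lin] clinear_scale[OF lin] clinear_add[OF linl]
        clinear_scale[OF linl] ctrace_add[OF B(2)] ctrace_scale[OF B(2)] m scaleC_complex_def)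
  ultimately show ?thesis unfolding invariant_form_def by blast
qed

context simple_lie
begin

text \<open>The radical of an invariant form is an ideal, so a nonzero form is nondegenerate. Its
  Gram map \<open>T\<close> is then injective, hence bijective, and \<open>f\<close> is the
  inverse.\<close>

lemma ex_dual_bases:
  assumes \<beta>: "invariant_form (\<beta> :: 'g \<Rightarrow> 'g \<Rightarrow> complex)" and "\<beta> x0 y0 \<noteq> 0"
  obtains E f where "dual_bases \<beta> E f" "E \<noteq> {}" "cindependent E" "cspan E = UNIV"
proof -
  have lin: "clinear (\<beta> a)" "clinear (\<lambda>a. \<beta> a b)" and sym: "\<beta> a b = \<beta> b a"
    and inv: "\<beta> (lie a b) c = \<beta> a (lie b c)" for a b c
    using \<beta> unfolding invariant_form_def cbilinear_def by blast+
  let ?R = "{x. \<forall>y. \<beta> x y = 0}"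
  have "lie_ideal ?R"
    unfolding lie_ideal_def
  proof safe
    show "csubspace ?R"
      by (simp add: complex_vector.subspace_def clinear_0[OF lin(2)] clinear_add[OF lin(2)] clinear_scale[OF lin(2)])
    fix x y z assume "\<forall>z. \<beta> y z = 0"
    then have "\<beta> (lie y x) z = 0" by (simp add: inv)
    then show "\<beta> (lie x y) z = 0" by (simp add: lie_skew[of x y] clinear_neg[OF lin(2)])
  qed
  then have "?R = {0}" using ideal_cases assms(2) by blast
  then have nondeg: "x = 0" if "\<And>y. \<beta> x y = 0" for x using that by blast
  obtain E where E: "finite E" "cindependent E" "cspan E = (UNIV :: 'g set)"
    by (rule finite_dimensional_basis[OF finite_dimensional])
  have E_eq: "y = 0" if "\<And>e. e \<in> E \<Longrightarrow> \<beta> e y = 0" for y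
  proof (rule nondeg)
    fix x
    have "cspan E \<subseteq> {x. \<beta> x y = 0}"
      by (rule complex_vector.span_minimal)
        (simp_all add: subset_iff that complex_vector.subspace_def clinear_0[OF lin(2)]
          clinear_add[OF lin(2)] clinear_scale[OF lin(2)])
    then show "\<beta> y x = 0" using E(3) sym by auto
  qed
  define T where "T y = (\<Sum>e\<in>E. \<beta> e y *\<^sub>C e)" for y
  have T: "clinear T"
    unfolding T_def
    by (rule clinear_sum_fun)
      (simp add: clinear_iff clinear_add[OF lin(1)] clinear_scale[OF lin(1)] scaleC_complex_def
        scaleC_add_left scaleC_scaleC)
  have repT: "crep E (T y) e = \<beta> e y" if "e \<in> E" for y e
  proof -
    have "crep E (T y) e = (\<Sum>e'\<in>E. crep E (\<beta> e' y *\<^sub>C e') e)"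
      unfolding T_def
      by (subst complex_vector.representation_sum[OF E(2)]) (simp_all add: E(3))
    also have "\<dots> = (\<Sum>e'\<in>E. if e' = e then \<beta> e' y else 0)"
      by (intro sum.cong refl)
        (simp add: complex_vector.representation_scale[OF E(2)] E(3)
          complex_vector.representation_basis[OF E(2)])
    finally show ?thesis using that E(1) by (simp add: sum.delta)
  qed
  have "\<exists>y. T y = x" for x
  proof -
    have "x \<in> T ` UNIV"
    proof (rule injective_endomorphism_surjective[OF finite_dimensional T])
      fix w assume "T w = 0"
      then have "\<beta> e w = 0" if "e \<in> E" for e
        using repT[OF that, of w] by (simp add: complex_vector.representation_zero)
      then show "w = 0" by (rule E_eq)
    qed simp_all
    then show ?thesis by auto
  qed
  then obtain f where f: "T (f x) = x" for x by metis
  have \<beta>f: "\<beta> e (f e') = (if e = e' then 1 else 0)" if "e \<in> E" "e' \<in> E" for e e'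
    using repT[OF that(1), of "f e'"] complex_vector.representation_basis[OF E(2) that(2)]
    by (auto simp: f)
  have rep: "\<beta> v (f e) = crep E v e" if e: "e \<in> E" for v e
  proof -
    have "v = (\<Sum>e\<in>E. crep E v e *\<^sub>C e)" using crep_sum[OF E(1,2)] E(3) by simp
    then have "\<beta> v (f e) = \<beta> (\<Sum>e\<in>E. crep E v e *\<^sub>C e) (f e)" by simp
    also have "\<dots> = (\<Sum>e'\<in>E. if e' = e then crep E v e' else 0)"
      unfolding clinear_sum[OF lin(2)]
      by (intro sum.cong refl) (simp add: clinear_scale[OF lin(2)] \<beta>f e scaleC_complex_def)
    finally show ?thesis using e E(1) by (simp add: sum.delta)
  qed
  have "dual_bases \<beta> E f"
    unfolding dual_bases_def
  proof (intro conjI allI ballI)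
    show "finite E" by (rule E)
    show "\<beta> e (f e) = 1" if "e \<in> E" for e using \<beta>f that by simp
    show "(\<Sum>e\<in>E. \<beta> v (f e) *\<^sub>C e) = v" for v
      using crep_sum[OF E(1,2), of v] E(3) by (simp add: rep)
    show "(\<Sum>e\<in>E. \<beta> e v *\<^sub>C f e) = v" for v
    proof -
      have "\<beta> e' (v - (\<Sum>e\<in>E. \<beta> e v *\<^sub>C f e)) = 0" if "e' \<in> E" for e'
      proof -
        have "(\<Sum>e\<in>E. \<beta> e v * \<beta> e' (f e)) = (\<Sum>e\<in>E. if e = e' then \<beta> e v else 0)"
          by (intro sum.cong refl) (simp add: \<beta>f that)
        then show ?thesis
          using that E(1)
          by (simp add: clinear_diff[OF lin(1)] clinear_sum[OF lin(1)] clinear_scale[OF lin(1)]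
              scaleC_complex_def sum.delta)
      qed
      then have "v - (\<Sum>e\<in>E. \<beta> e v *\<^sub>C f e) = 0" by (rule E_eq)
      then show ?thesis by simp
    qed
  qed
  moreover have "E \<noteq> {}"
  proof
    assume "E = {}"
    then have "x0 = 0" using E(3) by auto
    then show False using assms(2) by (simp add: clinear_0[OF lin(2)])
  qed
  ultimately show ?thesis using that E(2,3) by blast
qed

text \<open>A substitute for complete reducibility: the Casimir element of the trace form of \<open>W\<close> has trace
  \<open>dim g \<noteq> 0\<close>, so its Fitting null component is a proper submodule, and it contains \<open>w\<close>.\<close>

lemma invariant_in_image_eq_0:
  assumes \<rho>: "lie_module (\<rho> :: 'g \<Rightarrow> 'e::complex_vector \<Rightarrow> 'e)"
    and W: "finite_dimensional W" and stable: "\<And>x. \<rho> x ` W \<subseteq> W"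
    and "w \<in> cspan {\<rho> x u |x u. u \<in> W}" and inv: "\<And>x. \<rho> x w = 0"
  shows "w = 0"
  using assms(2-4)
proof (induction "cdim W" arbitrary: W rule: less_induct)
  case less
  note W = less(2) and stable = less(3) and w = less(4)
  note lin = lie_module_linear[OF \<rho>]
  have sub: "csubspace W" by (rule finite_dimensional_subspaceD[OF W])
  obtain B where B: "finite B" "cindependent B" "cspan B = W"
    by (rule finite_dimensional_basis[OF W])
  have stB: "\<rho> x ` cspan B \<subseteq> cspan B" for x using stable B(3) by simp
  have st: "\<rho> x u \<in> W" if "u \<in> W" for x u
    using stable[of x] that by (meson imageI subsetD)
  show "w = 0"
  \<comment> \<open>If the trace form vanishes, Cartan's criterion makes \<open>g\<close> act by
    zero on \<open>W\<close>, so g W contains only 0.\<close>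
  proof (cases "\<forall>x y. trace_form B \<rho> x y = 0")
    case True
    then have zero: "ctrace B (\<lambda>w. \<rho> x (\<rho> y w)) = 0" for x y
      by (simp add: trace_form_def)
    have "\<rho> x u = 0" if "u \<in> W" for x u
      by (rule trace_form_zero_imp_trivial[OF \<rho> B(1,2) stB zero]) (simp add: B(3) that)
    then have "{\<rho> x u |x u. u \<in> W} \<subseteq> {0}" by auto
    then have "cspan {\<rho> x u |x u. u \<in> W} \<subseteq> {0}"
      by (rule complex_vector.span_minimal[OF _ complex_vector.subspace_single_0])
    then show ?thesis using w by (meson singletonD subsetD)
  next
    case False
    define \<beta> where "\<beta> = trace_form B \<rho>"
    have \<beta>: "invariant_form \<beta>"
      unfolding \<beta>_def by (rule invariant_form_trace_form[OF \<rho> B(1,2) stB])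
    obtain x0 y0 where "\<beta> x0 y0 \<noteq> 0" using False by (auto simp: \<beta>_def)
    then obtain E f where d: "dual_bases \<beta> E f" and "E \<noteq> {}"
      by (rule ex_dual_bases[OF \<beta>])
    then have E: "finite E" "\<And>e. e \<in> E \<Longrightarrow> \<beta> e (f e) = 1" by (simp_all add: dual_bases_def)
    define c where "c u = (\<Sum>e\<in>E. \<rho> e (\<rho> (f e) u))" for u
    have c: "clinear c"
      unfolding c_def by (intro clinear_sum_fun clinear_compose[OF lin lin])
    have cW: "c ` W \<subseteq> W"
      unfolding c_def using st by (auto intro!: complex_vector.subspace_sum[OF sub])
    have c_comm: "c (\<rho> x u) = \<rho> x (c u)" for x u
      unfolding c_def by (rule casimir_commute[OF \<beta> d \<rho>, symmetric])
    have ck_comm: "(c ^^ k) (\<rho> x u) = \<rho> x ((c ^^ k) u)" for x u k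
      by (induction k) (simp_all add: c_comm)
    obtain k where k: "k > 0" "\<forall>w\<in>W. (c ^^ k) ((c ^^ k) w) = 0 \<longrightarrow> (c ^^ k) w = 0"
      "\<forall>w\<in>W. \<exists>u\<in>W. (c ^^ k) (w - (c ^^ k) u) = 0"
      using fitting[OF W c cW] by blast
    have lck: "clinear (c ^^ k)" by (rule clinear_funpow[OF c])
    have ckW: "(c ^^ k) u \<in> W" if "u \<in> W" for u using funpow_stable[of W c] cW that by blast
    define W0 where "W0 = {u \<in> W. (c ^^ k) u = 0}"
    have sub0: "csubspace W0"
      using sub by (auto simp: W0_def complex_vector.subspace_def clinear_0[OF lck]
          clinear_add[OF lck] clinear_scale[OF lck])
    have st0: "\<rho> x ` W0 \<subseteq> W0" for x
      by (auto simp: W0_def st ck_comm clinear_0[OF lin])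
    \<comment> \<open>If \<open>c\<close> were nilpotent on \<open>W\<close>, its trace would be
      zero. But each \<open>e\<close> contributes \<beta> e (f e) = 1, so the trace is the number of
      elements of the nonempty set \<open>E\<close>.\<close>
    have "W0 \<noteq> W"
    proof
      assume "W0 = W"
      obtain C l where C: "finite C" "cindependent C" "cspan C = W"
        and eig: "\<And>b. b \<in> C \<Longrightarrow> gen_eigen c (l b) b"
        and diag: "\<And>b. b \<in> C \<Longrightarrow> crep C (c b - l b *\<^sub>C b) b = 0"
        using ex_gen_eigen_basis[OF W c cW] by blast
      have "crep C (c b) b = 0" if b: "b \<in> C" for b
      proof -
        have "b \<in> W0" using complex_vector.span_base[OF b] C(3) \<open>W0 = W\<close> by simp
        then have "gen_eigen c 0 b" unfolding W0_def gen_eigen_def by auto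
        moreover have "b \<noteq> 0" using C(2) b complex_vector.dependent_zero by blast
        ultimately have "l b = 0" using gen_eigen_unique[OF c eig[OF b]] by blast
        then show ?thesis using diag[OF b] by simp
      qed
      then have "ctrace C c = 0" by (simp add: ctrace_def)
      then have "ctrace B c = 0"
        using ctrace_basis[OF B(1,2) C(1,2) _ c] B(3) C(3) cW by auto
      moreover have "ctrace B c = (\<Sum>e\<in>E. \<beta> e (f e))"
        unfolding c_def \<beta>_def trace_form_def
      proof (rule ctrace_sum[OF B(2)])
        fix e b assume "b \<in> B"
        then have "b \<in> W" using B(3) complex_vector.span_base by blast
        then show "\<rho> e (\<rho> (f e) b) \<in> cspan B" using st B(3) by simp
      qed
      ultimately have "of_nat (card E) = (0 :: complex)" using E by simp
      then show False using E(1) \<open>E \<noteq> {}\<close> by simp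
    qed
    moreover have "W0 \<subseteq> W" by (auto simp: W0_def)
    ultimately have dim: "cdim W0 < cdim W" by (intro cdim_psubset[OF W sub0]) blast
    have fd0: "finite_dimensional W0" by (rule finite_dimensional_subspace[OF W sub0]) (auto simp: W0_def)
    let ?G = "cspan {\<rho> x u |x u. u \<in> W0}"
    have sG: "?G \<subseteq> W0"
      by (rule complex_vector.span_minimal[OF _ sub0]) (use st0 in blast)
    \<comment> \<open>Fitting writes an element of \<open>W\<close> as one of \<open>W0\<close> plus
      one of the image of \<open>c ^^ k\<close>. As \<open>c\<close> commutes with the action, g W
      lies in g W0 plus that image.\<close>
    have split: "\<exists>y\<in>?G. \<exists>y'\<in>W. v = y + (c ^^ k) y'" if "v \<in> cspan {\<rho> x u |x u. u \<in> W}" for v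
      using that
    proof (induction rule: complex_vector.span_induct_alt)
      case base
      show ?case
        by (rule bexI[of _ 0], rule bexI[of _ 0])
          (simp_all add: clinear_0[OF lck] complex_vector.span_zero complex_vector.subspace_0[OF sub])
    next
      case (step a g v)
      then obtain x u where g: "g = \<rho> x u" "u \<in> W" by blast
      obtain y y' where y: "y \<in> ?G" "y' \<in> W" "v = y + (c ^^ k) y'" using step by blast
      obtain u' where u': "u' \<in> W" "(c ^^ k) (u - (c ^^ k) u') = 0" using k(3) g(2) by blast
      have "u - (c ^^ k) u' \<in> W0"
        using u' g(2) ckW sub by (auto simp: W0_def intro: complex_vector.subspace_diff)
      then have "\<rho> x (u - (c ^^ k) u') \<in> ?G" by (intro complex_vector.span_base) blast
      then have "a *\<^sub>C \<rho> x (u - (c ^^ k) u') + y \<in> ?G"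
        by (intro complex_vector.span_add complex_vector.span_scale y(1))
      moreover have "a *\<^sub>C \<rho> x u' + y' \<in> W"
        by (intro complex_vector.subspace_add[OF sub] complex_vector.subspace_scale[OF sub] st u' y)
      moreover have "a *\<^sub>C g + v =
          (a *\<^sub>C \<rho> x (u - (c ^^ k) u') + y) + (c ^^ k) (a *\<^sub>C \<rho> x u' + y')"
        by (simp add: g(1) y(3) clinear_add[OF lck] clinear_scale[OF lck] ck_comm clinear_diff[OF lin]
            complex_vector.scale_right_diff_distrib)
      ultimately show ?case by blast
    qed
    have "(c ^^ k) w = 0"
    proof -
      obtain j where j: "k = Suc j" using k(1) gr0_conv_Suc by auto
      have "c w = 0" by (simp add: c_def inv clinear_0[OF lin])
      then show ?thesis
        unfolding j funpow_Suc_right comp_apply using clinear_0[OF clinear_funpow[OF c]] by simp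
    qed
    \<comment> \<open>\<open>c ^^ k\<close> kills both \<open>w\<close> and \<open>y\<close>, hence
      also their difference, which lies in its image and therefore vanishes. So \<open>w\<close> is
      in g W0, and the induction hypothesis applies.\<close>
    moreover obtain y y' where y: "y \<in> ?G" "y' \<in> W" "w = y + (c ^^ k) y'" using split[OF w] by blast
    moreover have "(c ^^ k) y = 0" using sG y(1) by (auto simp: W0_def)
    ultimately have "(c ^^ k) ((c ^^ k) y') = 0" by (simp add: clinear_add[OF lck])
    then have "(c ^^ k) y' = 0" using k(2) y(2) by blast
    then have "w \<in> ?G" using y by simp
    then show ?thesis by (rule less(1)[OF dim fd0 st0])
  qed
qed

text \<open>The Casimir element of the Killing form acts on \<open>g\<close> as the identity. Indeed
  \<beta> y w is the trace of ad w ad y; computed in the basis \<open>E\<close> with coordinates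
  read off through \<open>f\<close>, invariance turns it into \<beta> of \<open>y\<close> and the
  Casimir image of \<open>w\<close>.\<close>

lemma ex_killing_dual_bases:
  "\<exists>(\<beta> :: 'g \<Rightarrow> 'g \<Rightarrow> complex) E f. invariant_form \<beta> \<and> dual_bases \<beta> E f \<and>
    (\<forall>w. (\<Sum>e\<in>E. lie e (lie (f e) w)) = w)"
proof -
  note \<rho> = lie_module_adjoint[where 'a = 'g]
  obtain B where B: "finite B" "cindependent B" "cspan B = (UNIV :: 'g set)"
    by (rule finite_dimensional_basis[OF finite_dimensional])
  have st: "lie x ` cspan B \<subseteq> cspan B" for x using B(3) by simp
  define \<beta> where "\<beta> = trace_form B (lie :: 'g \<Rightarrow> 'g \<Rightarrow> 'g)"
  have \<beta>: "invariant_form \<beta>"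
    unfolding \<beta>_def by (rule invariant_form_trace_form[OF \<rho> B(1,2) st])
  have "\<exists>x y. \<beta> x y \<noteq> 0"
  proof (rule ccontr)
    assume "\<not> ?thesis"
    then have zero: "ctrace B (\<lambda>w. lie x (lie y w)) = 0" for x y
      by (simp add: \<beta>_def trace_form_def)
    have "lie x w = 0" for x w :: 'g
      by (rule trace_form_zero_imp_trivial[OF \<rho> B(1,2) st zero]) (simp add: B(3))
    then show False using simple by (simp add: simple_lie_algebra_def)
  qed
  then obtain x0 y0 where "\<beta> x0 y0 \<noteq> 0" by blast
  then obtain E f where d: "dual_bases \<beta> E f" and E: "cindependent E" "cspan E = UNIV"
    by (rule ex_dual_bases[OF \<beta>])
  have lin: "clinear (\<beta> a)" "clinear (\<lambda>a. \<beta> a b)" and sym: "\<beta> a b = \<beta> b a"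
    and inv: "\<beta> (lie a b) c = \<beta> a (lie b c)" for a b c
    using \<beta> unfolding invariant_form_def cbilinear_def by blast+
  have finE: "finite E" and dE: "(\<Sum>e\<in>E. \<beta> v (f e) *\<^sub>C e) = v" "(\<Sum>e\<in>E. \<beta> e v *\<^sub>C f e) = v" for v
    using d by (simp_all add: dual_bases_def)
  have rep: "crep E v e = \<beta> v (f e)" if e: "e \<in> E" for v e
  proof -
    have "crep E v e = crep E (\<Sum>e\<in>E. \<beta> v (f e) *\<^sub>C e) e" by (simp add: dE)
    also have "\<dots> = (\<Sum>e'\<in>E. crep E (\<beta> v (f e') *\<^sub>C e') e)"
      by (subst complex_vector.representation_sum[OF E(1)]) (simp_all add: E(2))
    also have "\<dots> = (\<Sum>e'\<in>E. if e' = e then \<beta> v (f e') else 0)"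
      by (intro sum.cong refl)
        (simp add: complex_vector.representation_scale[OF E(1)] E(2)
          complex_vector.representation_basis[OF E(1)])
    finally show ?thesis using e finE by (simp add: sum.delta)
  qed
  have "(\<Sum>e\<in>E. lie e (lie (f e) w)) = w" for w
  proof -
    let ?v = "\<Sum>e\<in>E. lie e (lie (f e) w)"
    have "\<beta> y w = \<beta> y ?v" for y
    proof -
      have "\<beta> y w = \<beta> w y" by (rule sym)
      also have "\<dots> = ctrace E (\<lambda>u. lie w (lie y u))"
        unfolding \<beta>_def trace_form_def
        by (rule ctrace_basis[OF B(1,2) finE E(1)])
          (simp_all add: B(3) E(2) clinear_compose[OF lie_module_linear[OF \<rho>] lie_module_linear[OF \<rho>]])
      also have "\<dots> = (\<Sum>e\<in>E. \<beta> (lie w (lie y e)) (f e))"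
        unfolding ctrace_def by (intro sum.cong refl rep)
      also have "\<dots> = (\<Sum>e\<in>E. \<beta> y (lie e (lie (f e) w)))"
      proof (intro sum.cong refl)
        fix e
        have "\<beta> (lie w (lie y e)) (f e) = - \<beta> (lie y e) (lie w (f e))"
          by (simp add: lie_skew[of w "lie y e"] clinear_neg[OF lin(2)] inv)
        also have "\<dots> = \<beta> (lie y e) (lie (f e) w)"
          by (simp add: lie_skew[of w "f e"] clinear_neg[OF lin(1)])
        finally show "\<beta> (lie w (lie y e)) (f e) = \<beta> y (lie e (lie (f e) w))" by (simp add: inv)
      qed
      also have "\<dots> = \<beta> y ?v" by (simp add: clinear_sum[OF lin(1)])
      finally show ?thesis .
    qed
    then have "\<beta> y (?v - w) = 0" for y by (simp add: clinear_diff[OF lin(1)])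
    then show ?thesis using dE(2)[of "?v - w"] by simp
  qed
  then show ?thesis using \<beta> d by blast
qed

end

section \<open>Extending representations of truncated current algebras\<close>

text \<open>The endomorphism plays the part of the quotient map modulo \<open>S\<close>; it is the
  identity minus a projection onto \<open>S\<close>.\<close>

lemma ex_linear_with_kernel:
  assumes "csubspace S"
  obtains \<pi> :: "'a::complex_vector \<Rightarrow> 'a" where "clinear \<pi>" "\<And>x. \<pi> x = 0 \<longleftrightarrow> x \<in> S"
proof -
  obtain g :: "'a \<Rightarrow> 'a" where g: "range g \<subseteq> S" "clinear g" "\<forall>v\<in>S. g v = v"
    using complex_vector_pair.linear_exists_left_inverse_on[OF clinear_id assms] by (auto simp: inj_on_def)
  show ?thesis
  proof (rule that[of "\<lambda>x. x - g x"])
    show "clinear (\<lambda>x. x - g x)" by (intro clinear_diff_fun clinear_id g)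
    show "x - g x = 0 \<longleftrightarrow> x \<in> S" for x using g by (auto simp: image_subset_iff) metis
  qed
qed

lemma double_eq_0: "x + x = 0 \<Longrightarrow> x = (0 :: 'a::complex_vector)"
  using scaleC_add_left[of 1 1 x] by (simp add: scaleC_one)

context simple_lie
begin

text \<open>The form \<open>(a, b, c, d) \<mapsto> C [a, b] [c, d]\<close> has the symmetries of a curvature tensor, hence the
  pair symmetry.\<close>

lemma cyclic_form_symmetric:
  fixes C :: "'g \<Rightarrow> 'g \<Rightarrow> 'e::complex_vector"
  assumes C: "cbilinear C" and cyc: "\<And>x y z. C x (lie y z) = C z (lie x y)"
  shows "C x y = C y x"
proof -
  have lin: "clinear (C a)" "clinear (\<lambda>a. C a b)" for a b
    using C by (auto simp: cbilinear_def)
  define R where "R c d a b = C (lie a b) (lie c d)" for a b c d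
  have R: "R c d a b = C c (lie d (lie a b))" for a b c d
    unfolding R_def by (rule cyc[symmetric])
  have flip: "R d c a b = - R c d a b" "R c d b a = - R c d a b" for a b c d
    unfolding R_def by (simp_all add: lie_skew[of d c] lie_skew[of b a] clinear_neg[OF lin(1)] clinear_neg[OF lin(2)])
  \<comment> \<open>By the cyclic property each term is \<open>C c\<close> of a double bracket, so
    the Bianchi identity is the Jacobi identity.\<close>
  have bianchi: "R c d a b + R c a b d + R c b d a = 0" for a b c d
    unfolding R by (simp add: jacobi clinear_0[OF lin(1)] flip: clinear_add[OF lin(1)])
  have pair: "R c d a b = R a b c d" for a b c d
  proof -
    have 1: "R c d a b + R c a b d + R c b d a = 0" by (rule bianchi)
    have "R d a b c = - R d a c b" "R d b c a = - R b d c a" "R d c a b = - R c d a b"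
      by (rule flip)+
    then have "- (R d a c b + R b d c a + R c d a b) = 0"
      using bianchi[of d a b c] by (simp add: algebra_simps)
    then have 2: "R d a c b + R b d c a + R c d a b = 0" by (simp only: neg_equal_0_iff_equal)
    have "R a c d b = - R c a d b" "R c a d b = - R c a b d" "R a d b c = - R d a b c"
      "R d a b c = - R d a c b"
      by (rule flip)+
    then have 3: "R a b c d + R c a b d + R d a c b = 0" using bianchi[of a b c d] by simp
    have "R b c d a = - R c b d a" "R b d a c = - R b d c a" "R b a c d = - R a b c d"
      by (rule flip)+
    then have "- (R c b d a + R b d c a + R a b c d) = 0"
      using bianchi[of b c d a] by (simp add: algebra_simps)
    then have 4: "R c b d a + R b d c a + R a b c d = 0" by (simp only: neg_equal_0_iff_equal)
    \<comment> \<open>The octahedron argument: in this signed sum of the four Bianchi identities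
      everything cancels except twice the wanted difference.\<close>
    have "(R c d a b - R a b c d) + (R c d a b - R a b c d) =
      (R c d a b + R c a b d + R c b d a) - (R a b c d + R c a b d + R d a c b)
      + (R d a c b + R b d c a + R c d a b) - (R c b d a + R b d c a + R a b c d)"
      by simp
    also have "\<dots> = 0" unfolding 1 2 3 4 by simp
    finally have "R c d a b - R a b c d = 0" by (rule double_eq_0)
    then show ?thesis by simp
  qed
  have sub: "csubspace {x. C x y = C y x}" for y
    by (simp add: complex_vector.subspace_def clinear_0[OF lin(1)] clinear_0[OF lin(2)]
        clinear_add[OF lin(1)] clinear_add[OF lin(2)] clinear_scale[OF lin(1)] clinear_scale[OF lin(2)])
  \<comment> \<open>The pair symmetry covers brackets in both arguments; perfectness frees one
    argument at a time.\<close>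
  have 1: "C y (lie a b) = C (lie a b) y" for a b y
    by (rule perfect_induct[where P = "\<lambda>y. C y (lie a b) = C (lie a b) y", OF sub])
      (rule pair[unfolded R_def])
  show ?thesis
    by (rule perfect_induct[where P = "\<lambda>x. C x y = C y x", OF sub]) (rule 1[symmetric])
qed

text \<open>Whitehead's second lemma for trivial coefficients. Contraction of \<open>A\<close> with
  the Casimir tensor is a homotopy: invariance of the tensor and the cocycle identity turn \<psi>
  [x, y] into \<open>A x\<close> of the Casimir image of \<open>y\<close>, which is
  \<open>y\<close>.\<close>

lemma alternating_cocycle_factors:
  fixes A :: "'g \<Rightarrow> 'g \<Rightarrow> 'e::complex_vector"
  assumes A: "cbilinear A" and alt: "\<And>x y. A x y = - A y x"
    and cocycle: "\<And>x y z. A x (lie y z) + A y (lie z x) + A z (lie x y) = 0"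
  obtains \<psi> where "clinear \<psi>" "\<And>x y. A x y = \<psi> (lie x y)"
proof -
  have lin: "clinear (A a)" "clinear (\<lambda>a. A a b)" for a b
    using A by (auto simp: cbilinear_def)
  note ad = lie_module_linear[OF lie_module_adjoint[where 'a = 'g]]
    lie_module_linear_left[OF lie_module_adjoint[where 'a = 'g]]
  obtain \<beta> :: "'g \<Rightarrow> 'g \<Rightarrow> complex" and E f where \<beta>: "invariant_form \<beta>" and d: "dual_bases \<beta> E f"
    and cas: "\<And>w. (\<Sum>e\<in>E. lie e (lie (f e) w)) = w"
    using ex_killing_dual_bases by blast
  define \<psi> where "\<psi> w = (\<Sum>e\<in>E. A e (lie (f e) w))" for w
  have "clinear \<psi>"
    unfolding \<psi>_def by (intro clinear_sum_fun clinear_compose[OF lin(1) ad(1)])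
  moreover have "A x y = \<psi> (lie x y)" for x y
  proof -
    have bil: "cbilinear (\<lambda>a b. A a (lie b y))"
      unfolding cbilinear_def by (auto intro: lin clinear_compose[OF lin(1) ad(2)])
    have "(\<Sum>e\<in>E. A (lie x e) (lie (f e) y) + A e (lie (lie x (f e)) y)) = 0"
      by (rule dual_bases_invariant[OF \<beta> d bil])
    moreover have "A e (lie (lie x (f e)) y) = - A e (lie (lie (f e) x) y)" for e
      by (simp add: lie_skew[of x "f e"] lie_neg_left clinear_neg[OF lin(1)])
    ultimately have 1: "(\<Sum>e\<in>E. A e (lie (lie (f e) x) y)) = (\<Sum>e\<in>E. A (lie x e) (lie (f e) y))"
      by (simp add: sum_subtractf)
    have coc: "A (lie x e) u + A e (lie x u) = A x (lie e u)" for e u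
    proof -
      have "A e (lie u x) = - A e (lie x u)" "A u (lie x e) = - A (lie x e) u"
        by (simp_all add: lie_skew[of u x] clinear_neg[OF lin(1)] alt[of u])
      then show ?thesis using cocycle[of x e u] by (simp add: algebra_simps)
    qed
    have "\<psi> (lie x y) = (\<Sum>e\<in>E. A e (lie (lie (f e) x) y) + A e (lie x (lie (f e) y)))"
      unfolding \<psi>_def by (intro sum.cong refl) (simp add: lie_lie_right[of "f _" x y] clinear_add[OF lin(1)])
    also have "\<dots> = (\<Sum>e\<in>E. A (lie x e) (lie (f e) y) + A e (lie x (lie (f e) y)))"
      by (simp add: sum.distrib 1)
    also have "\<dots> = A x (\<Sum>e\<in>E. lie e (lie (f e) y))"
      by (simp add: coc clinear_sum[OF lin(1)])
    finally show ?thesis by (simp add: cas)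
  qed
  ultimately show ?thesis by (rule that)
qed

text \<open>\<open>\<psi>\<close> is to become the member of the family in degree \<open>n\<close>.
  Its bracket with degree 0 is a separate clause because that pairing already involves
  \<open>\<psi>\<close> itself.\<close>

lemma truncated_current_step:
  fixes \<phi> :: "nat \<Rightarrow> 'g \<Rightarrow> 'e::complex_lie_algebra"
  assumes n: "n \<ge> 4" and lin: "\<And>i. i < n \<Longrightarrow> clinear (\<phi> i)"
    and rel: "\<And>i j x y. i + j < n \<Longrightarrow> lie (\<phi> i x) (\<phi> j y) = \<phi> (i + j) (lie x y)"
  obtains \<psi> where "clinear \<psi>"
    "\<And>i x y. 0 < i \<Longrightarrow> i < n \<Longrightarrow> lie (\<phi> i x) (\<phi> (n - i) y) = \<psi> (lie x y)"
    "\<And>x y. lie (\<phi> 0 x) (\<psi> y) = \<psi> (lie x y)"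
proof -
  note adE = lie_module_linear[OF lie_module_adjoint[where 'a = 'e]]
    lie_module_linear_left[OF lie_module_adjoint[where 'a = 'e]]
  define B where "B i x y = lie (\<phi> i x) (\<phi> (n - i) y)" for i x y
  have lin': "clinear (\<phi> i)" "clinear (\<phi> (n - i))" if "0 < i" "i < n" for i
    using lin that by auto
  have Bl: "clinear (B i x)" "clinear (\<lambda>x. B i x y)" if "0 < i" "i < n" for i x y
    unfolding B_def
    by (rule clinear_compose[OF adE(1) lin'(2)[OF that]])
      (rule clinear_compose[OF adE(2) lin'(1)[OF that]])
  have S: "B i x y = - B (n - i) y x" if "0 < i" "i < n" for i x y
    using that by (simp add: B_def lie_skew[of "\<phi> (n - i) y"])
  \<comment> \<open>All three degrees are positive, so every inner bracket has total degree below
    \<open>n\<close> and can be evaluated.\<close>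
  have J: "B i x (lie y z) + B j y (lie z x) + B k z (lie x y) = 0"
    if "0 < i" "0 < j" "0 < k" "i + j + k = n" for i j k x y z
  proof -
    have "B i x (lie y z) = lie (\<phi> i x) (lie (\<phi> j y) (\<phi> k z))"
      "B j y (lie z x) = lie (\<phi> j y) (lie (\<phi> k z) (\<phi> i x))"
      "B k z (lie x y) = lie (\<phi> k z) (lie (\<phi> i x) (\<phi> j y))"
      using that rel[of j k y z] rel[of k i z x] rel[of i j x y]
      by (auto simp: B_def intro!: arg_cong2[where f = lie] arg_cong2[where f = \<phi>])
    then show ?thesis using jacobi by simp
  qed
  define \<rho> where "\<rho> a u = lie (\<phi> 0 a) u" for a u
  have lin0: "clinear (\<phi> 0)" using lin n by simp
  have \<rho>: "lie_module \<rho>"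
  proof -
    have "\<phi> 0 (lie x y) = lie (\<phi> 0 x) (\<phi> 0 y)" for x y using rel[of 0 0 x y] n by simp
    then have "\<rho> (lie x y) v = \<rho> x (\<rho> y v) - \<rho> y (\<rho> x v)" for x y v
      unfolding \<rho>_def using lie_lie_right[of "\<phi> 0 x" "\<phi> 0 y" v] by simp
    moreover have "clinear (\<lambda>x. \<rho> x v)" "clinear (\<rho> x)" for x v
      unfolding \<rho>_def by (rule clinear_compose[OF adE(2) lin0]) (rule adE(1))
    ultimately show ?thesis by (simp add: lie_module_def cbilinear_def)
  qed
  have equiv: "\<rho> a (B i x y) = B i (lie a x) y + B i x (lie a y)" if "0 < i" "i < n" for a i x y
    using that rel[of 0 i a x] rel[of 0 "n - i" a y] unfolding \<rho>_def B_def lie_lie_right[of "\<phi> 0 a"]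
    by simp
  \<comment> \<open>A finite-dimensional module even if the ambient Lie algebra is not: finitely
    many indices and a finite basis of \<open>g\<close> suffice to span it.\<close>
  define N where "N = cspan {B i x y |i x y. 0 < i \<and> i < n}"
  have BN: "B i x y \<in> N" if "0 < i" "i < n" for i x y
    unfolding N_def by (rule complex_vector.span_base) (use that in blast)
  have fdN: "finite_dimensional N"
  proof -
    obtain D where D: "finite D" "cindependent D" "cspan D = (UNIV :: 'g set)"
      by (rule finite_dimensional_basis[OF finite_dimensional])
    let ?F = "(\<lambda>(i, x, y). B i x y) ` ({0<..<n} \<times> D \<times> D)"
    have "B i x y \<in> cspan ?F" if i: "0 < i" "i < n" for i x y
    proof -
      have 1: "cspan D \<subseteq> {y. B i x y \<in> cspan ?F}" if "x \<in> D" for x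
      proof (rule complex_vector.span_minimal)
        show "D \<subseteq> {y. B i x y \<in> cspan ?F}"
        proof safe
          fix y assume "y \<in> D"
          then have "(i, x, y) \<in> {0<..<n} \<times> D \<times> D" using i that by simp
          then have "(case (i, x, y) of (i, x, y) \<Rightarrow> B i x y) \<in> ?F" by (rule imageI)
          then show "B i x y \<in> cspan ?F" using complex_vector.span_base by simp
        qed
        show "csubspace {y. B i x y \<in> cspan ?F}"
          by (simp add: complex_vector.subspace_def clinear_0[OF Bl(1)[OF i]] clinear_add[OF Bl(1)[OF i]]
              clinear_scale[OF Bl(1)[OF i]] complex_vector.span_zero complex_vector.span_add
              complex_vector.span_scale)
      qed
      have "cspan D \<subseteq> {x. B i x y \<in> cspan ?F}"
      proof (rule complex_vector.span_minimal)
        show "D \<subseteq> {x. B i x y \<in> cspan ?F}" using 1 D(3) by blast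
        show "csubspace {x. B i x y \<in> cspan ?F}"
          by (simp add: complex_vector.subspace_def clinear_0[OF Bl(2)[OF i]] clinear_add[OF Bl(2)[OF i]]
              clinear_scale[OF Bl(2)[OF i]] complex_vector.span_zero complex_vector.span_add
              complex_vector.span_scale)
      qed
      then show ?thesis using D(3) by blast
    qed
    then have "N \<subseteq> cspan ?F"
      unfolding N_def by (intro complex_vector.span_minimal) auto
    moreover have "finite ?F" using D(1) by simp
    moreover have "csubspace N" by (simp add: N_def)
    ultimately show ?thesis unfolding finite_dimensional_iff_span by blast
  qed
  have subN: "csubspace N" by (simp add: N_def)
  have stN: "\<rho> a ` N \<subseteq> N" for a
  proof -
    have "N \<subseteq> {u. \<rho> a u \<in> N}"
      unfolding N_def
    proof (rule complex_vector.span_minimal)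
      show "{B i x y |i x y. 0 < i \<and> i < n} \<subseteq> {u. \<rho> a u \<in> cspan {B i x y |i x y. 0 < i \<and> i < n}}"
        unfolding N_def[symmetric] by (auto simp: equiv intro!: complex_vector.subspace_add[OF subN] BN)
      show "csubspace {u. \<rho> a u \<in> cspan {B i x y |i x y. 0 < i \<and> i < n}}"
        by (rule complex_vector_pair.linear_subspace_vimage[OF lie_module_linear[OF \<rho>],
              unfolded vimage_def]) simp
    qed
    then show ?thesis by blast
  qed
  define G where "G = cspan {\<rho> a u |a u. u \<in> N}"
  \<comment> \<open>The claim is that the forms vanish in the coinvariants N / g N, modelled by
    \<open>\<pi>\<close>. There \<open>T i\<close> is totally alternating, \<open>J\<close> reads
    T_i + T_j + T_k = 0 for i + j + k = n, and skewness reads T_(n-i) = - T_i. Hence T_i = i T_1,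
    and i = n - 1 gives n T_1 = 0.\<close>
  have BG: "B i x y \<in> G" if i: "0 < i" "i < n" for i x y
  proof -
    obtain \<pi> :: "'e \<Rightarrow> 'e" where \<pi>: "clinear \<pi>" and ker: "\<And>x. \<pi> x = 0 \<longleftrightarrow> x \<in> G"
      by (rule ex_linear_with_kernel[of G]) (simp_all add: G_def)
    define b where "b i x y = \<pi> (B i x y)" for i x y
    have bl: "clinear (b i x)" "clinear (\<lambda>x. b i x y)" if "0 < i" "i < n" for i x y
      unfolding b_def
      by (rule clinear_compose[OF \<pi> Bl(1)[OF that]]) (rule clinear_compose[OF \<pi> Bl(2)[OF that]])
    define T where "T i x y z = b i x (lie y z)" for i x y z
    have T': "T i x y z = b i (lie x y) z" if "0 < i" "i < n" for i x y z
    proof -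
      have "\<rho> y (B i x z) \<in> G"
        unfolding G_def by (rule complex_vector.span_base) (use BN[OF that] in blast)
      then have "b i (lie y x) z + b i x (lie y z) = 0"
        using ker by (simp add: b_def equiv[OF that] flip: clinear_add[OF \<pi>])
      then show ?thesis
        by (simp add: T_def lie_skew[of y x] clinear_neg[OF bl(2)[OF that]])
    qed
    have flip1: "T i y x z = - T i x y z" if "0 < i" "i < n" for i x y z
      by (simp add: T'[OF that] lie_skew[of y x] clinear_neg[OF bl(2)[OF that]])
    have flip2: "T i x z y = - T i x y z" if "0 < i" "i < n" for i x y z
      by (simp add: T_def lie_skew[of z y] clinear_neg[OF bl(1)[OF that]])
    have cyc: "T i y z x = T i x y z" if "0 < i" "i < n" for i x y z
      using flip2[OF that, of y x z] flip1[OF that, of y x z] by simp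
    have sum0: "T i x y z + T j x y z + T k x y z = 0"
      if "0 < i" "0 < j" "0 < k" "i + j + k = n" for i j k x y z
    proof -
      have "T i x y z + T j y z x + T k z x y = \<pi> (B i x (lie y z) + B j y (lie z x) + B k z (lie x y))"
        by (simp add: T_def b_def clinear_add[OF \<pi>])
      then have "T i x y z + T j y z x + T k z x y = 0" by (simp add: J[OF that] clinear_0[OF \<pi>])
      then show ?thesis using that cyc[of j y z x] cyc[of k z x y] cyc[of k y z x] by simp
    qed
    have neg: "T (n - i) x y z = - T i x y z" if "0 < i" "i < n" for i x y z
    proof -
      have "T i x y z = - \<pi> (B (n - i) (lie y z) x)"
        using S[OF that, of x "lie y z"] by (simp add: T_def b_def clinear_neg[OF \<pi>])
      also have "\<dots> = - T (n - i) y z x" using T'[of "n - i" y z x] that by (simp add: b_def)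
      finally show ?thesis using cyc[of "n - i" y z x] that by simp
    qed
    have mult: "T i x y z = of_nat i *\<^sub>C T 1 x y z" if "0 < i" "i < n" for i x y z
      using that
    proof (induction i)
      case (Suc i)
      show ?case
      proof (cases "i = 0")
        case False
        then have "T 1 x y z + T i x y z + T (n - Suc i) x y z = 0" using Suc(3) by (intro sum0) auto
        then have "T (Suc i) x y z = T 1 x y z + T i x y z" using neg[of "Suc i" x y z] Suc(3)
          by (simp add: eq_neg_iff_add_eq_0 algebra_simps)
        then show ?thesis using Suc False by (simp add: scaleC_add_left scaleC_one)
      qed (simp add: scaleC_one)
    qed simp
    have "T 1 x y z = 0" for x y z
    proof -
      have "of_nat (n - 1) *\<^sub>C T 1 x y z = - T 1 x y z"
        using mult[of "n - 1" x y z] neg[of 1 x y z] n by simp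
      then have "(of_nat (n - 1) + 1) *\<^sub>C T 1 x y z = 0" by (simp add: scaleC_add_left scaleC_one)
      moreover have "of_nat (n - 1) + 1 = (of_nat n :: complex)"
        using n by (simp add: of_nat_diff)
      ultimately show ?thesis using n by (simp add: complex_vector.scale_eq_0_iff)
    qed
    then have lie0: "b i x (lie y z) = 0" for y z using mult[OF i] by (simp add: T_def)
    have sub0: "csubspace {y. b i x y = 0}"
      by (simp add: complex_vector.subspace_def clinear_0[OF bl(1)[OF i]] clinear_add[OF bl(1)[OF i]]
          clinear_scale[OF bl(1)[OF i]])
    have "b i x y = 0"
      by (rule perfect_induct[where P = "\<lambda>y. b i x y = 0", OF sub0 lie0])
    then show ?thesis using ker by (simp add: b_def)
  qed
  \<comment> \<open>Two instances of \<open>J\<close> share their middle term, whose index n - 1 - k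
    is positive since k < n - 1; subtracting them gives the cyclic identity for \<open>C\<close>. So
    \<open>C\<close> is symmetric, and together with equivariance this makes its values invariant.
    They also lie in g N, hence vanish.\<close>
  have B_eq: "B k x y = B 1 x y" if k: "0 < k" "k < n - 1" for k x y
  proof -
    define C where "C x y = B k x y - B 1 x y" for x y
    have k': "0 < k" "k < n" and one: "0 < (1::nat)" "1 < n" using k n by auto
    have C: "cbilinear C"
      unfolding cbilinear_def C_def by (intro conjI allI clinear_diff_fun Bl k' one)
    then have linC: "clinear (C x)" "clinear (\<lambda>x. C x y)" for x y by (auto simp: cbilinear_def)
    have cyc: "C x (lie y z) = C z (lie x y)" for x y z
    proof -
      have "B 1 x (lie y z) + B (n - 1 - k) y (lie z x) + B k z (lie x y) = 0"
        "B k x (lie y z) + B (n - 1 - k) y (lie z x) + B 1 z (lie x y) = 0"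
        using k n by (intro J; simp)+
      then have "(B k x (lie y z) + B (n - 1 - k) y (lie z x) + B 1 z (lie x y)) -
          (B 1 x (lie y z) + B (n - 1 - k) y (lie z x) + B k z (lie x y)) = 0"
        by (simp only: diff_self)
      moreover have "(p + q + r) - (p' + q + r') = (p - p') - (r' - r)" for p p' q r r' :: 'e
        by simp
      ultimately show ?thesis by (simp add: C_def)
    qed
    have inv: "\<rho> a (C x w) = 0" for a x w
    proof -
      have "\<rho> a (C x w) = C (lie a x) w + C x (lie a w)"
        unfolding C_def clinear_diff[OF lie_module_linear[OF \<rho>]] equiv[OF k'] equiv[OF one] by simp
      also have "C x (lie a w) = C (lie x a) w"
        using cyc[of x a w] cyclic_form_symmetric[OF C cyc, of w "lie x a"] by simp
      finally show ?thesis by (simp add: lie_skew[of x a] clinear_neg[OF linC(2)])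
    qed
    have "C x y \<in> G"
      unfolding C_def G_def by (intro complex_vector.span_diff BG[unfolded G_def] k' one)
    then have "C x y = 0"
      unfolding G_def by (rule invariant_in_image_eq_0[OF \<rho> fdN stN _ inv])
    then show ?thesis by (simp add: C_def)
  qed
  \<comment> \<open>This uses \<open>n \<ge> 4\<close>: both 2 and n - 2 must lie strictly between 0
    and n - 1.\<close>
  have alt: "B 1 x y = - B 1 y x" for x y
  proof -
    have "B 1 x y = B 2 x y" using n B_eq[of 2] by simp
    also have "\<dots> = - B (n - 2) y x" using n by (intro S) auto
    also have "B (n - 2) y x = B 1 y x" using n by (intro B_eq) auto
    finally show ?thesis .
  qed
  have cocycle: "B 1 x (lie y z) + B 1 y (lie z x) + B 1 z (lie x y) = 0" for x y z
    using J[of 1 1 "n - 2" x y z] B_eq[of "n - 2" z "lie x y"] n by simp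
  have bil: "cbilinear (B 1)" unfolding cbilinear_def using Bl n by auto
  obtain \<psi> where \<psi>: "clinear \<psi>" "\<And>x y. B 1 x y = \<psi> (lie x y)"
    using alternating_cocycle_factors[OF bil alt cocycle] by blast
  \<comment> \<open>The index n - 1, excluded from \<open>B_eq\<close>, is reached from index 1 by
    skew symmetry of the bracket.\<close>
  have all: "B i x y = \<psi> (lie x y)" if "0 < i" "i < n" for i x y
  proof (cases "i < n - 1")
    case True
    then show ?thesis using B_eq[OF that(1) True, of x y] \<psi>(2)[of x y] by metis
  next
    case False
    then have "i = n - 1" using that by simp
    then have "B i x y = - B 1 y x" using S[OF that] n by simp
    then show ?thesis using alt[of x y] \<psi>(2) by simp
  qed
  have zero: "lie (\<phi> 0 x) (\<psi> y) = \<psi> (lie x y)" for x y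
  proof (rule perfect_induct[where P = "\<lambda>y. lie (\<phi> 0 x) (\<psi> y) = \<psi> (lie x y)"])
    show "csubspace {y. lie (\<phi> 0 x) (\<psi> y) = \<psi> (lie x y)}"
      by (simp add: complex_vector.subspace_def clinear_0[OF \<psi>(1)] clinear_add[OF \<psi>(1)]
          clinear_scale[OF \<psi>(1)] lie_add_right lie_scaleC_right)
    show "lie (\<phi> 0 x) (\<psi> (lie y z)) = \<psi> (lie x (lie y z))" for y z
      using equiv[of 1 x y z] n
      unfolding \<psi>(2) \<rho>_def lie_lie_right[of x y z] clinear_add[OF \<psi>(1)] by simp
  qed
  show ?thesis by (rule that[OF \<psi>(1)]) (use all zero in \<open>simp_all add: B_def\<close>)
qed

text \<open>Stage \<open>n\<close> of the dependent choice is correct in total degree below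
  \<open>n + 4\<close>, the offset being the given degrees 0 to 3. Later stages leave these degrees
  alone, so the diagonal family satisfies all relations.\<close>

theorem truncated_current_extension:
  fixes \<phi> :: "nat \<Rightarrow> 'g \<Rightarrow> 'e::complex_lie_algebra"
  assumes lin: "\<And>i. i \<le> 3 \<Longrightarrow> clinear (\<phi> i)"
    and rel: "\<And>i j x y. i + j \<le> 3 \<Longrightarrow> lie (\<phi> i x) (\<phi> j y) = \<phi> (i + j) (lie x y)"
  obtains \<psi> where "\<And>i. i \<le> 3 \<Longrightarrow> \<psi> i = \<phi> i" "\<And>i. clinear (\<psi> i)"
    "\<And>i j x y. lie (\<psi> i x) (\<psi> j y) = \<psi> (i + j) (lie x y)"
proof -
  define P where "P n \<chi> \<longleftrightarrow> (\<forall>i\<le>3. \<chi> i = \<phi> i) \<and> (\<forall>i<n + 4. clinear (\<chi> i)) \<and>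
    (\<forall>i j x y. i + j < n + 4 \<longrightarrow> lie (\<chi> i x) (\<chi> j y) = \<chi> (i + j) (lie x y))"
    for n and \<chi> :: "nat \<Rightarrow> 'g \<Rightarrow> 'e"
  define Q where "Q n \<chi> \<chi>' \<longleftrightarrow> (\<forall>i<n + 4. \<chi>' i = \<chi> i)" for n and \<chi> \<chi>' :: "nat \<Rightarrow> 'g \<Rightarrow> 'e"
  have "\<exists>\<Psi>. \<forall>n. P n (\<Psi> n) \<and> Q n (\<Psi> n) (\<Psi> (Suc n))"
  proof (rule dependent_nat_choice)
    have "P 0 \<phi>" unfolding P_def using lin rel by (auto simp: less_Suc_eq_le numeral_eq_Suc)
    then show "\<exists>\<chi>. P 0 \<chi>" by blast
    fix \<chi> n assume "P n \<chi>"
    then have \<chi>: "\<And>i. i \<le> 3 \<Longrightarrow> \<chi> i = \<phi> i" "\<And>i. i < n + 4 \<Longrightarrow> clinear (\<chi> i)"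
      "\<And>i j x y. i + j < n + 4 \<Longrightarrow> lie (\<chi> i x) (\<chi> j y) = \<chi> (i + j) (lie x y)"
      by (simp_all add: P_def)
    obtain \<psi> where \<psi>: "clinear \<psi>"
      "\<And>i x y. 0 < i \<Longrightarrow> i < n + 4 \<Longrightarrow> lie (\<chi> i x) (\<chi> (n + 4 - i) y) = \<psi> (lie x y)"
      "\<And>x y. lie (\<chi> 0 x) (\<psi> y) = \<psi> (lie x y)"
      using truncated_current_step[of "n + 4" \<chi>, OF _ \<chi>(2,3)] by auto
    let ?\<chi> = "\<chi>(n + 4 := \<psi>)"
    have "lie (?\<chi> i x) (?\<chi> j y) = ?\<chi> (i + j) (lie x y)" if ij: "i + j < Suc n + 4" for i j x y
    proof -
      consider "i + j < n + 4" | "i = 0" "j = n + 4" | "i = n + 4" "j = 0"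
        | "0 < i" "i < n + 4" "j = n + 4 - i" using ij by linarith
      then show ?thesis
      proof cases
        case 3
        have "lie (\<psi> x) (\<chi> 0 y) = - lie (\<chi> 0 y) (\<psi> x)" by (rule lie_skew)
        also have "\<dots> = \<psi> (lie x y)"
          by (simp add: \<psi>(3) lie_skew[of y x] clinear_neg[OF \<psi>(1)])
        finally show ?thesis using 3 by simp
      qed (use \<chi>(3) \<psi> in auto)
    qed
    then have "P (Suc n) ?\<chi>" using \<chi> \<psi>(1) by (auto simp: P_def)
    moreover have "Q n \<chi> ?\<chi>" by (simp add: Q_def)
    ultimately show "\<exists>\<chi>'. P (Suc n) \<chi>' \<and> Q n \<chi> \<chi>'" by blast
  qed
  then obtain \<Psi> where \<Psi>: "\<And>n. P n (\<Psi> n)" "\<And>n. Q n (\<Psi> n) (\<Psi> (Suc n))" by blast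
  have stab: "\<Psi> (n + m) i = \<Psi> n i" if "i < n + 4" for n m i
    using that
  proof (induction m)
    case (Suc m)
    then show ?case using \<Psi>(2)[of "n + m"] by (simp add: Q_def)
  qed simp
  define \<psi> where "\<psi> i = \<Psi> i i" for i
  have eq: "\<psi> i = \<Psi> n i" if "i \<le> n" for i n
    using stab[of i i "n - i"] that by (simp add: \<psi>_def)
  show ?thesis
  proof (rule that[of \<psi>])
    show "\<psi> i = \<phi> i" if "i \<le> 3" for i using \<Psi>(1)[of i] that by (simp add: \<psi>_def P_def)
    show "clinear (\<psi> i)" for i using \<Psi>(1)[of i] by (simp add: \<psi>_def P_def)
    show "lie (\<psi> i x) (\<psi> j y) = \<psi> (i + j) (lie x y)" for i j x y
      using \<Psi>(1)[of "i + j"] by (simp add: eq[of _ "i + j"] P_def)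
  qed
qed

end

section \<open>Twisted modules over the current algebra\<close>

instantiation prod :: (complex_vector, complex_vector) complex_vector
begin

definition "scaleC_prod c p = (c *\<^sub>C fst p, c *\<^sub>C snd p)"

instance
  by standard (simp_all add: scaleC_prod_def prod_eq_iff scaleC_add_right scaleC_add_left
      scaleC_scaleC scaleC_one)

end

text \<open>Linear endomorphisms become a type of their own so that the commutator makes it an
  instance of the class of Lie algebras, as the extension theorem asks of its target.\<close>

typedef (overloaded) 'a endo = "{f :: 'a::complex_vector \<Rightarrow> 'a. clinear f}"
  morphisms endo_apply Endo
  using clinear_id by blast

setup_lifting type_definition_endo

instantiation endo :: (complex_vector) complex_lie_algebra
begin

lift_definition zero_endo :: "'a endo" is "\<lambda>x. 0" by (simp add: clinear_iff)
lift_definition plus_endo :: "'a endo \<Rightarrow> 'a endo \<Rightarrow> 'a endo" is "\<lambda>f g x. f x + g x"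
  by (rule clinear_add_fun)
lift_definition minus_endo :: "'a endo \<Rightarrow> 'a endo \<Rightarrow> 'a endo" is "\<lambda>f g x. f x - g x"
  by (rule clinear_diff_fun)
lift_definition uminus_endo :: "'a endo \<Rightarrow> 'a endo" is "\<lambda>f x. - f x"
  by (simp add: clinear_iff)
lift_definition scaleC_endo :: "complex \<Rightarrow> 'a endo \<Rightarrow> 'a endo" is "\<lambda>c f x. c *\<^sub>C f x"
  by (rule clinear_scale_fun)
lift_definition lie_endo :: "'a endo \<Rightarrow> 'a endo \<Rightarrow> 'a endo" is "\<lambda>f g x. f (g x) - g (f x)"
  by (rule clinear_diff_fun; rule clinear_compose)

instance
  by standard
    (transfer; simp add: fun_eq_iff scaleC_add_right scaleC_add_left scaleC_scaleC scaleC_one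
      clinear_add clinear_diff clinear_scale complex_vector.scale_right_diff_distrib algebra_simps)+

end

lemma endo_eqI: "(\<And>x. endo_apply f x = endo_apply g x) \<Longrightarrow> f = g"
  by (simp add: endo_apply_inject[symmetric] fun_eq_iff)

lemmas endo_apply_simps = zero_endo.rep_eq plus_endo.rep_eq minus_endo.rep_eq
  scaleC_endo.rep_eq lie_endo.rep_eq

lemma clinear_endo_apply: "clinear (endo_apply f)"
  using endo_apply[of f] by simp

lemma clinear_monom: "clinear (\<lambda>x. monom x n)"
  by (simp add: clinear_iff poly_eq_iff coeff_scaleC)

definition current_lift :: "(nat \<Rightarrow> 'g::complex_lie_algebra \<Rightarrow> 'e::complex_lie_algebra) \<Rightarrow> 'g poly \<Rightarrow> 'e"
  where "current_lift \<psi> f = (\<Sum>i\<le>degree f. \<psi> i (coeff f i))"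

lemma current_lift:
  assumes lin: "\<And>i. clinear (\<psi> i)" and rel: "\<And>i j x y. lie (\<psi> i x) (\<psi> j y) = \<psi> (i + j) (lie x y)"
  shows "clinear (current_lift \<psi>)" and "current_lift \<psi> (monom x i) = \<psi> i x"
    and "current_lift \<psi> (lie f g) = lie (current_lift \<psi> f) (current_lift \<psi> g)"
proof -
  have sup: "current_lift \<psi> f = (\<Sum>i\<le>n. \<psi> i (coeff f i))" if "degree f \<le> n" for f n
    unfolding current_lift_def
    by (rule sum.mono_neutral_left) (use that in \<open>auto simp: coeff_eq_0 clinear_0[OF lin]\<close>)
  have add: "current_lift \<psi> (f + g) = current_lift \<psi> f + current_lift \<psi> g" for f g
  proof -
    let ?n = "max (degree f) (degree g)"
    have "degree (f + g) \<le> ?n" by (rule degree_add_le) simp_all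
    then show ?thesis by (simp add: sup[of _ ?n] clinear_add[OF lin] sum.distrib)
  qed
  have scale: "current_lift \<psi> (c *\<^sub>C f) = c *\<^sub>C current_lift \<psi> f" for c f
  proof -
    have "degree (c *\<^sub>C f) \<le> degree f"
      by (simp add: scaleC_poly_def map_poly_degree_leq)
    then show ?thesis
      by (simp add: sup[of _ "degree f"] coeff_scaleC clinear_scale[OF lin] complex_vector.scale_sum_right)
  qed
  show "clinear (current_lift \<psi>)" using add scale by (rule clinearI)
  have mon: "current_lift \<psi> (monom x i) = \<psi> i x" for x i
  proof -
    have "current_lift \<psi> (monom x i) = (\<Sum>j\<le>i. \<psi> j (coeff (monom x i) j))"
      by (rule sup) (rule degree_monom_le)
    also have "\<dots> = (\<Sum>j\<le>i. if j = i then \<psi> j x else 0)"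
      by (intro sum.cong refl) (simp add: clinear_0[OF lin])
    finally show ?thesis by (simp add: sum.delta)
  qed
  then show "current_lift \<psi> (monom x i) = \<psi> i x" .
  have "current_lift \<psi> (lie f g) - lie (current_lift \<psi> f) (current_lift \<psi> g) = 0"
  proof (rule poly_additive_induct[where p = f])
    fix x i
    show "current_lift \<psi> (lie (monom x i) g) - lie (current_lift \<psi> (monom x i)) (current_lift \<psi> g) = 0"
    proof (rule poly_additive_induct[where p = g])
      fix y j
      have "lie (monom x i) (monom y j) = monom (lie x y) (i + j)"
        by (simp add: lie_poly_def poly_lie_monom)
      then show "current_lift \<psi> (lie (monom x i) (monom y j)) -
          lie (current_lift \<psi> (monom x i)) (current_lift \<psi> (monom y j)) = 0"
        by (simp add: mon rel)
    qed (simp add: lie_add_right add)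
  qed (simp add: lie_add_left add)
  then show "current_lift \<psi> (lie f g) = lie (current_lift \<psi> f) (current_lift \<psi> g)" by simp
qed

context simple_lie
begin

text \<open>As \<open>g\<close> is perfect, the brackets of g t with g t^n span g t^(n+1); so
  degrees 0 and 1 generate the current algebra.\<close>

lemma current_algebra_induct:
  assumes sub: "csubspace {x. Q x}" and lie: "\<And>x y. Q x \<Longrightarrow> Q y \<Longrightarrow> Q (lie x y)"
    and gen: "\<And>a. Q (monom a 0)" "\<And>a. Q (monom a 1)"
  shows "Q (f :: 'g poly)"
proof -
  have monom: "Q (monom a n)" for a n
  proof (induction n arbitrary: a)
    case 0
    show ?case by (rule gen)
  next
    case (Suc n)
    show ?case
    proof (rule perfect_induct[where P = "\<lambda>a. Q (monom a (Suc n))"])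
      show "csubspace {a. Q (monom a (Suc n))}"
        using complex_vector_pair.linear_subspace_vimage[OF clinear_monom sub, of "Suc n"]
        by (simp add: vimage_def)
      fix a b
      have "Q (lie (monom a 1) (monom b n))" by (intro lie gen Suc)
      then show "Q (monom (lie a b) (Suc n))" by (simp add: lie_poly_def poly_lie_monom)
    qed
  qed
  have "(\<Sum>i\<le>degree f. monom (coeff f i) i) \<in> {x. Q x}"
    by (rule complex_vector.subspace_sum[OF sub]) (simp add: monom)
  then show ?thesis by (simp add: poly_as_sum_of_monoms)
qed

text \<open>The twisted action \<open>x (w, p) = (x w + e x (\<kappa> p), x p)\<close> on \<open>W \<times> F\<close> is a module up to the
  cocycle \<open>\<Omega> x y v = e x (D y v) - e y (D x v)\<close> with \<open>D y v = y (s v) - s (y v)\<close>.  By the extension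
  theorem it can be corrected when \<open>\<Omega>\<close> vanishes in total degree at most 3.\<close>

lemma ex_twisted_module:
  fixes \<tau> :: "'g poly \<Rightarrow> 'f::complex_vector \<Rightarrow> 'f" and \<rho> :: "'g poly \<Rightarrow> 'v::complex_vector \<Rightarrow> 'v"
    and \<sigma> :: "'g poly \<Rightarrow> 'w::complex_vector \<Rightarrow> 'w"
  assumes \<tau>: "lie_module \<tau>" and \<rho>: "lie_module \<rho>" and \<sigma>: "lie_module \<sigma>"
    and q: "clinear q" "\<And>p. q (q p) = q p" "\<And>x p. q (\<tau> x p) = \<tau> x (q p)"
    and \<epsilon>: "clinear \<epsilon>" "\<And>x p. \<epsilon> (\<tau> x p) = \<rho> x (\<epsilon> p)" "\<And>p. \<epsilon> (q p) = \<epsilon> p"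
    and s: "clinear s" "\<And>v. q (s v) = s v" "\<And>v. \<epsilon> (s v) = v"
    and e: "cbilinear e" "\<And>x y k. q k = k \<Longrightarrow> \<epsilon> k = 0 \<Longrightarrow>
      e (lie x y) k = \<sigma> x (e y k) - \<sigma> y (e x k) + e x (\<tau> y k) - e y (\<tau> x k)"
    and \<Omega>: "\<And>i j a b v. i + j \<le> 3 \<Longrightarrow>
      e (monom a i) (\<tau> (monom b j) (s v) - s (\<rho> (monom b j) v)) =
      e (monom b j) (\<tau> (monom a i) (s v) - s (\<rho> (monom a i) v))"
  obtains \<Theta> :: "'g poly \<Rightarrow> 'w \<times> 'f \<Rightarrow> 'w \<times> 'f" where "lie_module \<Theta>"
    "\<And>x w p. snd (\<Theta> x (w, p)) = \<tau> x p"
    "\<And>x w k. q k = k \<Longrightarrow> \<epsilon> k = 0 \<Longrightarrow> \<Theta> x (w, k) = (\<sigma> x w + e x k, \<tau> x k)"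
proof -
  note lin\<tau> = lie_module_linear[OF \<tau>] lie_module_linear_left[OF \<tau>]
  note lin\<rho> = lie_module_linear[OF \<rho>] lie_module_linear_left[OF \<rho>]
  note lin\<sigma> = lie_module_linear[OF \<sigma>] lie_module_linear_left[OF \<sigma>]
  have line: "clinear (e x)" "clinear (\<lambda>x. e x k)" for x k using e(1) by (auto simp: cbilinear_def)
  \<comment> \<open>A linear projection onto the kernel of \<open>\<epsilon>\<close> inside the
    range of \<open>q\<close>. It extends the cocycle \<open>e\<close> from that kernel to the whole
    space; \<open>\<kappa>\<tau>\<close> records its failure to be equivariant.\<close>
  define \<kappa> where "\<kappa> p = q p - s (\<epsilon> p)" for p
  have \<kappa>: "clinear \<kappa>" unfolding \<kappa>_def by (intro clinear_diff_fun q clinear_compose[OF s(1) \<epsilon>(1)])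
  have \<kappa>K: "q (\<kappa> p) = \<kappa> p" "\<epsilon> (\<kappa> p) = 0" for p
    by (simp_all add: \<kappa>_def clinear_diff[OF q(1)] q(2) s(2) clinear_diff[OF \<epsilon>(1)] \<epsilon>(3) s(3))
  have \<kappa>_id: "\<kappa> k = k" if "q k = k" "\<epsilon> k = 0" for k
    using that by (simp add: \<kappa>_def clinear_0[OF s(1)])
  have \<kappa>\<tau>: "\<kappa> (\<tau> y p) = \<tau> y (\<kappa> p) + (\<tau> y (s (\<epsilon> p)) - s (\<rho> y (\<epsilon> p)))" for y p
    by (simp add: \<kappa>_def q(3) \<epsilon>(2) clinear_diff[OF lin\<tau>(1)])
  define O1 where "O1 x u = (\<sigma> x (fst u) + e x (\<kappa> (snd u)), \<tau> x (snd u))" for x u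
  have O1: "clinear (O1 x)" for x
    by (rule clinearI) (simp_all add: O1_def scaleC_prod_def clinear_add[OF lin\<sigma>(1)] clinear_add[OF lin\<tau>(1)]
        clinear_add[OF line(1)] clinear_add[OF \<kappa>] clinear_scale[OF lin\<sigma>(1)] clinear_scale[OF lin\<tau>(1)]
        clinear_scale[OF line(1)] clinear_scale[OF \<kappa>] scaleC_add_right)
  have O1_left: "O1 (x + y) u = O1 x u + O1 y u" "O1 (c *\<^sub>C x) u = c *\<^sub>C O1 x u" for x y u c
    by (simp_all add: O1_def scaleC_prod_def clinear_add[OF lin\<sigma>(2)] clinear_add[OF lin\<tau>(2)]
        clinear_add[OF line(2)] clinear_scale[OF lin\<sigma>(2)] clinear_scale[OF lin\<tau>(2)]
        clinear_scale[OF line(2)] scaleC_add_right)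
  have O1_lie: "O1 (lie x y) u = O1 x (O1 y u) - O1 y (O1 x u)"
    if "\<And>v. e x (\<tau> y (s v) - s (\<rho> y v)) = e y (\<tau> x (s v) - s (\<rho> x v))" for x y u
  proof -
    obtain w p where u: "u = (w, p)" by (cases u)
    have "\<sigma> (lie x y) w + e (lie x y) (\<kappa> p) =
      \<sigma> x (\<sigma> y w + e y (\<kappa> p)) + e x (\<kappa> (\<tau> y p)) - (\<sigma> y (\<sigma> x w + e x (\<kappa> p)) + e y (\<kappa> (\<tau> x p)))"
      unfolding \<kappa>\<tau> clinear_add[OF line(1)] that[of "\<epsilon> p"] e(2)[OF \<kappa>K] lie_module_lie[OF \<sigma>]
        clinear_add[OF lin\<sigma>(1)] by (simp add: algebra_simps)
    then show ?thesis by (simp add: O1_def u lie_module_lie[OF \<tau>])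
  qed
  define \<phi> where "\<phi> i a = Endo (O1 (monom a i))" for i and a :: 'g
  have \<phi>: "endo_apply (\<phi> i a) = O1 (monom a i)" for i a
    unfolding \<phi>_def by (rule Endo_inverse) (simp add: O1)
  have \<phi>_lin: "clinear (\<phi> i)" for i
    by (rule clinearI; rule endo_eqI)
      (simp_all add: endo_apply_simps \<phi> clinear_add[OF clinear_monom] clinear_scale[OF clinear_monom] O1_left)
  have \<phi>_rel: "lie (\<phi> i x) (\<phi> j y) = \<phi> (i + j) (lie x y)" if "i + j \<le> 3" for i j x y
  proof (rule endo_eqI)
    fix u
    have "lie (monom x i) (monom y j) = monom (lie x y) (i + j)"
      by (simp add: lie_poly_def poly_lie_monom)
    then show "endo_apply (lie (\<phi> i x) (\<phi> j y)) u = endo_apply (\<phi> (i + j) (lie x y)) u"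
      using O1_lie[OF \<Omega>[OF that], of x y u] by (simp add: endo_apply_simps \<phi>)
  qed
  obtain \<psi> where \<psi>: "\<And>i. i \<le> 3 \<Longrightarrow> \<psi> i = \<phi> i" "\<And>i. clinear (\<psi> i)"
    "\<And>i j x y. lie (\<psi> i x) (\<psi> j y) = \<psi> (i + j) (lie x y)"
    using truncated_current_extension[OF \<phi>_lin \<phi>_rel] by blast
  note \<Psi> = current_lift[OF \<psi>(2,3)]
  define \<Theta> where "\<Theta> x = endo_apply (current_lift \<psi> x)" for x
  have \<Theta>: "lie_module \<Theta>"
    unfolding lie_module_def cbilinear_def \<Theta>_def
    by (simp add: clinear_endo_apply \<Psi>(3) endo_apply_simps)
      (simp add: clinear_iff clinear_add[OF \<Psi>(1)] clinear_scale[OF \<Psi>(1)] endo_apply_simps)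
  note lin\<Theta> = lie_module_linear[OF \<Theta>] lie_module_linear_left[OF \<Theta>]
  have \<Theta>_monom: "\<Theta> (monom a i) = O1 (monom a i)" if "i \<le> 3" for a i
    by (simp add: \<Theta>_def \<Psi>(2) \<psi>(1)[OF that] \<phi>)
  \<comment> \<open>The corrected action is explicitly known only in degrees up to 3. The two
    required properties hold there and are stable under brackets, so they spread from degrees 0 and
    1 to all of g[t].\<close>
  define Q where "Q x \<longleftrightarrow> (\<forall>w p. snd (\<Theta> x (w, p)) = \<tau> x p) \<and>
    (\<forall>w k. q k = k \<longrightarrow> \<epsilon> k = 0 \<longrightarrow> \<Theta> x (w, k) = (\<sigma> x w + e x k, \<tau> x k))" for x
  have "Q x" for x
  proof (rule current_algebra_induct[where Q = Q])
    show "Q (monom a 0)" "Q (monom a 1)" for a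
      by (simp_all add: Q_def \<Theta>_monom O1_def \<kappa>_id)
    show "csubspace {x. Q x}"
      by (auto simp: complex_vector.subspace_def Q_def clinear_0[OF lin\<Theta>(2)] clinear_0[OF lin\<tau>(2)]
          clinear_0[OF lin\<sigma>(2)] clinear_0[OF line(2)] clinear_add[OF lin\<Theta>(2)] clinear_add[OF lin\<tau>(2)]
          clinear_add[OF lin\<sigma>(2)] clinear_add[OF line(2)] clinear_scale[OF lin\<Theta>(2)]
          clinear_scale[OF lin\<tau>(2)] clinear_scale[OF lin\<sigma>(2)] clinear_scale[OF line(2)]
          scaleC_prod_def scaleC_add_right zero_prod_def)
    fix x y assume x: "Q x" and y: "Q y"
    have snd_eq: "snd (\<Theta> z u) = \<tau> z (snd u)" if "Q z" for z u
      using that unfolding Q_def by (metis prod.collapse)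
    have 1: "snd (\<Theta> (lie x y) (w, p)) = \<tau> (lie x y) p" for w p
      by (simp add: lie_module_lie[OF \<Theta>] lie_module_lie[OF \<tau>] snd_eq x y)
    have 2: "\<Theta> (lie x y) (w, k) = (\<sigma> (lie x y) w + e (lie x y) k, \<tau> (lie x y) k)"
      if k: "q k = k" "\<epsilon> k = 0" for w k
    proof -
      have act: "\<Theta> z (w, k) = (\<sigma> z w + e z k, \<tau> z k)" if "Q z" "q k = k" "\<epsilon> k = 0" for z w k
        using that unfolding Q_def by blast
      have k': "q (\<tau> z k) = \<tau> z k" "\<epsilon> (\<tau> z k) = 0" for z
        using k by (simp_all add: q(3) \<epsilon>(2) clinear_0[OF lin\<rho>(1)])
      show ?thesis
        unfolding lie_module_lie[OF \<Theta>] act[OF x k] act[OF y k] act[OF x k'] act[OF y k']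
          lie_module_lie[OF \<sigma>] lie_module_lie[OF \<tau>] e(2)[OF k] clinear_add[OF lin\<sigma>(1)]
        by (simp add: algebra_simps)
    qed
    show "Q (lie x y)" unfolding Q_def using 1 2 by blast
  qed
  then show ?thesis using that[OF \<Theta>] unfolding Q_def by blast
qed

end

section \<open>Modules over enveloping algebras as complex vector spaces\<close>

lemma free_algebra_scalar_mult:
  "(c *\<^sub>C 1) * p = c *\<^sub>C (p :: 'a free_algebra)" "p * (c *\<^sub>C 1) = c *\<^sub>C p"
proof -
  have 1: "c *\<^sub>C (1 :: 'a free_algebra) = Poly_Mapping.single 0 c"
    by (simp add: scaleC_single scaleC_complex_def flip: single_one)
  show "(c *\<^sub>C 1) * p = c *\<^sub>C p"
    by (rule poly_mapping_additive_eqI[where p = p])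
      (simp_all add: 1 distrib_left scaleC_add_right mult_single scaleC_single scaleC_complex_def)
  show "p * (c *\<^sub>C 1) = c *\<^sub>C p"
    by (rule poly_mapping_additive_eqI[where p = p])
      (simp_all add: 1 distrib_right scaleC_add_right mult_single scaleC_single scaleC_complex_def mult.commute)
qed

lemma uea_scalar_add: "uea_scalar (c + d) = uea_scalar c + uea_scalar d"
  by transfer (simp add: scaleC_add_left uea_ideal.intros(1))

lemma uea_scalar_mult: "uea_scalar (c * d) = uea_scalar c * uea_scalar d"
  by transfer (simp add: free_algebra_scalar_mult(1) scaleC_scaleC uea_ideal.intros(1))

lemma uea_scalar_1: "uea_scalar 1 = 1"
  by transfer (simp add: scaleC_one uea_ideal.intros(1))

lemma uea_scalar_commute: "u * uea_scalar c = uea_scalar c * u"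
  by transfer (simp add: free_algebra_scalar_mult uea_ideal.intros(1))

instantiation uea :: (complex_lie_algebra) complex_vector
begin

definition "scaleC_uea c u = uea_scalar c * (u :: 'a uea)"

instance
  by standard (simp_all add: scaleC_uea_def uea_scalar_add uea_scalar_mult uea_scalar_1
      distrib_left distrib_right mult.assoc)

end

lemma uea_gen_add: "uea_gen (x + y) = uea_gen x + uea_gen y"
  by transfer (use uea_ideal.intros(4) in \<open>simp add: diff_diff_eq\<close>)

lemma uea_gen_scaleC: "uea_gen (c *\<^sub>C x) = uea_scalar c * uea_gen x"
  by transfer (simp add: free_algebra_scalar_mult uea_ideal.intros(5))

lemma uea_gen_lie: "uea_gen (lie x y) = uea_gen x * uea_gen y - uea_gen y * uea_gen x"
proof -
  have "uea_gen x * uea_gen y - uea_gen y * uea_gen x = uea_gen (lie x y)"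
    by transfer (rule uea_ideal.intros(6))
  then show ?thesis by simp
qed

lemma uea_induct:
  assumes "\<And>x. Q (uea_gen x)" "\<And>c. Q (uea_scalar c)" "\<And>u v. Q u \<Longrightarrow> Q v \<Longrightarrow> Q (u + v)"
    "\<And>u v. Q u \<Longrightarrow> Q v \<Longrightarrow> Q (u * v)"
  shows "Q u"
proof -
  have "Q (abs_uea p)" for p
  proof (induction p rule: free_algebra_induct)
    case 2
    then show ?case using assms(2)[of 1] by (simp add: uea_scalar_1 flip: one_uea_def)
  qed (use assms in \<open>simp_all flip: plus_uea.abs_eq times_uea.abs_eq uea_gen.abs_eq uea_scalar.abs_eq\<close>)
  then show ?thesis by (cases u rule: uea_cases) simp
qed

text \<open>\<open>uea_module\<close> concerns the additive group alone; the second clause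
  identifies the given complex structure with the one that comes from
  \<open>uea_scalar\<close>.\<close>

definition complex_uea_module :: "('l::complex_lie_algebra uea \<Rightarrow> 'v::complex_vector \<Rightarrow> 'v) \<Rightarrow> bool"
  where "complex_uea_module A \<longleftrightarrow> uea_module A \<and> (\<forall>c v. A (uea_scalar c) v = c *\<^sub>C v)"

lemma complex_uea_module_simps:
  assumes "complex_uea_module A"
  shows "A (u + u') v = A u v + A u' v" "A (u * u') v = A u (A u' v)" "A (uea_scalar c) v = c *\<^sub>C v"
    "clinear (A u)"
proof -
  show *: "A (u + u') v = A u v + A u' v" "A (u * u') v = A u (A u' v)" "A (uea_scalar c) v = c *\<^sub>C v"
    for u u' v c
    using assms by (simp_all add: complex_uea_module_def uea_module_def)
  show "clinear (A u)"
  proof (rule clinearI)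
    show "A u (x + y) = A u x + A u y" for x y
      using assms by (simp add: complex_uea_module_def uea_module_def)
    show "A u (c *\<^sub>C x) = c *\<^sub>C A u x" for c x
      using *(2)[of u "uea_scalar c" x] by (simp add: uea_scalar_commute *)
  qed
qed

lemma complex_uea_module_uea_act: "lie_module \<rho> \<Longrightarrow> complex_uea_module (uea_act \<rho>)"
  by (simp add: complex_uea_module_def uea_act)

lemma free_module_act_scalar: "free_module_act (uea_scalar c) p = c *\<^sub>C p"
  by (simp add: poly_mapping_eq_iff fun_eq_iff lookup_free_module_act lookup_scaleC scaleC_uea_def)

lemma complex_uea_module_free: "complex_uea_module free_module_act"
  by (simp add: complex_uea_module_def uea_module_free_module_act free_module_act_scalar)

lemma lie_module_uea_gen:
  assumes A: "complex_uea_module A"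
  shows "lie_module (\<lambda>x. A (uea_gen x))"
proof -
  note S = complex_uea_module_simps[OF A]
  have "A (uea_gen (lie x y)) v = A (uea_gen x) (A (uea_gen y) v) - A (uea_gen y) (A (uea_gen x) v)" for x y v
  proof -
    have "A (uea_gen (lie x y)) v + A (uea_gen y * uea_gen x) v = A (uea_gen x * uea_gen y) v"
      by (simp add: uea_gen_lie flip: S(1))
    then show ?thesis by (simp add: S(2) eq_diff_eq)
  qed
  then show ?thesis
    by (simp add: lie_module_def cbilinear_def S(4))
      (simp add: clinear_iff uea_gen_add uea_gen_scaleC S)
qed

lemma hom_on_generators:
  assumes A: "complex_uea_module A" and A': "complex_uea_module A'"
    and M: "\<And>u m. m \<in> M \<Longrightarrow> A u m \<in> M"
    and add: "\<And>x y. x \<in> M \<Longrightarrow> y \<in> M \<Longrightarrow> f (x + y) = f x + f y"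
    and scale: "\<And>c x. x \<in> M \<Longrightarrow> f (c *\<^sub>C x) = c *\<^sub>C f x"
    and gen: "\<And>x m. m \<in> M \<Longrightarrow> f (A (uea_gen x) m) = A' (uea_gen x) (f m)"
  shows "hom_on M A A' f"
proof -
  have "\<forall>m\<in>M. f (A u m) = A' u (f m)" for u
    by (induction u rule: uea_induct)
      (auto simp: gen scale add M complex_uea_module_simps(1-3)[OF A] complex_uea_module_simps(1-3)[OF A'])
  then show ?thesis using add by (simp add: hom_on_def)
qed

lemma subspace_Hom_space:
  assumes A': "complex_uea_module A'"
  shows "csubspace (Hom_space M A A')"
  using clinear_0[OF complex_uea_module_simps(4)[OF A']] clinear_add[OF complex_uea_module_simps(4)[OF A']]
    clinear_scale[OF complex_uea_module_simps(4)[OF A']]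
  by (simp add: complex_vector.subspace_def Hom_space_def hom_on_def scaleC_fun_def scaleC_add_right add_ac)

lemma subspace_ext_cocycles:
  assumes "complex_uea_module A'"
  shows "csubspace (ext_cocycles P d A' n)"
  using subspace_Hom_space[OF assms, of "P n" free_module_act]
  by (auto simp: ext_cocycles_def complex_vector.subspace_def scaleC_fun_def)

lemma subspace_ext_coboundaries:
  assumes "complex_uea_module A'"
  shows "csubspace (ext_coboundaries P d A' n)"
proof (cases n)
  case (Suc m)
  have "clinear (\<lambda>g x. if x \<in> P (Suc m) then g (d m x) else 0)"
    by (rule clinearI) (auto simp: fun_eq_iff scaleC_fun_def)
  then show ?thesis
    unfolding Suc ext_coboundaries.simps
    by (rule complex_vector_pair.linear_subspace_image) (rule subspace_Hom_space[OF assms])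
qed simp

text \<open>One functional at a time: if it is nonzero somewhere on the part of \<open>Z\<close>
  killed by the earlier ones, such a vector joins \<open>F\<close> and serves as a correction;
  otherwise \<open>F\<close> suffices as it is.\<close>

lemma finite_codimension:
  fixes l :: "'i \<Rightarrow> 'x::complex_vector \<Rightarrow> complex"
  assumes "finite I" and Z: "csubspace Z" and l: "\<And>i. clinear (l i)"
  shows "\<exists>F. finite F \<and> F \<subseteq> Z \<and> (\<forall>z\<in>Z. \<exists>y\<in>cspan F. \<forall>i\<in>I. l i (z - y) = 0)"
  using assms(1)
proof (induction I rule: finite_induct)
  case empty
  show ?case by (intro exI[of _ "{}"]) auto
next
  case (insert i I)
  then obtain F where F: "finite F" "F \<subseteq> Z" "\<And>z. z \<in> Z \<Longrightarrow> \<exists>y\<in>cspan F. \<forall>i\<in>I. l i (z - y) = 0"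
    by blast
  have spF: "cspan F \<subseteq> Z" by (rule complex_vector.span_minimal[OF F(2) Z])
  show ?case
  proof (cases "\<exists>z0\<in>Z. (\<forall>j\<in>I. l j z0 = 0) \<and> l i z0 \<noteq> 0")
    case False
    have "\<exists>y\<in>cspan F. \<forall>i\<in>insert i I. l i (z - y) = 0" if z: "z \<in> Z" for z
    proof -
      obtain y where y: "y \<in> cspan F" "\<forall>i\<in>I. l i (z - y) = 0" using F(3)[OF z] by blast
      have "z - y \<in> Z" using complex_vector.subspace_diff[OF Z z] y(1) spF by blast
      then show ?thesis using False y by blast
    qed
    then show ?thesis using F(1,2) by blast
  next
    case True
    then obtain z0 where z0: "z0 \<in> Z" "\<And>j. j \<in> I \<Longrightarrow> l j z0 = 0" "l i z0 \<noteq> 0" by blast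
    have "\<exists>y\<in>cspan (insert z0 F). \<forall>i\<in>insert i I. l i (z - y) = 0" if z: "z \<in> Z" for z
    proof -
      obtain y where y: "y \<in> cspan F" "\<forall>i\<in>I. l i (z - y) = 0" using F(3)[OF z] by blast
      let ?c = "l i (z - y) / l i z0"
      have "y \<in> cspan (insert z0 F)"
        using y(1) complex_vector.span_mono[OF subset_insertI] by blast
      then have "y + ?c *\<^sub>C z0 \<in> cspan (insert z0 F)"
        by (intro complex_vector.span_add complex_vector.span_scale) (auto intro: complex_vector.span_base)
      moreover have "l j (z - (y + ?c *\<^sub>C z0)) = l j (z - y) - ?c * l j z0" for j
        by (simp add: clinear_diff[OF l] clinear_add[OF l] clinear_scale[OF l] scaleC_complex_def)
      ultimately show ?thesis using y(2) z0(2,3) by (intro bexI[of _ "y + ?c *\<^sub>C z0"]) auto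
    qed
    then show ?thesis using F(1,2) z0(1) by (intro exI[of _ "insert z0 F"]) auto
  qed
qed

text \<open>Modulo coboundaries a cocycle is determined by its finitely many values
  \<open>l i\<close>, so the classes from a suitable finite span exhaust Ext.\<close>

lemma ext_finite_dimensionalI:
  fixes l :: "'i \<Rightarrow> (('b \<Rightarrow>\<^sub>0 'l::complex_lie_algebra uea) \<Rightarrow> 'w::complex_vector) \<Rightarrow> complex"
  assumes A: "complex_uea_module A" and "finite I" and l: "\<And>i. clinear (l i)"
    and ker: "\<And>f. f \<in> ext_cocycles P d A n \<Longrightarrow> (\<And>i. i \<in> I \<Longrightarrow> l i f = 0) \<Longrightarrow> f \<in> ext_coboundaries P d A n"
  shows "Ext_finite_dimensional P d A n"
proof -
  let ?Z = "ext_cocycles P d A n" and ?B = "ext_coboundaries P d A n"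
  note Z = subspace_ext_cocycles[OF A, of P d n] and B = subspace_ext_coboundaries[OF A, of P d n]
  obtain F where F: "finite F" "F \<subseteq> ?Z" "\<And>z. z \<in> ?Z \<Longrightarrow> \<exists>y\<in>cspan F. \<forall>i\<in>I. l i (z - y) = 0"
    using finite_codimension[where l = l, OF assms(2) Z l] by blast
  have spF: "cspan F \<subseteq> ?Z" by (rule complex_vector.span_minimal[OF F(2) Z])
  have "ext_class P d A n z \<in> ext_class P d A n ` cspan F" if z: "z \<in> ?Z" for z
  proof -
    obtain y where y: "y \<in> cspan F" "\<And>i. i \<in> I \<Longrightarrow> l i (z - y) = 0" using F(3)[OF z] by blast
    have "z - y \<in> ?B"
      using complex_vector.subspace_diff[OF Z z] y spF by (intro ker) auto
    then have b: "z - y + b \<in> ?B" "b - (z - y) \<in> ?B" if "b \<in> ?B" for b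
      using that complex_vector.subspace_add[OF B] complex_vector.subspace_diff[OF B] by auto
    have "ext_class P d A n z = ext_class P d A n y"
    proof (intro equalityI subsetI)
      fix u assume "u \<in> ext_class P d A n z"
      then obtain c where "c \<in> ?B" "u = z + c" by (auto simp: ext_class_def)
      then show "u \<in> ext_class P d A n y"
        using b(1)[of c] unfolding ext_class_def by (intro CollectI exI[of _ "z - y + c"]) simp
    next
      fix u assume "u \<in> ext_class P d A n y"
      then obtain c where "c \<in> ?B" "u = y + c" by (auto simp: ext_class_def)
      then show "u \<in> ext_class P d A n z"
        using b(2)[of c] unfolding ext_class_def by (intro CollectI exI[of _ "c - (z - y)"]) simp
    qed
    then show ?thesis using y(1) by blast
  qed
  then have "Ext P d A n = ext_class P d A n ` cspan F"
    unfolding Ext_def using spF by blast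
  then show ?thesis unfolding Ext_finite_dimensional_def using F(1,2) by blast
qed

section \<open>Finite-dimensionality of the second Ext space\<close>

lemma finite_dimensional_tensor:
  assumes "finite_dimensional (UNIV :: 'a::complex_vector set)" "finite_dimensional (UNIV :: 'b::complex_vector set)"
  shows "finite_dimensional (UNIV :: ('a, 'b) tensor set)"
proof -
  obtain B where B: "finite B" "cindependent B" "cspan B = (UNIV :: 'a set)"
    by (rule finite_dimensional_basis[OF assms(1)])
  obtain C where C: "finite C" "cindependent C" "cspan C = (UNIV :: 'b set)"
    by (rule finite_dimensional_basis[OF assms(2)])
  let ?S = "(\<lambda>(x, y). x \<otimes>\<^sub>C y) ` (B \<times> C)"
  have lin: "clinear (\<lambda>y :: 'b. x \<otimes>\<^sub>C y)" "clinear (\<lambda>x :: 'a. x \<otimes>\<^sub>C y)" for x :: 'a and y :: 'b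
    using cbilinear_tensor_pair[where 'a = 'a and 'b = 'b] unfolding cbilinear_def by blast+
  have 1: "x \<otimes>\<^sub>C y \<in> cspan ?S" if x: "x \<in> B" for x y
  proof -
    have "(\<lambda>y. x \<otimes>\<^sub>C y) ` cspan C = cspan ((\<lambda>y. x \<otimes>\<^sub>C y) ` C)"
      by (rule complex_vector_pair.linear_span_image[OF lin(1), symmetric])
    also have "\<dots> \<subseteq> cspan ?S"
      by (rule complex_vector.span_mono) (use x in auto)
    finally show ?thesis using C(3) by blast
  qed
  have 2: "x \<otimes>\<^sub>C y \<in> cspan ?S" for x y
  proof -
    have "(\<lambda>x. x \<otimes>\<^sub>C y) ` cspan B = cspan ((\<lambda>x. x \<otimes>\<^sub>C y) ` B)"
      by (rule complex_vector_pair.linear_span_image[OF lin(2), symmetric])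
    also have "\<dots> \<subseteq> cspan ?S"
      by (rule complex_vector.span_minimal) (use 1 in auto)
    finally show ?thesis using B(3) by blast
  qed
  \<comment> \<open>The span contains every pure tensor, so a linear map with this kernel agrees
    with 0 on pure tensors and hence everywhere.\<close>
  obtain \<pi> :: "('a, 'b) tensor \<Rightarrow> ('a, 'b) tensor" where \<pi>: "clinear \<pi>" "\<And>t. \<pi> t = 0 \<longleftrightarrow> t \<in> cspan ?S"
    by (rule ex_linear_with_kernel[of "cspan ?S"]) simp_all
  have "\<pi> t = 0" for t
    by (rule tensor_hom_eqI[OF \<pi>(1)]) (simp_all add: \<pi>(2) 2 clinear_iff)
  then have "cspan ?S = UNIV" using \<pi>(2) by blast
  then show ?thesis using finite_dimensional_span[of ?S] B(1) C(1) by simp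
qed

lemma clinear_eq_0_on_UNIV:
  assumes "clinear h" "cspan B = UNIV" "\<And>b. b \<in> B \<Longrightarrow> h b = 0"
  shows "h x = 0"
  using complex_vector_pair.linear_eq_0_on_span[OF assms(1,3), of B x] assms(2) by blast

lemma projectiveE:
  fixes P :: "('b \<Rightarrow>\<^sub>0 'l::complex_lie_algebra uea) set"
  assumes "projective P"
  obtains e where "clinear e" "\<And>u p. e (free_module_act u p) = free_module_act u (e p)"
    "\<And>p. e p \<in> P" "\<And>p. p \<in> P \<Longrightarrow> e p = p"
proof -
  obtain e where e: "hom_on UNIV free_module_act free_module_act e" "\<And>x. e (e x) = e x" "P = range e"
    using assms unfolding projective_def by blast
  show ?thesis
  proof (rule that[of e])
    show act: "e (free_module_act u p) = free_module_act u (e p)" for u p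
      using e(1) by (simp add: hom_on_def)
    show "clinear e"
      using e(1) act[of "uea_scalar _"] by (intro clinearI) (simp_all add: hom_on_def free_module_act_scalar)
    show "e p \<in> P" for p using e(3) by simp
    show "e p = p" if "p \<in> P" for p using that e(2,3) by auto
  qed
qed

text \<open>With \<open>e\<close> the projector onto a projective module, the section takes its
  values in that module; composing with \<open>e\<close> keeps it a section because \<open>f\<close>
  does not see \<open>e\<close>.\<close>

lemma ex_linear_section:
  assumes f: "clinear f" and e: "clinear e" "\<And>p. f (e p) = f p"
  obtains s where "clinear s" "\<And>v. \<exists>p. s v = e p" "\<And>p. f (s (f p)) = f p"
proof -
  obtain g where g: "clinear g" "\<forall>v\<in>range f. f (g v) = v"
    using complex_vector_pair.linear_exists_right_inverse_on[OF f complex_vector.subspace_UNIV] by blast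
  show ?thesis
    by (rule that[of "\<lambda>v. e (g v)"]) (use g e in \<open>auto intro: clinear_compose\<close>)
qed

context simple_lie
begin

theorem ext2_finite_dimensional:
  fixes \<rho> :: "'g poly \<Rightarrow> 'v::complex_vector \<Rightarrow> 'v" and \<sigma> :: "'g poly \<Rightarrow> 'w::complex_vector \<Rightarrow> 'w"
    and P :: "nat \<Rightarrow> ('b \<Rightarrow>\<^sub>0 'g poly uea) set"
  assumes \<rho>: "lie_module \<rho>" and \<sigma>: "lie_module \<sigma>"
    and fdV: "finite_dimensional (UNIV :: 'v set)" and fdW: "finite_dimensional (UNIV :: 'w set)"
    and res: "projective_resolution (uea_act \<rho>) P d \<epsilon>"
  shows "Ext_finite_dimensional P d (uea_act \<sigma>) 2"
proof -
  let ?F = "free_module_act :: 'g poly uea \<Rightarrow> ('b \<Rightarrow>\<^sub>0 'g poly uea) \<Rightarrow> _"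
  define A where "A = uea_act \<sigma>"
  have A: "complex_uea_module A" unfolding A_def by (rule complex_uea_module_uea_act[OF \<sigma>])
  have A_gen: "A (uea_gen x) w = \<sigma> x w" for x w unfolding A_def by (rule uea_act[OF \<sigma>])
  have A_sc: "A (uea_scalar c) w = c *\<^sub>C w" for c w unfolding A_def by (rule uea_act[OF \<sigma>])
  define \<tau> where "\<tau> x = ?F (uea_gen x)" for x
  have \<tau>: "lie_module \<tau>"
    unfolding \<tau>_def by (rule lie_module_uea_gen[OF complex_uea_module_free])
  note lin\<tau> = lie_module_linear[OF \<tau>] lie_module_linear_left[OF \<tau>]
  have "\<exists>e. clinear e \<and> (\<forall>u p. e (?F u p) = ?F u (e p)) \<and> (\<forall>p. e p \<in> P n) \<and> (\<forall>p\<in>P n. e p = p)" for n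
  proof -
    have "projective (P n)" using res by (simp add: projective_resolution_def)
    then show ?thesis by (rule projectiveE) blast
  qed
  then obtain q where q: "\<And>n. clinear (q n)" "\<And>n u p. q n (?F u p) = ?F u (q n p)"
    "\<And>n p. q n p \<in> P n" "\<And>n p. p \<in> P n \<Longrightarrow> q n p = p"
    by metis
  have memP: "p \<in> P n \<longleftrightarrow> q n p = p" for p n using q(3,4) by metis
  have subP: "csubspace (P n)" for n
    by (auto simp: complex_vector.subspace_def memP clinear_0[OF q(1)] clinear_add[OF q(1)] clinear_scale[OF q(1)])
  have actP: "?F u p \<in> P n" if "p \<in> P n" for u p n using that by (simp add: memP q(2))
  have d_add: "d n (x + y) = d n x + d n y" and d_act: "d n (?F u x) = ?F u (d n x)"
    if "x \<in> P (Suc n)" "y \<in> P (Suc n)" for n x y u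
    using res that by (simp_all add: projective_resolution_def hom_on_def)
  have \<epsilon>_add: "\<epsilon> (x + y) = \<epsilon> x + \<epsilon> y" and \<epsilon>_act: "\<epsilon> (?F u x) = uea_act \<rho> u (\<epsilon> x)"
    if "x \<in> P 0" "y \<in> P 0" for x y u
    using res that by (simp_all add: projective_resolution_def hom_on_def)
  have \<epsilon>_surj: "\<epsilon> ` P 0 = UNIV" and ex0: "{x \<in> P 0. \<epsilon> x = 0} = d 0 ` P 1"
    and ex1: "{x \<in> P 1. d 0 x = 0} = d 1 ` P 2" and ex2: "{x \<in> P 2. d 1 x = 0} = d 2 ` P 3"
    using res unfolding projective_resolution_def by (auto simp: numeral_eq_Suc)
  have dP1: "d 1 x \<in> P 1" "d 0 (d 1 x) = 0" if "x \<in> P 2" for x using ex1 that by blast+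
  \<comment> \<open>\<open>\<epsilon>\<close> and \<open>d n\<close> are controlled only on the
    modules of the resolution; composition with the projectors \<open>q\<close> gives maps that are
    linear on the whole free module.\<close>
  define \<epsilon>' where "\<epsilon>' p = \<epsilon> (q 0 p)" for p
  define D where "D n p = d n (q (Suc n) p)" for n p
  have \<epsilon>'F: "\<epsilon>' (?F u p) = uea_act \<rho> u (\<epsilon>' p)" for u p
    unfolding \<epsilon>'_def q(2) by (rule \<epsilon>_act[OF q(3) q(3)])
  have \<epsilon>': "clinear \<epsilon>'"
  proof (rule clinearI)
    show "\<epsilon>' (x + y) = \<epsilon>' x + \<epsilon>' y" for x y
      unfolding \<epsilon>'_def clinear_add[OF q(1)] by (rule \<epsilon>_add[OF q(3) q(3)])
    show "\<epsilon>' (c *\<^sub>C x) = c *\<^sub>C \<epsilon>' x" for c x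
      using \<epsilon>'F[of "uea_scalar c" x] uea_act(2)[OF \<rho>] by (simp add: free_module_act_scalar)
  qed
  have DF: "D n (?F u p) = ?F u (D n p)" for n u p
    unfolding D_def q(2) by (rule d_act[OF q(3) q(3)])
  have D: "clinear (D n)" for n
  proof (rule clinearI)
    show "D n (x + y) = D n x + D n y" for x y
      unfolding D_def clinear_add[OF q(1)] by (rule d_add[OF q(3) q(3)])
    show "D n (c *\<^sub>C x) = c *\<^sub>C D n x" for c x
      using DF[of n "uea_scalar c" x] by (simp add: free_module_act_scalar)
  qed
  have dD: "d n x = D n x" if "x \<in> P (Suc n)" for n x using q(4)[OF that] by (simp add: D_def)
  have \<epsilon>q: "\<epsilon>' (q 0 p) = \<epsilon>' p" and Dq: "D n (q (Suc n) p) = D n p" for n p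
    by (simp_all add: \<epsilon>'_def D_def q(3,4))
  obtain s0 where s0: "clinear s0" "\<And>v. \<exists>p. s0 v = q 0 p" "\<And>p. \<epsilon>' (s0 (\<epsilon>' p)) = \<epsilon>' p"
    by (rule ex_linear_section[where f = \<epsilon>' and e = "q 0", OF \<epsilon>' q(1) \<epsilon>q]) blast
  have Dq': "D 0 (q 1 p) = D 0 p" "D 1 (q 2 p) = D 1 p" for p
    using Dq[of 0 p] Dq[of 1 p] by (simp_all add: numeral_2_eq_2)
  obtain s1 where s1: "clinear s1" "\<And>v. \<exists>p. s1 v = q 1 p" "\<And>p. D 0 (s1 (D 0 p)) = D 0 p"
    by (rule ex_linear_section[where f = "D 0" and e = "q 1", OF D q(1) Dq'(1)]) blast
  obtain s2 where s2: "clinear s2" "\<And>v. \<exists>p. s2 v = q 2 p" "\<And>p. D 1 (s2 (D 1 p)) = D 1 p"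
    by (rule ex_linear_section[where f = "D 1" and e = "q 2", OF D q(1) Dq'(2)]) blast
  have s0P: "s0 v \<in> P 0" for v by (rule exE[OF s0(2)[of v]]) (simp add: q(3))
  have s1P: "s1 k \<in> P 1" for k by (rule exE[OF s1(2)[of k]]) (simp add: q(3))
  have s2P: "s2 z \<in> P 2" for z by (rule exE[OF s2(2)[of z]]) (simp add: q(3))
  have s0_sec: "\<epsilon>' (s0 v) = v" for v
  proof -
    obtain p where "p \<in> P 0" "v = \<epsilon> p" using \<epsilon>_surj by (metis UNIV_I imageE)
    then have "v = \<epsilon>' p" by (simp add: \<epsilon>'_def q(4))
    then show ?thesis using s0(3) by simp
  qed
  have s1_sec: "d 0 (s1 k) = k" if "k \<in> P 0" "\<epsilon> k = 0" for k
  proof -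
    have "k \<in> d 0 ` P 1" unfolding ex0[symmetric] using that by simp
    then obtain p where "p \<in> P 1" "k = d 0 p" by (elim imageE)
    then show ?thesis using s1(3)[of p] dD[of _ 0] s1P by simp
  qed
  have s2_sec: "d 1 (s2 z) = z" if "z \<in> P 1" "d 0 z = 0" for z
  proof -
    have "z \<in> d 1 ` P 2" unfolding ex1[symmetric] using that by simp
    then obtain p where "p \<in> P 2" "z = d 1 p" by (elim imageE)
    then show ?thesis using s2(3)[of p] dD[of _ 1] s2P by (simp add: numeral_2_eq_2)
  qed
  \<comment> \<open>\<open>c1\<close> and \<open>c0\<close> measure how far the sections are from
    being equivariant: \<open>c0\<close> has values in the kernel of \<open>\<epsilon>\<close>, and
    \<open>c1 x\<close> carries that kernel into the cycles of \<open>P 1\<close>.\<close>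
  define c1 where "c1 x k = \<tau> x (s1 k) - s1 (\<tau> x k)" for x k
  have c1: "clinear (c1 x)" "clinear (\<lambda>x. c1 x k)" for x k
    unfolding c1_def
    by (rule clinear_diff_fun[OF clinear_compose[OF lin\<tau>(1) s1(1)] clinear_compose[OF s1(1) lin\<tau>(1)]])
      (rule clinear_diff_fun[OF lin\<tau>(2) clinear_compose[OF s1(1) lin\<tau>(2)]])
  define c0 where "c0 y v = \<tau> y (s0 v) - s0 (\<rho> y v)" for y v
  have c0: "clinear (c0 y)" "clinear (\<lambda>y. c0 y v)" for y v
    unfolding c0_def
    by (rule clinear_diff_fun[OF clinear_compose[OF lin\<tau>(1) s0(1)]
          clinear_compose[OF s0(1) lie_module_linear[OF \<rho>]]])
      (rule clinear_diff_fun[OF lin\<tau>(2) clinear_compose[OF s0(1) lie_module_linear_left[OF \<rho>]]])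
  obtain Bg where Bg: "finite Bg" "cindependent Bg" "cspan Bg = (UNIV :: 'g set)"
    by (rule finite_dimensional_basis[OF finite_dimensional])
  obtain Bv where Bv: "finite Bv" "cindependent Bv" "cspan Bv = (UNIV :: 'v set)"
    by (rule finite_dimensional_basis[OF fdV])
  obtain Bw where Bw: "finite Bw" "cindependent Bw" "cspan Bw = (UNIV :: 'w set)"
    by (rule finite_dimensional_basis[OF fdW])
  \<comment> \<open>The functionals are coordinates of the 2-cocycle that \<open>f\<close> induces
    through the three sections. The square of degrees is a convenient finite set that contains every
    pair with \<open>i + j \<le> 3\<close>.\<close>
  define I where "I = {..3::nat} \<times> {..3::nat} \<times> Bg \<times> Bg \<times> Bv \<times> Bw"
  have finI: "finite I" using Bg Bv Bw by (simp add: I_def)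
  define l where "l = (\<lambda>(i, j, a, b, v, w) f.
    crep Bw (f (s2 (c1 (monom a i) (c0 (monom b j) v))) - f (s2 (c1 (monom b j) (c0 (monom a i) v)))) w)"
  have l: "clinear (l idx)" for idx
  proof -
    obtain i j a b v w where idx: "idx = (i, j, a, b, v, w)" by (cases idx)
    show ?thesis
      unfolding idx l_def
      by (rule clinearI)
        (simp_all add: Bw(3) scaleC_fun_def complex_vector.representation_add[OF Bw(2)]
          complex_vector.representation_diff[OF Bw(2)] complex_vector.representation_scale[OF Bw(2)]
          scaleC_complex_def right_diff_distrib)
  qed
  show ?thesis
    unfolding A_def[symmetric]
  proof (rule ext_finite_dimensionalI[OF A finI l])
    fix f assume f: "f \<in> ext_cocycles P d A 2" and l0: "\<And>idx. idx \<in> I \<Longrightarrow> l idx f = 0"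
    have f_hom: "f (x + y) = f x + f y" "f (?F u x) = A u (f x)" if "x \<in> P 2" "y \<in> P 2" for x y u
      using f that by (simp_all add: ext_cocycles_def Hom_space_def hom_on_def)
    have f_out: "f x = 0" if "x \<notin> P 2" for x
      using f that by (simp add: ext_cocycles_def Hom_space_def)
    have f_bd: "f (d 2 x) = 0" if "x \<in> P 3" for x
      using f that by (simp add: ext_cocycles_def numeral_eq_Suc)
    have f_scale: "f (c *\<^sub>C x) = c *\<^sub>C f x" if "x \<in> P 2" for c x
      using f_hom(2)[OF that that, of "uea_scalar c"] by (simp add: free_module_act_scalar A_sc)
    \<comment> \<open>\<open>f\<close> kills the kernel of \<open>d 1\<close>, so it descends to the
      cycles of \<open>P 1\<close>; \<open>\<phi>\<close> agrees with the descended map there and is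
      a linear extension of it elsewhere.\<close>
    define \<phi> where "\<phi> z = f (s2 z)" for z
    have \<phi>: "clinear \<phi>"
      unfolding \<phi>_def
      by (rule clinearI) (simp_all add: clinear_add[OF s2(1)] clinear_scale[OF s2(1)] f_hom f_scale s2P)
    have \<phi>d: "\<phi> (d 1 y) = f y" if y: "y \<in> P 2" for y
    proof -
      let ?y' = "s2 (d 1 y)"
      have mem: "y - ?y' \<in> P 2" by (rule complex_vector.subspace_diff[OF subP y s2P])
      have "d 1 (y - ?y') = D 1 y - D 1 ?y'"
        using dD[of "y - ?y'" 1] mem by (simp add: numeral_2_eq_2 clinear_diff[OF D])
      also have "\<dots> = 0"
        using s2_sec[OF dP1[OF y]] dD[of y 1] dD[of ?y' 1] y s2P by (simp add: numeral_2_eq_2)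
      finally have "y - ?y' \<in> d 2 ` P 3" unfolding ex2[symmetric] using mem by simp
      then obtain z where "z \<in> P 3" "y - ?y' = d 2 z" by (elim imageE)
      then have "f (y - ?y') = 0" using f_bd by simp
      moreover have "f y = f (y - ?y') + f ?y'" using f_hom(1)[OF mem s2P[of "d 1 y"]] by simp
      ultimately show ?thesis by (simp add: \<phi>_def)
    qed
    have \<phi>\<tau>: "\<phi> (\<tau> x z) = \<sigma> x (\<phi> z)" if "z \<in> P 1" "d 0 z = 0" for x z
    proof -
      have "z \<in> d 1 ` P 2" unfolding ex1[symmetric] using that by simp
      then obtain y where y: "y \<in> P 2" "z = d 1 y" by (elim imageE)
      have "\<tau> x z = d 1 (\<tau> x y)"
        unfolding \<tau>_def y(2) using d_act[of y 1 y] y(1) by (simp add: numeral_2_eq_2)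
      moreover have "\<tau> x y \<in> P 2" unfolding \<tau>_def by (rule actP[OF y(1)])
      ultimately show ?thesis
        using \<phi>d f_hom(2)[OF y(1) y(1)] y by (simp add: \<tau>_def A_gen)
    qed
    have Kact: "\<tau> x k \<in> P 0" "\<epsilon> (\<tau> x k) = 0" if "k \<in> P 0" "\<epsilon> k = 0" for x k
      using actP[OF that(1)] \<epsilon>_act[OF that(1) that(1)] that(2) uea_act(3)[OF \<rho>]
        clinear_0[OF lie_module_linear[OF \<rho>]] by (simp_all add: \<tau>_def)
    have P1act: "\<tau> x p \<in> P 1" "d 0 (\<tau> x p) = \<tau> x (d 0 p)" if "p \<in> P 1" for x p
      using actP[OF that] d_act[of p 0 p] that by (simp_all add: \<tau>_def)
    have d0_diff: "d 0 (p - p') = d 0 p - d 0 p'" if "p \<in> P 1" "p' \<in> P 1" for p p'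
      using dD[of _ 0] that complex_vector.subspace_diff[OF subP that] by (simp add: clinear_diff[OF D])
    have c1Z: "c1 x k \<in> P 1" "d 0 (c1 x k) = 0" if "k \<in> P 0" "\<epsilon> k = 0" for x k
    proof -
      show "c1 x k \<in> P 1"
        unfolding c1_def by (intro complex_vector.subspace_diff[OF subP] P1act s1P)
      show "d 0 (c1 x k) = 0"
        unfolding c1_def d0_diff[OF P1act(1)[OF s1P] s1P] P1act(2)[OF s1P]
          s1_sec[OF that] s1_sec[OF Kact[OF that]] by simp
    qed
    \<comment> \<open>The dimension shift: on the kernel K of \<open>\<epsilon>\<close> this is a
      1-cocycle of g[t] with values in Hom(K, V'), so it describes an extension of K by V'.\<close>
    define e where "e x k = \<phi> (c1 x k)" for x k
    have e: "cbilinear e"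
      unfolding cbilinear_def e_def by (intro conjI allI clinear_compose[OF \<phi>] c1)
    have e_coc: "e (lie x y) k = \<sigma> x (e y k) - \<sigma> y (e x k) + e x (\<tau> y k) - e y (\<tau> x k)"
      if "q 0 k = k" "\<epsilon>' k = 0" for x y k
    proof -
      have k: "k \<in> P 0" "\<epsilon> k = 0" using that memP by (auto simp: \<epsilon>'_def)
      have c1_lie: "c1 (lie x y) k = \<tau> x (c1 y k) - \<tau> y (c1 x k) + c1 x (\<tau> y k) - c1 y (\<tau> x k)"
        by (simp add: c1_def lie_module_lie[OF \<tau>] clinear_diff[OF lin\<tau>(1)] clinear_diff[OF s1(1)])
      show ?thesis
        unfolding e_def c1_lie
        by (simp add: clinear_diff[OF \<phi>] clinear_add[OF \<phi>] \<phi>\<tau>[OF c1Z[OF k]])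
    qed
    \<comment> \<open>The functionals test basis vectors only; linearity in \<open>a\<close>,
      \<open>b\<close> and \<open>v\<close> does the rest.\<close>
    have vanish: "e (monom a i) (c0 (monom b j) v) - e (monom b j) (c0 (monom a i) v) = 0"
      if ij: "i + j \<le> 3" for i j a b v
    proof -
      let ?h = "\<lambda>a b v. e (monom a i) (c0 (monom b j) v) - e (monom b j) (c0 (monom a i) v)"
      have line: "clinear (e x)" "clinear (\<lambda>x. e x k)" for x k using e by (auto simp: cbilinear_def)
      have lin: "clinear (?h a b)" "clinear (\<lambda>b. ?h a b v)" "clinear (\<lambda>a. ?h a b v)" for a b v
        by (rule clinear_diff_fun[OF clinear_compose[OF line(1) c0(1)] clinear_compose[OF line(1) c0(1)]],
            rule clinear_diff_fun[OF clinear_compose[OF line(1) clinear_compose[OF c0(2) clinear_monom]]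
              clinear_compose[OF line(2) clinear_monom]],
            rule clinear_diff_fun[OF clinear_compose[OF line(2) clinear_monom]
              clinear_compose[OF line(1) clinear_compose[OF c0(2) clinear_monom]]])
      have "?h a b v = 0" if abv: "a \<in> Bg" "b \<in> Bg" "v \<in> Bv" for a b v
      proof -
        have "crep Bw (?h a b v) w = 0" if w: "w \<in> Bw" for w
        proof -
          have "(i, j, a, b, v, w) \<in> I" using ij abv w by (auto simp: I_def)
          from l0[OF this] show ?thesis by (simp add: l_def e_def \<phi>_def)
        qed
        then show ?thesis using crep_sum[OF Bw(1,2), of "?h a b v"] Bw(3) by simp
      qed
      then have "?h a b v = 0" if "a \<in> Bg" "b \<in> Bg" for a b v
        using clinear_eq_0_on_UNIV[OF lin(1) Bv(3)] that by blast
      then have "?h a b v = 0" if "a \<in> Bg" for a b v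
        using clinear_eq_0_on_UNIV[OF lin(2) Bg(3)] that by blast
      then show ?thesis
        using clinear_eq_0_on_UNIV[OF lin(3) Bg(3)] by blast
    qed
    obtain \<Theta> :: "'g poly \<Rightarrow> 'w \<times> ('b \<Rightarrow>\<^sub>0 'g poly uea) \<Rightarrow> _" where \<Theta>: "lie_module \<Theta>"
      and \<Theta>_snd: "\<And>x w p. snd (\<Theta> x (w, p)) = \<tau> x p"
      and \<Theta>_K: "\<And>x w k. q 0 k = k \<Longrightarrow> \<epsilon>' k = 0 \<Longrightarrow> \<Theta> x (w, k) = (\<sigma> x w + e x k, \<tau> x k)"
    proof (rule ex_twisted_module[OF \<tau> \<rho> \<sigma> q(1)[of 0] _ _ \<epsilon>' _ \<epsilon>q s0(1) _ s0_sec e e_coc])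
      show "q 0 (q 0 p) = q 0 p" for p using q(3,4) by metis
      show "q 0 (\<tau> x p) = \<tau> x (q 0 p)" for x p unfolding \<tau>_def by (rule q(2))
      show "\<epsilon>' (\<tau> x p) = \<rho> x (\<epsilon>' p)" for x p
        unfolding \<tau>_def by (simp add: \<epsilon>'F uea_act(3)[OF \<rho>])
      show "q 0 (s0 v) = s0 v" for v using s0P by (simp add: memP)
      show "e (monom a i) (\<tau> (monom b j) (s0 v) - s0 (\<rho> (monom b j) v)) =
          e (monom b j) (\<tau> (monom a i) (s0 v) - s0 (\<rho> (monom a i) v))" if "i + j \<le> 3" for i j a b v
        using vanish[OF that, of a b v] by (simp add: c0_def)
    qed (use that in blast)+
    define T where "T = uea_act \<Theta>"
    have T: "complex_uea_module T" unfolding T_def by (rule complex_uea_module_uea_act[OF \<Theta>])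
    then have Tm: "uea_module T" by (simp add: complex_uea_module_def)
    have T_gen: "T (uea_gen x) u = \<Theta> x u" for x u unfolding T_def by (rule uea_act[OF \<Theta>])
    have T_snd: "snd (T u z) = ?F u (snd z)" for u z
    proof (induction u arbitrary: z rule: uea_induct)
      case (1 x)
      show ?case using \<Theta>_snd[of x "fst z" "snd z"] by (simp add: T_gen \<tau>_def)
    next
      case (2 c)
      show ?case by (simp add: complex_uea_module_simps(3)[OF T] free_module_act_scalar scaleC_prod_def)
    qed (simp_all add: complex_uea_module_simps(1,2)[OF T] complex_uea_module_simps(1,2)[OF complex_uea_module_free])
    \<comment> \<open>Freeness enters here: lifting each basis element with first component 0
      determines an equivariant section of the projection onto the second factor.\<close>
    define S where "S = free_hom T (\<lambda>k. (0, Poly_Mapping.single k 1))"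
    have S_add: "S (p + p') = S p + S p'" for p p' unfolding S_def by (rule free_hom_add[OF Tm])
    have S_act: "S (?F u p) = T u (S p)" for u p unfolding S_def by (rule free_hom_act[OF Tm])
    have S_single: "S (Poly_Mapping.single k u) = T u (0, Poly_Mapping.single k 1)" for k u
      unfolding S_def by (rule free_hom_single[OF Tm])
    have S_snd: "snd (S p) = p" for p
      by (rule poly_mapping_additive_eqI[where p = p])
        (simp_all add: S_add S_single T_snd free_module_act_single)
    define h where "h p = fst (S p)" for p
    have h: "clinear h"
    proof (rule clinearI)
      show "h (p + p') = h p + h p'" for p p' by (simp add: h_def S_add)
      show "h (c *\<^sub>C p) = c *\<^sub>C h p" for c p
        using S_act[of "uea_scalar c" p]
        by (simp add: h_def free_module_act_scalar complex_uea_module_simps(3)[OF T] scaleC_prod_def)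
    qed
    \<comment> \<open>On the kernel of \<open>\<epsilon>\<close>, \<open>e\<close> is thus the
      coboundary of \<open>h\<close>, so the extension splits.\<close>
    have h\<tau>: "h (\<tau> x k) = \<sigma> x (h k) + e x k" if "k \<in> P 0" "\<epsilon> k = 0" for x k
    proof -
      have k: "q 0 k = k" "\<epsilon>' k = 0" using that by (simp_all add: memP[symmetric] \<epsilon>'_def q(4))
      have "S k = (h k, k)" using S_snd[of k] by (simp add: h_def prod_eq_iff)
      then show ?thesis using \<Theta>_K[OF k, of x "h k"] by (simp add: h_def \<tau>_def S_act T_gen)
    qed
    \<comment> \<open>Subtracting \<open>s1 (D 0 p)\<close> makes the argument of
      \<open>\<phi>\<close> a cycle. The resulting term fails to be equivariant by
      \<open>e x (D 0 p)\<close>, and \<open>h\<close> fails by the same amount, so the difference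
      is a homomorphism.\<close>
    define g where "g p = (if p \<in> P 1 then \<phi> (p - s1 (D 0 p)) - h (D 0 p) else 0)" for p
    have D0K: "D 0 p \<in> P 0" "\<epsilon> (D 0 p) = 0" if "p \<in> P 1" for p
    proof -
      have "d 0 p = D 0 p" using that dD[of p 0] by simp
      then have "D 0 p \<in> d 0 ` P 1" using imageI[OF that, of "d 0"] by simp
      then show "D 0 p \<in> P 0" "\<epsilon> (D 0 p) = 0" unfolding ex0[symmetric] by simp_all
    qed
    have "hom_on (P 1) ?F A g"
    proof (rule hom_on_generators[OF complex_uea_module_free A])
      show "?F u m \<in> P 1" if "m \<in> P 1" for u m by (rule actP[OF that])
      show "g (x + y) = g x + g y" if "x \<in> P 1" "y \<in> P 1" for x y
        using that complex_vector.subspace_add[OF subP that]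
        by (simp add: g_def clinear_add[OF D] clinear_add[OF h] clinear_add[OF \<phi>]
            clinear_diff[OF \<phi>] clinear_add[OF s1(1)])
      show "g (c *\<^sub>C x) = c *\<^sub>C g x" if "x \<in> P 1" for c x
        using that complex_vector.subspace_scale[OF subP that]
        by (simp add: g_def clinear_scale[OF D] clinear_scale[OF h] clinear_scale[OF \<phi>]
            clinear_diff[OF \<phi>] clinear_scale[OF s1(1)] complex_vector.scale_right_diff_distrib)
      show "g (?F (uea_gen x) p) = A (uea_gen x) (g p)" if p: "p \<in> P 1" for x p
      proof -
        let ?k = "D 0 p"
        have Z: "p - s1 ?k \<in> P 1" by (rule complex_vector.subspace_diff[OF subP p s1P])
        have "d 0 p = ?k" using p dD[of p 0] by simp
        then have Z0: "d 0 (p - s1 ?k) = 0"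
          unfolding d0_diff[OF p s1P] s1_sec[OF D0K[OF p]] by simp
        have "\<tau> x p - s1 (\<tau> x ?k) = \<tau> x (p - s1 ?k) + c1 x ?k"
          by (simp add: c1_def clinear_diff[OF lin\<tau>(1)])
        then have 1: "\<phi> (\<tau> x p - s1 (\<tau> x ?k)) = \<sigma> x (\<phi> (p - s1 ?k)) + e x ?k"
          by (simp add: clinear_add[OF \<phi>] \<phi>\<tau>[OF Z Z0] e_def)
        have "g (\<tau> x p) = \<phi> (\<tau> x p - s1 (\<tau> x ?k)) - h (\<tau> x ?k)"
          using P1act[OF p] DF[of 0] by (simp add: g_def \<tau>_def)
        also have "\<dots> = \<sigma> x (g p)"
          using p by (simp add: 1 h\<tau>[OF D0K[OF p]] g_def clinear_diff[OF lie_module_linear[OF \<sigma>]])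
        finally show ?thesis by (simp add: A_gen \<tau>_def)
      qed
    qed
    then have gH: "g \<in> Hom_space (P 1) ?F A" by (simp add: Hom_space_def g_def)
    \<comment> \<open>\<open>D 0\<close> vanishes on boundaries, so there \<open>g\<close> reduces
      to \<open>\<phi>\<close>, which gives back \<open>f\<close>.\<close>
    have "f = (\<lambda>x. if x \<in> P 2 then g (d 1 x) else 0)"
    proof
      fix x
      show "f x = (if x \<in> P 2 then g (d 1 x) else 0)"
      proof (cases "x \<in> P 2")
        case True
        have "D 0 (d 1 x) = 0" using dP1[OF True] dD[of "d 1 x" 0] by simp
        then show ?thesis
          using True dP1(1)[OF True] \<phi>d[OF True] by (simp add: g_def clinear_0[OF s1(1)] clinear_0[OF h])
      qed (simp add: f_out)
    qed
    then show "f \<in> ext_coboundaries P d A 2"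
      unfolding numeral_2_eq_2 One_nat_def ext_coboundaries.simps
      using gH by (intro image_eqI[where x = g]) simp_all
  qed
qed

end

theorem corollary5p1p2:
  fixes H :: "'g::complex_lie_algebra set"
    and \<Delta> :: "('g \<Rightarrow> complex) set"
    and lam\<^sub>1 lam\<^sub>2 \<mu>\<^sub>1 \<mu>\<^sub>2 :: "'g \<Rightarrow> complex"
    and \<rho>\<^sub>1 :: "'g \<Rightarrow> 'v1::complex_vector \<Rightarrow> 'v1" and \<rho>\<^sub>2 :: "'g \<Rightarrow> 'v2::complex_vector \<Rightarrow> 'v2"
    and \<sigma>\<^sub>1 :: "'g \<Rightarrow> 'w1::complex_vector \<Rightarrow> 'w1" and \<sigma>\<^sub>2 :: "'g \<Rightarrow> 'w2::complex_vector \<Rightarrow> 'w2"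
    and a b :: complex
    and V :: "'g poly \<Rightarrow> ('v1, 'v2) tensor \<Rightarrow> ('v1, 'v2) tensor"
    and V' :: "'g poly \<Rightarrow> ('w1, 'w2) tensor \<Rightarrow> ('w1, 'w2) tensor"
    and P :: "nat \<Rightarrow> ('b \<Rightarrow>\<^sub>0 'g poly uea) set"
    and d :: "nat \<Rightarrow> ('b \<Rightarrow>\<^sub>0 'g poly uea) \<Rightarrow> ('b \<Rightarrow>\<^sub>0 'g poly uea)"
    and \<epsilon> :: "('b \<Rightarrow>\<^sub>0 'g poly uea) \<Rightarrow> ('v1, 'v2) tensor"
  assumes "finite_dimensional (UNIV :: 'g set)" and "simple_lie_algebra TYPE('g)"
    and "cartan_subalgebra H" and "simple_roots H \<Delta>"
    and "lam\<^sub>1 \<in> dominant_integral_weights H \<Delta>" and "lam\<^sub>2 \<in> dominant_integral_weights H \<Delta>"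
    and "\<mu>\<^sub>1 \<in> dominant_integral_weights H \<Delta>" and "\<mu>\<^sub>2 \<in> dominant_integral_weights H \<Delta>"
    and "is_V H \<Delta> lam\<^sub>1 \<rho>\<^sub>1" and "is_V H \<Delta> lam\<^sub>2 \<rho>\<^sub>2"
    and "is_V H \<Delta> \<mu>\<^sub>1 \<sigma>\<^sub>1" and "is_V H \<Delta> \<mu>\<^sub>2 \<sigma>\<^sub>2"
    and "a \<noteq> b"
    and "V = tensor_module (ev_pullback a \<rho>\<^sub>1) (ev_pullback b \<rho>\<^sub>2)"
    and "V' = tensor_module (ev_pullback a \<sigma>\<^sub>1) (ev_pullback b \<sigma>\<^sub>2)"
    and "projective_resolution (uea_act V) P d \<epsilon>"
  shows "Ext_finite_dimensional P d (uea_act V') 2"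
proof -
  interpret simple_lie H by unfold_locales (rule assms)+
  show ?thesis
  proof (rule ext2_finite_dimensional[OF _ _ _ _ assms(16)])
    show "lie_module V" "lie_module V'"
      unfolding assms(14,15) using assms(9-12)
      by (auto simp: is_V_def irreducible_lie_module_def
          intro!: lie_module_tensor_module lie_module_ev_pullback)
    show "finite_dimensional (UNIV :: ('v1, 'v2) tensor set)" "finite_dimensional (UNIV :: ('w1, 'w2) tensor set)"
      using assms(9-12) by (auto simp: is_V_def intro: finite_dimensional_tensor)
  qed
qed

end
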